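(* If $\tau:I\to I$ is piecewise monotonic and topologically exact, with associated local homeomorphism $\sigma:X\to X$, then $DG(\tau)$ is simple and has a unique state, given by the unique scaling measure (that is, the state is $[f]\mapsto\int f\,d\mu$, where $\mu$ is the unique probability measure on $X$ scaled by $\sigma$), and $DG(\tau)$ has the strict order given by that state.
   Context: Let $I=[0,1]$. A (not necessarily continuous) map $\tau:I\to I$ is piecewise monotonic if there are points $0=a_0<a_1<\dots<a_n=1$ such that each $\tau|_{(a_{i-1},a_i)}$ is continuous and strictly monotonic; the points are chosen so that no $(a_{i-1},a_i)$ is contained in a larger open interval on which $\tau$ is continuous and strictly monotonic. Then $\{a_0,\dots,a_n\}$ is the partition associated with $\tau$, and $\tau_i:[a_{i-1},a_i]\to I$ denotes the continuous extension of $\tau|_{(a_{i-1},a_i)}$. Actual values of $\tau$ at partition points of discontinuity are ignored: $\widehat\tau(x)$ is the set of left and right limits of $\tau$ at $x$, $\widehat\tau(A)=\bigcup_i\tau_i(A\cap[a_{i-1},a_i])$, and $\widehat\tau^{-1}(A)=\bigcup_i\{x\in[a_{i-1},a_i]:\tau_i(x)\in A\}$. $\tau$ is topologically exact if for every non-empty open $U\subset I$ there is $n$ such that $\widehat\tau^n(U)=I$. The generalized orbit of $x\in I$ is the smallest subset of $I$ containing $x$ that is forward and backward invariant under $\widehat\tau$. $I_1$ is the union of the generalized orbits of $a_0,\dots,a_n$, and $I_0=I\setminus I_1$. $X$ is the totally ordered set obtained from $I$ by replacing each $x\in I_1\setminus\{0,1\}$ by two points $x^-<x^+$, with the order topology (homeomorphic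 to a compact subset of $\mathbb R$); $\pi:X\to I$ is the collapse map ($\pi(x^\pm)=x$), and $X_0=\pi^{-1}(I_0)$. The local homeomorphism associated with $\tau$ is the unique continuous map $\sigma:X\to X$ with $\pi\circ\sigma=\tau\circ\pi$ on $X_0$. Let $(\mathcal L f)(x)=\sum_{\sigma y=x}f(y)$ for $f\in C(X,\mathbb Z)$. $DG(\tau)$ is $C(X,\mathbb Z)$ modulo $f\sim g$ iff $\mathcal L^nf=\mathcal L^ng$ for some $n\ge0$, ordered by $[f]\ge0$ iff $\mathcal L^nf\ge0$ for some $n$; it is a dimension group with distinguished order unit $[1]$. A state on a dimension group $G$ with distinguished order unit $e$ is a positive homomorphism $\omega:G\to\mathbb R$ with $\omega(e)=1$; the strict order given by $\omega$ is: $x\le y$ iff $\omega(x)<\omega(y)$ or $x=y$. A probability measure $\mu$ on $X$ is scaled by $\sigma$ by a factor $s>0$ if $\mu(\sigma(E))=s\mu(E)$ for all Borel sets $E$ on which $\sigma$ is one-to-one; a scaling measure is a probability measure scaled by some factor. *)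

theory Defs
  imports "HOL-Probability.Probability_Measure" "HOL-Algebra.Coset"
begin

section \<open>Piecewise monotonic maps of the unit interval\<close>

definition monotonic_on_interval :: "(real \<Rightarrow> real) \<Rightarrow> real \<Rightarrow> real \<Rightarrow> bool" where
  "monotonic_on_interval \<tau> c d \<longleftrightarrow>
     continuous_on {c<..<d} \<tau> \<and>
     (strict_mono_on {c<..<d} \<tau> \<or> strict_antimono_on {c<..<d} \<tau>)"

definition monotonic_partition :: "(real \<Rightarrow> real) \<Rightarrow> nat \<Rightarrow> (nat \<Rightarrow> real) \<Rightarrow> bool" where
  "monotonic_partition \<tau> n a \<longleftrightarrow>
     a 0 = 0 \<and> a n = 1 \<and> (\<forall>i<n. a i < a (Suc i)) \<and>
     (\<forall>i<n. monotonic_on_interval \<tau> (a i) (a (Suc i)))"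

definition piecewise_monotonic :: "(real \<Rightarrow> real) \<Rightarrow> bool" where
  "piecewise_monotonic \<tau> \<longleftrightarrow>
     \<tau> \<in> {0..1} \<rightarrow> {0..1} \<and> (\<exists>n a. monotonic_partition \<tau> n a)"

text \<open>The values of \<open>a\<close> beyond \<open>n\<close> are irrelevant. Larger intervals are taken inside
  \<open>{0..1}\<close>, since \<open>\<tau>\<close> is meaningless elsewhere.\<close>

definition associated_partition :: "(real \<Rightarrow> real) \<Rightarrow> nat \<Rightarrow> (nat \<Rightarrow> real) \<Rightarrow> bool" where
  "associated_partition \<tau> n a \<longleftrightarrow>
     monotonic_partition \<tau> n a \<and>
     (\<forall>i<n. \<not> (\<exists>c d. 0 \<le> c \<and> d \<le> 1 \<and> {a i<..<a (Suc i)} \<subset> {c<..<d} \<and>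
                      monotonic_on_interval \<tau> c d))"

text \<open>Indices are shifted by one: \<open>branch \<tau> a i\<close>, for \<open>i < n\<close>, is the
  continuous extension of \<open>\<tau>\<close> from \<open>{a i<..<a (Suc i)}\<close> to \<open>{a i..a (Suc i)}\<close>: at interior points
  the limit is the value of \<open>\<tau>\<close>, at the end points it is the one-sided limit from inside.\<close>

definition branch :: "(real \<Rightarrow> real) \<Rightarrow> (nat \<Rightarrow> real) \<Rightarrow> nat \<Rightarrow> real \<Rightarrow> real" where
  "branch \<tau> a i x = Lim (at x within {a i<..<a (Suc i)}) \<tau>"

definition hat_image :: "(real \<Rightarrow> real) \<Rightarrow> nat \<Rightarrow> (nat \<Rightarrow> real) \<Rightarrow> real set \<Rightarrow> real set" where
  "hat_image \<tau> n a A = (\<Union>i<n. branch \<tau> a i ` (A \<inter> {a i..a (Suc i)}))"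

definition hat_vimage :: "(real \<Rightarrow> real) \<Rightarrow> nat \<Rightarrow> (nat \<Rightarrow> real) \<Rightarrow> real set \<Rightarrow> real set" where
  "hat_vimage \<tau> n a A = (\<Union>i<n. {x \<in> {a i..a (Suc i)}. branch \<tau> a i x \<in> A})"

definition topologically_exact :: "(real \<Rightarrow> real) \<Rightarrow> nat \<Rightarrow> (nat \<Rightarrow> real) \<Rightarrow> bool" where
  "topologically_exact \<tau> n a \<longleftrightarrow>
     (\<forall>U. openin (top_of_set {0..1}) U \<and> U \<noteq> {} \<longrightarrow>
          (\<exists>m. (hat_image \<tau> n a ^^ m) U = {0..1}))"

definition generalized_orbit ::
  "(real \<Rightarrow> real) \<Rightarrow> nat \<Rightarrow> (nat \<Rightarrow> real) \<Rightarrow> real \<Rightarrow> real set" where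
  "generalized_orbit \<tau> n a x =
     \<Inter>{S. S \<subseteq> {0..1} \<and> x \<in> S \<and> hat_image \<tau> n a S \<subseteq> S \<and> hat_vimage \<tau> n a S \<subseteq> S}"

definition I1 :: "(real \<Rightarrow> real) \<Rightarrow> nat \<Rightarrow> (nat \<Rightarrow> real) \<Rightarrow> real set" where
  "I1 \<tau> n a = (\<Union>i\<le>n. generalized_orbit \<tau> n a (a i))"

definition I0 :: "(real \<Rightarrow> real) \<Rightarrow> nat \<Rightarrow> (nat \<Rightarrow> real) \<Rightarrow> real set" where
  "I0 \<tau> n a = {0..1} - I1 \<tau> n a"


section \<open>Disconnecting the interval\<close>

text \<open>A split point \<open>x\<close> is represented by \<open>(x, False)\<close> for \<open>x\<^sup>-\<close> and \<open>(x, True)\<close> for \<open>x\<^sup>+\<close>; a point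
  \<open>x\<close> that is not split is represented by \<open>(x, False)\<close>. The collapse map is \<^const>\<open>fst\<close>.\<close>

definition split_points :: "real set \<Rightarrow> (real \<times> bool) set" where
  "split_points D = {0..1} \<times> {False} \<union> (D - {0, 1}) \<times> {True}"

definition split_less :: "real \<times> bool \<Rightarrow> real \<times> bool \<Rightarrow> bool" where
  "split_less p q \<longleftrightarrow> fst p < fst q \<or> (fst p = fst q \<and> \<not> snd p \<and> snd q)"

text \<open>The order topology on \<open>split_points D\<close>; the open rays alone already cover, because
  there is a least and a greatest point and they are distinct.\<close>

definition split_topology :: "real set \<Rightarrow> (real \<times> bool) topology" where
  "split_topology D = topology_generated_by
     ((\<lambda>p. {q \<in> split_points D. split_less q p}) ` split_points D \<union>
      (\<lambda>p. {q \<in> split_points D. split_less p q}) ` split_points D)"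

definition X_top :: "(real \<Rightarrow> real) \<Rightarrow> nat \<Rightarrow> (nat \<Rightarrow> real) \<Rightarrow> (real \<times> bool) topology" where
  "X_top \<tau> n a = split_topology (I1 \<tau> n a)"

definition associated_map ::
  "(real \<Rightarrow> real) \<Rightarrow> nat \<Rightarrow> (nat \<Rightarrow> real) \<Rightarrow> (real \<times> bool \<Rightarrow> real \<times> bool) \<Rightarrow> bool" where
  "associated_map \<tau> n a \<sigma> \<longleftrightarrow>
     continuous_map (X_top \<tau> n a) (X_top \<tau> n a) \<sigma> \<and>
     (\<forall>p \<in> topspace (X_top \<tau> n a). fst p \<in> I0 \<tau> n a \<longrightarrow> fst (\<sigma> p) = \<tau> (fst p))"


section \<open>Ordered abelian groups with order unit\<close>

text \<open>The group operation is written multiplicatively, as always in HOL-Algebra.\<close>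

record 'a unital_ordered_group = "'a monoid" +
  pos_cone :: "'a set"
  order_unit :: 'a

definition group_le :: "('a, 'b) unital_ordered_group_scheme \<Rightarrow> 'a \<Rightarrow> 'a \<Rightarrow> bool" where
  "group_le G x y \<longleftrightarrow> y \<otimes>\<^bsub>G\<^esub> inv\<^bsub>G\<^esub> x \<in> pos_cone G"

definition order_ideal :: "('a, 'b) unital_ordered_group_scheme \<Rightarrow> 'a set \<Rightarrow> bool" where
  "order_ideal G J \<longleftrightarrow>
     subgroup J G \<and>
     (\<forall>x\<in>J. \<exists>y \<in> J \<inter> pos_cone G. \<exists>z \<in> J \<inter> pos_cone G. x = y \<otimes>\<^bsub>G\<^esub> inv\<^bsub>G\<^esub> z) \<and>
     (\<forall>x \<in> carrier G. \<forall>y\<in>J. group_le G \<one>\<^bsub>G\<^esub> x \<and> group_le G x y \<longrightarrow> x \<in> J)"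

definition simple_ordered_group :: "('a, 'b) unital_ordered_group_scheme \<Rightarrow> bool" where
  "simple_ordered_group G \<longleftrightarrow>
     (\<forall>J. order_ideal G J \<longrightarrow> J = {\<one>\<^bsub>G\<^esub>} \<or> J = carrier G)"

definition real_add_group :: "real monoid" where
  "real_add_group = \<lparr>carrier = UNIV, monoid.mult = (+), one = 0\<rparr>"

text \<open>Extensionality makes equality of states agree with equality on the carrier.\<close>

definition state :: "('a, 'b) unital_ordered_group_scheme \<Rightarrow> ('a \<Rightarrow> real) \<Rightarrow> bool" where
  "state G \<omega> \<longleftrightarrow>
     \<omega> \<in> extensional (carrier G) \<and> \<omega> \<in> hom G real_add_group \<and>
     (\<forall>x \<in> pos_cone G. 0 \<le> \<omega> x) \<and> \<omega> (order_unit G) = 1"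

definition has_strict_order :: "('a, 'b) unital_ordered_group_scheme \<Rightarrow> ('a \<Rightarrow> real) \<Rightarrow> bool" where
  "has_strict_order G \<omega> \<longleftrightarrow>
     (\<forall>x \<in> carrier G. \<forall>y \<in> carrier G. group_le G x y \<longleftrightarrow> \<omega> x < \<omega> y \<or> x = y)"


section \<open>The dimension group of a map\<close>

text \<open>Integer-valued continuous functions are normalised to vanish off the space, so that equality
  of functions is equality on the space.\<close>

definition C_int :: "'a topology \<Rightarrow> ('a \<Rightarrow> int) set" where
  "C_int X = {f. continuous_map X (discrete_topology UNIV) f \<and> (\<forall>x. x \<notin> topspace X \<longrightarrow> f x = 0)}"

definition transfer :: "'a topology \<Rightarrow> ('a \<Rightarrow> 'a) \<Rightarrow> ('a \<Rightarrow> int) \<Rightarrow> 'a \<Rightarrow> int" where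
  "transfer X \<sigma> f x =
     (if x \<in> topspace X then \<Sum>y | y \<in> topspace X \<and> \<sigma> y = x. f y else 0)"

definition DG_rel :: "'a topology \<Rightarrow> ('a \<Rightarrow> 'a) \<Rightarrow> (('a \<Rightarrow> int) \<times> ('a \<Rightarrow> int)) set" where
  "DG_rel X \<sigma> = {(f, g). f \<in> C_int X \<and> g \<in> C_int X \<and>
     (\<exists>n. (transfer X \<sigma> ^^ n) f = (transfer X \<sigma> ^^ n) g)}"

definition DG_class :: "'a topology \<Rightarrow> ('a \<Rightarrow> 'a) \<Rightarrow> ('a \<Rightarrow> int) \<Rightarrow> ('a \<Rightarrow> int) set" where
  "DG_class X \<sigma> f = DG_rel X \<sigma> `` {f}"

definition DG :: "'a topology \<Rightarrow> ('a \<Rightarrow> 'a) \<Rightarrow> ('a \<Rightarrow> int) set unital_ordered_group" where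
  "DG X \<sigma> = \<lparr>
     carrier = C_int X // DG_rel X \<sigma>,
     monoid.mult = (\<lambda>A B. \<Union>f\<in>A. \<Union>g\<in>B. DG_class X \<sigma> (\<lambda>x. f x + g x)),
     one = DG_class X \<sigma> (\<lambda>x. 0),
     pos_cone = {DG_class X \<sigma> f | f. f \<in> C_int X \<and> (\<exists>n. \<forall>x. 0 \<le> (transfer X \<sigma> ^^ n) f x)},
     order_unit = DG_class X \<sigma> (indicator (topspace X))\<rparr>"


section \<open>Scaling measures\<close>

definition borel_on :: "'a topology \<Rightarrow> 'a measure" where
  "borel_on X = sigma (topspace X) {U. openin X U}"

definition scaled_by :: "'a topology \<Rightarrow> ('a \<Rightarrow> 'a) \<Rightarrow> real \<Rightarrow> 'a measure \<Rightarrow> bool" where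
  "scaled_by X \<sigma> s \<mu> \<longleftrightarrow>
     prob_space \<mu> \<and> sets \<mu> = sets (borel_on X) \<and>
     (\<forall>E \<in> sets \<mu>. inj_on \<sigma> E \<longrightarrow> measure \<mu> (\<sigma> ` E) = s * measure \<mu> E)"

definition scaling_measure :: "'a topology \<Rightarrow> ('a \<Rightarrow> 'a) \<Rightarrow> 'a measure \<Rightarrow> bool" where
  "scaling_measure X \<sigma> \<mu> \<longleftrightarrow> (\<exists>s>0. scaled_by X \<sigma> s \<mu>)"

end

theory Submission
  imports Defs
begin

text \<open>Order intervals of \<open>X\<close> with end points in \<open>I\<^sub>1\<close> (cells) are carried to cells by \<open>\<sigma>\<close> on each branch. A
  compactness argument gives a positive functional \<open>m\<close> with \<open>m (L f) = s * m f\<close>, where \<open>L\<close> is the transfer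
  operator. Writing \<open>L\<^sup>N f\<close> as a nonnegative combination of indicators of cells, all but two of the
  pieces that a cell contributes are images of full members of a fixed finite partition; hence the
  total weight is eventually comparable to \<open>m (L\<^sup>N f)\<close>, so a definite proportion of the mass sits on cells
  bounded below in size, and exactness spreads it over all of \<open>X\<close>. This yields \<open>L\<^sup>n h \<ge> c * s\<^sup>n * m h\<close> for some
  \<open>n\<close>, with \<open>c > 0\<close> the same for all step functions \<open>h \<ge> 0\<close>. Applied to the difference of \<open>L\<^sup>n f\<close> and the best
  multiple of \<open>L\<^sup>n 1\<close> below it, this contracts the gap to \<open>m f\<close>, so that \<open>m f > 0\<close> forces \<open>L\<^sup>n f \<ge> 0\<close>
  eventually. The strict order, simplicity and uniqueness of the state and of the scaling measure
  all follow from this, and \<open>m\<close> extends to the scaling measure by Caratheodory's theorem.\<close>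

section \<open>Transfer operators of piecewise injective maps\<close>

text \<open>The branches need not be onto, so iterates of \<open>L\<close> cannot be read off a
  transition matrix: the two ends of a cell leave pieces whose images have no lower bound on their
  size. These pieces cost a factor 2 in weight per block of \<open>N\<close> iterations, whatever
  \<open>N\<close> is, whereas mass grows by \<open>s ^ N\<close>; taking
  \<open>4 \<le> s ^ N\<close> lets mass win. No smoothness of \<open>\<tau>\<close> enters, since
  all sizes are measured by \<open>m\<close>, which is positive on nonempty cells by exactness.

  The functional is built on all bounded functions, where the resolvents of \<open>L\<close> make
  sense before any smaller invariant space has been identified. Step functions are real-valued
  although the group consists of integer-valued ones, because the approximation subtracts real
  multiples of \<open>one\<close>. Finally, \<open>\<sigma>\<close> is given by
  \<open>\<tau>\<close> only at unsplit points; elsewhere everything comes from the density of these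
  points, the continuity of \<open>\<sigma>\<close> and the openness of cells.\<close>

definition bounded_on :: "'a set \<Rightarrow> ('a \<Rightarrow> real) \<Rightarrow> bool" where
  "bounded_on X f \<longleftrightarrow> (\<exists>c. \<forall>x\<in>X. \<bar>f x\<bar> \<le> c)"

lemma bounded_onI: "(\<And>x. x \<in> X \<Longrightarrow> \<bar>f x\<bar> \<le> c) \<Longrightarrow> bounded_on X f"
  by (auto simp: bounded_on_def)

lemma bounded_onE:
  assumes "bounded_on X f"
  obtains c where "0 \<le> c" "\<And>x. x \<in> X \<Longrightarrow> \<bar>f x\<bar> \<le> c"
proof -
  obtain c where c: "\<forall>x\<in>X. \<bar>f x\<bar> \<le> c" using assms by (auto simp: bounded_on_def)
  show thesis by (rule that[of "\<bar>c\<bar>"]) (use c in force)+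
qed

lemma bounded_on_add:
  assumes "bounded_on X f" "bounded_on X g"
  shows "bounded_on X (\<lambda>x. f x + g x)"
proof -
  obtain c d where "\<And>x. x \<in> X \<Longrightarrow> \<bar>f x\<bar> \<le> c" "\<And>x. x \<in> X \<Longrightarrow> \<bar>g x\<bar> \<le> d"
    using assms by (auto simp: bounded_on_def)
  then show ?thesis by (intro bounded_onI[where c="c + d"]) fastforce
qed

lemma bounded_on_cmult:
  assumes "bounded_on X f"
  shows "bounded_on X (\<lambda>x. c * f x)"
proof -
  obtain d where "\<And>x. x \<in> X \<Longrightarrow> \<bar>f x\<bar> \<le> d"
    using assms by (auto simp: bounded_on_def)
  then show ?thesis by (intro bounded_onI[where c="\<bar>c\<bar> * d"]) (auto simp: abs_mult mult_left_mono)
qed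

lemma bounded_on_diff:
  assumes "bounded_on X f" "bounded_on X g"
  shows "bounded_on X (\<lambda>x. f x - g x)"
  using bounded_on_add[OF assms(1) bounded_on_cmult[OF assms(2), of "-1"]] by simp

lemma bounded_on_indicator [simp]: "bounded_on X (indicator K)"
  by (rule bounded_onI[where c=1]) (auto simp: indicator_def)

locale piecewise_injective =
  fixes X :: "'a set" and \<sigma> :: "'a \<Rightarrow> 'a" and P :: "'a set set"
  assumes finite_P: "finite P" and Union_P: "\<Union>P = X" and disjoint_P: "disjoint P"
    and inj_P: "\<And>B. B \<in> P \<Longrightarrow> inj_on \<sigma> B"
    and maps: "\<And>x. x \<in> X \<Longrightarrow> \<sigma> x \<in> X"
begin

definition L :: "('a \<Rightarrow> real) \<Rightarrow> 'a \<Rightarrow> real" where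
  "L f x = (if x \<in> X then \<Sum>y | y \<in> X \<and> \<sigma> y = x. f y else 0)"

text \<open>Each member of \<open>P\<close> contains at most one point of a fibre, since
  \<open>\<sigma>\<close> is injective on it.\<close>

lemma finite_fibre: "finite {y \<in> X. \<sigma> y = x}"
  and card_fibre: "card {y \<in> X. \<sigma> y = x} \<le> card P"
proof -
  let ?F = "{y \<in> X. \<sigma> y = x}"
  have "\<forall>y\<in>?F. \<exists>B\<in>P. y \<in> B" using Union_P by auto
  then obtain b where b: "\<And>y. y \<in> ?F \<Longrightarrow> b y \<in> P \<and> y \<in> b y" by metis
  have "inj_on b ?F"
    by (rule inj_onI) (smt (verit) b inj_P inj_onD mem_Collect_eq)
  moreover have "b ` ?F \<subseteq> P" using b by auto
  ultimately show "finite ?F" "card ?F \<le> card P"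
    using finite_P by (auto intro: inj_on_finite card_inj_on_le)
qed

lemma L_add: "L (\<lambda>x. f x + g x) = (\<lambda>x. L f x + L g x)"
  by (auto simp: L_def sum.distrib)

lemma L_cmult: "L (\<lambda>x. c * f x) = (\<lambda>x. c * L f x)"
  by (auto simp: L_def sum_distrib_left)

lemma L_diff: "L (\<lambda>x. f x - g x) = (\<lambda>x. L f x - L g x)"
  by (auto simp: L_def sum_subtractf)

lemma L_mono: "(\<And>y. y \<in> X \<Longrightarrow> f y \<le> g y) \<Longrightarrow> L f x \<le> L g x"
  by (auto simp: L_def intro!: sum_mono)

lemma Ln_add: "(L ^^ n) (\<lambda>x. f x + g x) = (\<lambda>x. (L ^^ n) f x + (L ^^ n) g x)"
  by (induction n) (auto simp: L_add)

lemma Ln_cmult: "(L ^^ n) (\<lambda>x. c * f x) = (\<lambda>x. c * (L ^^ n) f x)"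
  by (induction n) (auto simp: L_cmult)

lemma Ln_diff: "(L ^^ n) (\<lambda>x. f x - g x) = (\<lambda>x. (L ^^ n) f x - (L ^^ n) g x)"
  by (induction n) (auto simp: L_diff)

lemma Ln_zero: "(L ^^ n) (\<lambda>x. 0) = (\<lambda>x. 0)"
  using Ln_cmult[of n 0 "\<lambda>x. 0"] by simp

lemma Ln_sum: "finite F \<Longrightarrow> (L ^^ n) (\<lambda>x. \<Sum>i\<in>F. f i x) = (\<lambda>x. \<Sum>i\<in>F. (L ^^ n) (f i) x)"
  by (induction F rule: finite_induct) (auto simp: Ln_add Ln_zero)

lemma Ln_mono: "(\<And>y. y \<in> X \<Longrightarrow> f y \<le> g y) \<Longrightarrow> x \<in> X \<Longrightarrow> (L ^^ n) f x \<le> (L ^^ n) g x"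
  by (induction n arbitrary: x) (auto intro: L_mono)

lemma Ln_nonneg: "(\<And>y. y \<in> X \<Longrightarrow> 0 \<le> f y) \<Longrightarrow> x \<in> X \<Longrightarrow> 0 \<le> (L ^^ n) f x"
  using Ln_mono[of "\<lambda>_. 0" f x n] by (simp add: Ln_zero)

abbreviation one :: "'a \<Rightarrow> real" where "one \<equiv> indicator X"

lemma Ln_nonneg_one: "x \<in> X \<Longrightarrow> 0 \<le> (L ^^ n) one x"
  by (rule Ln_nonneg) auto

lemma Ln_abs_le:
  assumes "\<And>x. x \<in> X \<Longrightarrow> \<bar>f x\<bar> \<le> c" "x \<in> X"
  shows "\<bar>(L ^^ n) f x\<bar> \<le> c * (L ^^ n) one x"
proof -
  have "(L ^^ n) f x \<le> (L ^^ n) (\<lambda>x. c * one x) x"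
    using assms by (intro Ln_mono) (force simp: abs_le_iff)+
  moreover have "(L ^^ n) (\<lambda>x. (- c) * one x) x \<le> (L ^^ n) f x"
    using assms by (intro Ln_mono) (force simp: abs_le_iff)+
  ultimately show ?thesis using Ln_cmult[of n "- c" one] Ln_cmult[of n c one] by simp
qed

lemma L_one_le: "L one x \<le> card P"
proof (cases "x \<in> X")
  case True
  have "L one x = card {y \<in> X. \<sigma> y = x}"
    using True finite_fibre[of x] by (simp add: L_def indicator_def)
  then show ?thesis using card_fibre[of x] by simp
qed (simp add: L_def)

lemma Ln_one_le: "x \<in> X \<Longrightarrow> (L ^^ n) one x \<le> card P ^ n"
proof (induction n arbitrary: x)
  case (Suc n)
  have "L ((L ^^ n) one) x \<le> L (\<lambda>x. real (card P ^ n) * one x) x"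
    using Suc.IH by (intro L_mono) auto
  also have "\<dots> = real (card P ^ n) * L one x" by (simp only: L_cmult)
  also have "\<dots> \<le> real (card P ^ n) * real (card P)" by (rule mult_left_mono[OF L_one_le]) auto
  finally show ?case by (simp add: mult.commute)
qed simp

lemma bounded_Ln:
  assumes "bounded_on X f"
  shows "bounded_on X ((L ^^ n) f)"
proof -
  obtain c where c: "0 \<le> c" "\<And>x. x \<in> X \<Longrightarrow> \<bar>f x\<bar> \<le> c"
    using assms by (rule bounded_onE) auto
  have "\<bar>(L ^^ n) f x\<bar> \<le> c * card P ^ n" if "x \<in> X" for x
    using Ln_abs_le[of f c x n] c that mult_left_mono[OF Ln_one_le[of x n] c(1)] by fastforce
  then show ?thesis by (rule bounded_onI)
qed

lemma bounded_L: "bounded_on X f \<Longrightarrow> bounded_on X (L f)"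
  using bounded_Ln[of f 1] by simp

lemma L_indicator_inj:
  assumes "K \<subseteq> X" "inj_on \<sigma> K"
  shows "L (indicator K) = indicator (\<sigma> ` K)"
proof
  fix x
  have *: "L (indicator K) x = real (card {y \<in> K. \<sigma> y = x})" if "x \<in> X"
  proof -
    have "{y \<in> X. \<sigma> y = x} \<inter> K = {y \<in> K. \<sigma> y = x}" using assms by auto
    then show ?thesis using that finite_fibre[of x]
      by (simp add: L_def indicator_def sum.inter_restrict[symmetric] Int_def)
  qed
  show "L (indicator K) x = indicator (\<sigma> ` K) x"
  proof (cases "x \<in> \<sigma> ` K")
    case True
    then obtain y where y: "y \<in> K" "x = \<sigma> y" by auto
    then have "{y \<in> K. \<sigma> y = x} = {y}" using assms(2) by (auto dest: inj_onD)
    then show ?thesis using * True y assms(1) maps by auto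
  next
    case False
    then have e: "{y \<in> K. \<sigma> y = x} = {}" by auto
    show ?thesis
    proof (cases "x \<in> X")
      case True
      then show ?thesis using *[OF True] e False by (simp only: card.empty) simp
    qed (use False in \<open>simp add: L_def\<close>)
  qed
qed

lemma indicator_decomp:
  assumes "finite Q" "disjoint Q" "K \<subseteq> \<Union>Q"
  shows "indicator K = (\<lambda>x. \<Sum>B\<in>Q. indicator (K \<inter> B) x :: real)"
proof
  fix x
  show "indicator K x = (\<Sum>B\<in>Q. indicator (K \<inter> B) x :: real)"
  proof (cases "x \<in> K")
    case True
    then obtain B where B: "B \<in> Q" "x \<in> B" using assms by auto
    have "(\<Sum>C\<in>Q. indicator (K \<inter> C) x :: real) = (\<Sum>C\<in>Q. if C = B then 1 else 0)"
    proof (rule sum.cong)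
      fix C assume "C \<in> Q"
      then show "indicator (K \<inter> C) x = (if C = B then 1 else 0 :: real)"
        using B True assms(2) by (auto simp: indicator_def disjoint_def)
    qed simp
    then show ?thesis using assms(1) B True by simp
  qed auto
qed

text \<open>\<open>y\<close> is one of the points over which \<open>(L ^^ n) f\<close> sums at
  \<open>(\<sigma> ^^ n) y\<close>. This turns the reaching of a point by an orbit into a lower
  bound for iterates of \<open>L\<close>.\<close>

lemma Ln_point_le:
  assumes "\<And>x. x \<in> X \<Longrightarrow> 0 \<le> f x" "y \<in> X"
  shows "f y \<le> (L ^^ n) f ((\<sigma> ^^ n) y)"
proof (induction n)
  case (Suc n)
  have y: "(\<sigma> ^^ n) y \<in> X" for n by (induction n) (use assms maps in auto)
  have "(L ^^ n) f ((\<sigma> ^^ n) y) \<le> L ((L ^^ n) f) (\<sigma> ((\<sigma> ^^ n) y))"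
    using y maps finite_fibre Ln_nonneg[of f, OF assms(1)]
    by (auto simp: L_def intro!: member_le_sum)
  with Suc show ?case by simp
qed simp

end

text \<open>The functionals below live in a product over uncountably many functions, where a
  sequence need not have a convergent subsequence. A cluster point that inherits all closed
  conditions is enough.\<close>

lemma closed_cluster:
  fixes S :: "'b::topological_space set"
  assumes "compact S" "\<And>k::nat. u k \<in> S"
  obtains v where "v \<in> S" "\<And>C. closed C \<Longrightarrow> eventually (\<lambda>k. u k \<in> C) sequentially \<Longrightarrow> v \<in> C"
proof -
  define F where "F = filtermap u sequentially"
  have "F \<noteq> bot" by (simp add: F_def filtermap_bot_iff)
  moreover have "eventually (\<lambda>x. x \<in> S) F" using assms by (simp add: F_def eventually_filtermap)
  ultimately obtain v where v: "v \<in> S" "inf (nhds v) F \<noteq> bot"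
    using assms(1) unfolding compact_filter by blast
  have "v \<in> C" if C: "closed C" "eventually (\<lambda>k. u k \<in> C) sequentially" for C
  proof (rule ccontr)
    assume "v \<notin> C"
    then have "eventually (\<lambda>x. x \<in> - C) (nhds v)"
      using C by (intro eventually_nhds_in_open) (auto simp: closed_def)
    moreover have "eventually (\<lambda>x. x \<in> C) F" using C by (simp add: F_def eventually_filtermap)
    ultimately have "eventually (\<lambda>x. False) (inf (nhds v) F)"
      unfolding eventually_inf by (metis (mono_tags, lifting) ComplD)
    then show False using v by (simp add: eventually_False)
  qed
  with v that show thesis by blast
qed

lemma closed_coordinate:
  fixes C :: "real set"
  assumes "closed C" "continuous_on UNIV g"
  shows "closed {\<phi> :: 'b \<Rightarrow> real. g \<phi> \<in> C}"
  using closed_vimage[OF assms] by (simp add: vimage_def)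

section \<open>The resolvent of the transfer operator and an eigenfunctional\<close>

context piecewise_injective
begin

text \<open>As \<open>L\<close> is positive, this series for \<open>one\<close> dominates that of
  every bounded function; in effect \<open>t\<close> is above the spectral radius of
  \<open>L\<close>.\<close>

definition bounded_resolvent :: "real \<Rightarrow> bool" where
  "bounded_resolvent t \<longleftrightarrow>
     0 < t \<and> (\<exists>b. \<forall>x\<in>X. \<forall>N. (\<Sum>n<N. (L ^^ n) one x / t ^ n) \<le> b)"

text \<open>The Neumann series of \<open>t (t - L)^(-1)\<close>, taken pointwise.\<close>

definition resolvent :: "real \<Rightarrow> ('a \<Rightarrow> real) \<Rightarrow> 'a \<Rightarrow> real" where
  "resolvent t f x = (\<Sum>n. (L ^^ n) f x / t ^ n)"

lemma bounded_resolvent_mono: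
  assumes "bounded_resolvent t" "t \<le> u"
  shows "bounded_resolvent u"
proof -
  obtain b where b: "\<And>x N. x \<in> X \<Longrightarrow> (\<Sum>n<N. (L ^^ n) one x / t ^ n) \<le> b" and t: "0 < t"
    using assms by (auto simp: bounded_resolvent_def)
  have "(\<Sum>n<N. (L ^^ n) one x / u ^ n) \<le> b" if "x \<in> X" for x N
  proof -
    have "(\<Sum>n<N. (L ^^ n) one x / u ^ n) \<le> (\<Sum>n<N. (L ^^ n) one x / t ^ n)"
      using t assms(2) Ln_nonneg_one[OF that]
      by (intro sum_mono divide_left_mono power_mono) auto
    also have "\<dots> \<le> b" by (rule b[OF that])
    finally show ?thesis .
  qed
  then show ?thesis using t assms(2) unfolding bounded_resolvent_def by (meson less_le_trans)
qed

lemma bounded_resolvent_large: "bounded_resolvent (2 * (real (card P) + 1))"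
proof -
  \<comment> \<open>The summand 1 keeps \<open>c\<close> positive when \<open>P\<close> is empty;
    the factor 2 produces the geometric ratio 1/2.\<close>
  define c where "c = real (card P) + 1"
  have c: "c > 0" by (simp add: c_def add_nonneg_pos)
  have "(\<Sum>n<N. (L ^^ n) one x / (2 * c) ^ n) \<le> 2" if x: "x \<in> X" for x N
  proof -
    have "(\<Sum>n<N. (L ^^ n) one x / (2 * c) ^ n) \<le> (\<Sum>n<N. (1/2) ^ n)"
    proof (rule sum_mono)
      fix n
      have "(L ^^ n) one x \<le> real (card P) ^ n" using Ln_one_le[OF x, of n] by simp
      also have "\<dots> \<le> c ^ n" by (intro power_mono) (auto simp: c_def)
      finally show "(L ^^ n) one x / (2 * c) ^ n \<le> (1/2) ^ n"
        using c by (simp add: field_simps power_mult_distrib)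
    qed
    also have "\<dots> \<le> (\<Sum>n. (1/2 :: real) ^ n)"
      by (intro sum_le_suminf summable_geometric) auto
    also have "\<dots> = 2" by (simp add: suminf_geometric)
    finally show ?thesis .
  qed
  then show ?thesis using c unfolding bounded_resolvent_def c_def[symmetric] by auto
qed

lemma summable_resolvent:
  assumes "bounded_resolvent t" "bounded_on X f" "x \<in> X"
  shows "summable (\<lambda>n. (L ^^ n) f x / t ^ n)"
proof -
  obtain b where b: "\<And>N. (\<Sum>n<N. (L ^^ n) one x / t ^ n) \<le> b" and t: "0 < t"
    using assms by (auto simp: bounded_resolvent_def)
  obtain c where c: "0 \<le> c" "\<And>x. x \<in> X \<Longrightarrow> \<bar>f x\<bar> \<le> c"
    using assms(2) by (rule bounded_onE) auto
  have s: "summable (\<lambda>n. (L ^^ n) one x / t ^ n)"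
    using t b Ln_nonneg_one[OF assms(3)]
    by (intro summableI_nonneg_bounded[where x=b]) auto
  show ?thesis
  proof (rule summable_comparison_test'[OF summable_mult[OF s, of c]])
    fix n
    show "norm ((L ^^ n) f x / t ^ n) \<le> c * ((L ^^ n) one x / t ^ n)"
      using Ln_abs_le[of f c x n] c assms(3) t by (simp add: divide_right_mono)
  qed
qed

text \<open>Removing the term of index 0 shifts the series. The defect \<open>t * f x\<close> stays
  bounded, so it disappears after division by a normaliser that tends to infinity.\<close>

lemma resolvent_L:
  assumes "bounded_resolvent t" "bounded_on X f" "x \<in> X"
  shows "resolvent t (L f) x = t * (resolvent t f x - f x)"
proof -
  have t: "0 < t" using assms by (auto simp: bounded_resolvent_def)
  note s = summable_resolvent[OF assms]
  have e: "(\<Sum>n. (L ^^ Suc n) f x / t ^ Suc n) = resolvent t f x - f x"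
    using suminf_split_head[OF s] by (simp add: resolvent_def)
  have "(\<lambda>n. (L ^^ Suc n) f x / t ^ Suc n) = (\<lambda>n. (1 / t) * ((L ^^ n) (L f) x / t ^ n))"
    by (simp add: funpow_Suc_right del: funpow.simps)
  from e[unfolded this] have "(1 / t) * resolvent t (L f) x = resolvent t f x - f x"
    using suminf_mult[OF summable_resolvent[OF assms(1) bounded_L[OF assms(2)] assms(3)], of "1/t"]
    by (simp only: resolvent_def)
  then show ?thesis using t by (simp add: field_simps)
qed

lemma resolvent_add:
  assumes "bounded_resolvent t" "bounded_on X f" "bounded_on X g" "x \<in> X"
  shows "resolvent t (\<lambda>x. f x + g x) x = resolvent t f x + resolvent t g x"
  using suminf_add[OF summable_resolvent[OF assms(1,2,4)] summable_resolvent[OF assms(1,3,4)]]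
  by (simp add: resolvent_def Ln_add add_divide_distrib)

lemma resolvent_cmult:
  assumes "bounded_resolvent t" "bounded_on X f" "x \<in> X"
  shows "resolvent t (\<lambda>x. c * f x) x = c * resolvent t f x"
  using suminf_mult[OF summable_resolvent[OF assms], of c]
  by (simp add: resolvent_def Ln_cmult)

lemma resolvent_mono:
  assumes "bounded_resolvent t" "bounded_on X f" "bounded_on X g" "x \<in> X"
    "\<And>y. y \<in> X \<Longrightarrow> f y \<le> g y"
  shows "resolvent t f x \<le> resolvent t g x"
  unfolding resolvent_def
proof (intro suminf_le summable_resolvent)
  have "0 < t" using assms by (auto simp: bounded_resolvent_def)
  then show "(L ^^ n) f x / t ^ n \<le> (L ^^ n) g x / t ^ n" for n
    using Ln_mono[of f g x n] assms(4,5) by (simp add: divide_right_mono)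
qed (use assms in auto)

lemma resolvent_one_ge:
  assumes "bounded_resolvent t" "x \<in> X"
  shows "(\<Sum>n<N. (L ^^ n) one x / t ^ n) \<le> resolvent t one x"
  unfolding resolvent_def
  using assms Ln_nonneg_one[OF assms(2)]
  by (intro sum_le_suminf summable_resolvent) (auto simp: bounded_resolvent_def)

text \<open>The resolvent \<open>F\<close> of \<open>one\<close> satisfies \<open>L F \<le> q t F\<close> with \<open>q < 1\<close>, so that
  the partial sums stay bounded for parameters slightly smaller than \<open>t\<close>.\<close>
lemma bounded_resolvent_open:
  assumes "bounded_resolvent t"
  shows "\<exists>u<t. bounded_resolvent u"
proof -
  obtain b0 where b0: "\<And>x N. x \<in> X \<Longrightarrow> (\<Sum>n<N. (L ^^ n) one x / t ^ n) \<le> b0" and t: "0 < t"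
    using assms by (auto simp: bounded_resolvent_def)
  \<comment> \<open>Raising the bound to at least 1 makes \<open>q\<close> below
    nonnegative.\<close>
  define b where "b = max b0 1"
  define F where "F = resolvent t one"
  have b: "b \<ge> 1" by (simp add: b_def)
  have Fb: "F x \<le> b" if "x \<in> X" for x
    unfolding F_def resolvent_def
    by (rule suminf_le_const[OF summable_resolvent[OF assms _ that]])
       (auto intro: order.trans[OF b0[OF that]] simp: b_def)
  have F1: "1 \<le> F x" if "x \<in> X" for x
    using resolvent_one_ge[OF assms that, of 1] that by (simp add: F_def)
  have Fbd: "bounded_on X F"
    using F1 Fb by (intro bounded_onI[where c=b]) force
  define q where "q = 1 - 1 / b"
  have q: "0 \<le> q" "q < 1" using b by (auto simp: q_def)
  have LF: "L F x \<le> q * t * F x" if x: "x \<in> X" for x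
  proof -
    have "L F x = (\<Sum>y | y \<in> X \<and> \<sigma> y = x. \<Sum>n. (L ^^ n) one y / t ^ n)"
      using x by (simp add: L_def F_def resolvent_def)
    also have "\<dots> = (\<Sum>n. \<Sum>y | y \<in> X \<and> \<sigma> y = x. (L ^^ n) one y / t ^ n)"
      by (rule suminf_sum[symmetric]) (auto intro: summable_resolvent[OF assms])
    also have "\<dots> = (\<Sum>n. (L ^^ n) (L one) x / t ^ n)"
    proof (rule arg_cong[where f=suminf], rule ext)
      fix n
      have "(L ^^ n) (L one) x = L ((L ^^ n) one) x" by (simp add: funpow_swap1)
      also have "\<dots> = (\<Sum>y | y \<in> X \<and> \<sigma> y = x. (L ^^ n) one y)" using x by (simp add: L_def)
      finally show "(\<Sum>y | y \<in> X \<and> \<sigma> y = x. (L ^^ n) one y / t ^ n) = (L ^^ n) (L one) x / t ^ n"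
        by (simp add: sum_divide_distrib)
    qed
    also have "\<dots> = t * (F x - 1)"
      using resolvent_L[OF assms _ x, of one] x by (simp add: resolvent_def F_def)
    \<comment> \<open>Since \<open>F \<le> b\<close>, the constant 1 is at least the fraction
      \<open>1 / b\<close> of \<open>F\<close>; this is the origin of \<open>q\<close>.\<close>
    also have "\<dots> \<le> t * (F x - F x / b)"
      using t b Fb[OF x] by (intro mult_left_mono) (auto simp: field_simps)
    also have "\<dots> = q * t * F x" by (simp add: q_def algebra_simps)
    finally show ?thesis .
  qed
  have LnF: "(L ^^ n) F x \<le> (q * t) ^ n * F x" if "x \<in> X" for n x
    using that
  proof (induction n arbitrary: x)
    case (Suc n)
    have "L ((L ^^ n) F) x \<le> L (\<lambda>y. (q * t) ^ n * F y) x"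
      by (intro L_mono Suc.IH)
    also have "\<dots> = (q * t) ^ n * L F x" by (simp only: L_cmult)
    also have "\<dots> \<le> (q * t) ^ n * (q * t * F x)"
      using q t by (intro mult_left_mono LF Suc.prems) auto
    finally show ?case by (simp add: mult_ac)
  qed simp
  \<comment> \<open>Between \<open>q\<close> and 1: \<open>q / r < 1\<close> makes the series
    converge and \<open>r < 1\<close> lowers the parameter. The midpoint is positive even if
    \<open>q = 0\<close>.\<close>
  define r where "r = (q + 1) / 2"
  have r: "0 < r" "q < r" "r < 1" using q by (auto simp: r_def)
  have "(\<Sum>n<N. (L ^^ n) one x / (r * t) ^ n) \<le> b * (1 / (1 - q / r))" if x: "x \<in> X" for x N
  proof -
    have "(\<Sum>n<N. (L ^^ n) one x / (r * t) ^ n) \<le> (\<Sum>n<N. b * (q / r) ^ n)"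
    proof (rule sum_mono)
      fix n
      have "(L ^^ n) one x \<le> (L ^^ n) F x" using F1 x by (intro Ln_mono) auto
      also have "\<dots> \<le> (q * t) ^ n * F x" by (rule LnF[OF x])
      also have "\<dots> \<le> (q * t) ^ n * b" using q t Fb[OF x] by (intro mult_left_mono) auto
      finally show "(L ^^ n) one x / (r * t) ^ n \<le> b * (q / r) ^ n"
        using r t by (simp add: field_simps power_mult_distrib)
    qed
    also have "\<dots> \<le> (\<Sum>n. b * (q / r) ^ n)"
      using q r b by (intro sum_le_suminf summable_mult summable_geometric) auto
    also have "\<dots> = b * (1 / (1 - q / r))"
      using q r by (simp add: suminf_mult summable_geometric suminf_geometric)
    finally show ?thesis .
  qed
  then have "bounded_resolvent (r * t)" using r t by (auto simp: bounded_resolvent_def)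
  moreover have "r * t < t" using r t by simp
  ultimately show ?thesis by blast
qed

text \<open>Surjectivity keeps each \<open>(L ^^ n) one\<close> at least 1, so for
  \<open>t \<le> 1\<close> the partial sums exceed every bound. Hence the admissible parameters are
  bounded below by 1.\<close>

lemma bounded_resolvent_gt_one:
  assumes "X \<noteq> {}" "\<And>x. x \<in> X \<Longrightarrow> 1 \<le> L one x" "bounded_resolvent t"
  shows "1 < t"
proof (rule ccontr)
  assume "\<not> 1 < t"
  obtain x where x: "x \<in> X" using assms by auto
  obtain b where b: "\<And>N. (\<Sum>n<N. (L ^^ n) one x / t ^ n) \<le> b" and t: "0 < t"
    using assms(3) x by (auto simp: bounded_resolvent_def)
  have Ln: "1 \<le> (L ^^ n) one x" if "x \<in> X" for n x
    using that
  proof (induction n arbitrary: x)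
    case (Suc n)
    have "L one x \<le> L ((L ^^ n) one) x" using Suc.IH by (intro L_mono) auto
    then show ?case using assms(2)[OF Suc.prems] by simp
  qed simp
  have "real N \<le> b" for N
  proof -
    have "(\<Sum>n<N. 1) \<le> (\<Sum>n<N. (L ^^ n) one x / t ^ n)"
    proof (rule sum_mono)
      fix n
      have "t ^ n \<le> 1" using t \<open>\<not> 1 < t\<close> by (intro power_le_one) auto
      then show "1 \<le> (L ^^ n) one x / t ^ n" using Ln[OF x, of n] t by (simp add: field_simps)
    qed
    then show ?thesis using b[of N] by simp
  qed
  then show False using reals_Archimedean2[of b] by (meson not_less)
qed

text \<open>With \<open>s\<close> the infimum of the parameters with bounded resolvent, the functionals
  \<open>f \<mapsto> resolvent t f x / resolvent t one x\<close> accumulate at an eigenfunctional as \<open>t\<close>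
  decreases to \<open>s\<close>, if the points \<open>x\<close> are chosen so that \<open>resolvent t one x\<close> tends to
  infinity.\<close>
theorem exists_eigenfunctional:
  assumes ne: "X \<noteq> {}" and surj: "\<And>x. x \<in> X \<Longrightarrow> 1 \<le> L one x"
  obtains s :: real and m :: "('a \<Rightarrow> real) \<Rightarrow> real" where
    "0 < s" "m one = 1"
    "\<And>f g. bounded_on X f \<Longrightarrow> bounded_on X g \<Longrightarrow> m (\<lambda>x. f x + g x) = m f + m g"
    "\<And>c f. bounded_on X f \<Longrightarrow> m (\<lambda>x. c * f x) = c * m f"
    "\<And>f. bounded_on X f \<Longrightarrow> (\<And>x. x \<in> X \<Longrightarrow> 0 \<le> f x) \<Longrightarrow> 0 \<le> m f"
    "\<And>f. bounded_on X f \<Longrightarrow> m (L f) = s * m f"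
proof -
  define s where "s = Inf (Collect bounded_resolvent)"
  have bdd: "bdd_below (Collect bounded_resolvent)"
    using bounded_resolvent_gt_one[OF ne surj] by (intro bdd_belowI[of _ 1]) (simp add: less_imp_le)
  have nonempty: "Collect bounded_resolvent \<noteq> {}" using bounded_resolvent_large by blast
  have s1: "1 \<le> s"
    unfolding s_def using bounded_resolvent_gt_one[OF ne surj]
    by (intro cInf_greatest[OF nonempty]) (simp add: less_imp_le)
  have above: "bounded_resolvent t" if st: "s < t" for t
  proof -
    obtain u where "bounded_resolvent u" "u < t"
      using st cInf_less_iff[OF nonempty bdd, of t] unfolding s_def by auto
    then show ?thesis by (auto intro: bounded_resolvent_mono)
  qed
  have not_s: "\<not> bounded_resolvent s"
  proof
    assume "bounded_resolvent s"
    then obtain u where "u < s" "bounded_resolvent u" using bounded_resolvent_open by blast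
    then show False using cInf_lower[OF _ bdd, of u] unfolding s_def by auto
  qed
  \<comment> \<open>Otherwise \<open>Suc k\<close> bounds the resolvents for all \<open>t\<close>
    just above \<open>s\<close>, and letting \<open>t\<close> tend to \<open>s\<close> in each
    partial sum makes \<open>s\<close> itself admissible.\<close>
  have "\<exists>t x. s < t \<and> t < s + 1 / Suc k \<and> x \<in> X \<and> real (Suc k) \<le> resolvent t one x" for k
  proof (rule ccontr)
    assume contra: "\<not> ?thesis"
    have "(\<Sum>n<N. (L ^^ n) one x / s ^ n) \<le> Suc k" if x: "x \<in> X" for x N
    proof (rule tendsto_upperbound)
      show "((\<lambda>t. \<Sum>n<N. (L ^^ n) one x / t ^ n) \<longlongrightarrow> (\<Sum>n<N. (L ^^ n) one x / s ^ n)) (at_right s)"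
        using s1 by (auto intro!: tendsto_intros)
      have "eventually (\<lambda>t. t \<in> {s<..<s + 1 / Suc k}) (at_right s)"
        by (rule eventually_at_right_real) simp
      then show "eventually (\<lambda>t. (\<Sum>n<N. (L ^^ n) one x / t ^ n) \<le> Suc k) (at_right s)"
      proof (rule eventually_mono)
        fix t assume t: "t \<in> {s<..<s + 1 / Suc k}"
        then have "(\<Sum>n<N. (L ^^ n) one x / t ^ n) \<le> resolvent t one x"
          using x by (intro resolvent_one_ge above) auto
        also have "\<dots> \<le> Suc k" using contra t x by force
        finally show "(\<Sum>n<N. (L ^^ n) one x / t ^ n) \<le> Suc k" .
      qed
    qed simp
    then have "bounded_resolvent s" using s1 by (auto simp: bounded_resolvent_def)
    then show False using not_s by simp
  qed
  then obtain t x where tx: "\<And>k. s < t k" "\<And>k. t k < s + 1 / Suc k" "\<And>k. x k \<in> X"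
      "\<And>k. real (Suc k) \<le> resolvent (t k) one (x k)"
    by metis
  define D where "D k = resolvent (t k) one (x k)" for k
  have D: "real (Suc k) \<le> D k" "0 < D k" for k using tx(4)[of k] by (auto simp: D_def)
  \<comment> \<open>The value 0 off the bounded functions makes \<open>u k\<close> a point of the
    full product over all functions.\<close>
  define u where "u k f = (if bounded_on X f then resolvent (t k) f (x k) / D k else 0)" for k f
  note br = above[OF tx(1)]
  have u_one: "u k one = 1" for k using D(2)[of k] by (simp add: u_def D_def)
  have u_add: "u k (\<lambda>x. f x + g x) = u k f + u k g"
    if "bounded_on X f" "bounded_on X g" for k f g
    using that br tx(3) by (simp add: u_def bounded_on_add resolvent_add add_divide_distrib)
  have u_cmult: "u k (\<lambda>x. c * f x) = c * u k f" if "bounded_on X f" for k c f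
    using that br tx(3) by (simp add: u_def bounded_on_cmult resolvent_cmult)
  have u_mono: "u k f \<le> u k g"
    if "bounded_on X f" "bounded_on X g" "\<And>x. x \<in> X \<Longrightarrow> f x \<le> g x" for k f g
    using that br tx(3) D(2)[of k] by (simp add: u_def divide_right_mono resolvent_mono)
  have u_abs: "\<bar>u k f\<bar> \<le> c" if c: "\<And>x. x \<in> X \<Longrightarrow> \<bar>f x\<bar> \<le> c" for k f c
  proof -
    have bd: "bounded_on X f" using c by (rule bounded_onI)
    have "u k f \<le> u k (\<lambda>x. c * one x)"
      using c by (intro u_mono bd bounded_on_cmult) (auto simp: abs_le_iff)
    moreover have "u k (\<lambda>x. (- c) * one x) \<le> u k f"
      using c by (intro u_mono bd bounded_on_cmult) (force simp: abs_le_iff)+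
    ultimately show ?thesis
      using u_cmult[of one k c] u_cmult[of one k "- c"] u_one[of k] by simp
  qed
  \<comment> \<open>One error comes from replacing \<open>t k\<close> by \<open>s\<close>, the other
    from the defect \<open>f (x k)\<close> divided by \<open>D k \<ge> Suc k\<close>, with the
    factor \<open>t k \<le> s + 1\<close> in front.\<close>
  have u_L: "\<bar>u k (L f) - s * u k f\<bar> \<le> (c + (s + 1) * c) / Suc k"
    if c: "\<And>x. x \<in> X \<Longrightarrow> \<bar>f x\<bar> \<le> c" for k f c
  proof -
    have bd: "bounded_on X f" using c by (rule bounded_onI)
    have "c \<ge> 0" using c[OF tx(3)[of 0]] by linarith
    have "u k (L f) = t k * (u k f - f (x k) / D k)"
      using bd bounded_L[OF bd] D(2)[of k]
      by (simp add: u_def resolvent_L[OF br bd tx(3)] field_simps)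
    then have "u k (L f) - s * u k f = (t k - s) * u k f - t k * (f (x k) / D k)"
      by (simp add: algebra_simps)
    then have "\<bar>u k (L f) - s * u k f\<bar> \<le> \<bar>(t k - s) * u k f\<bar> + \<bar>t k * (f (x k) / D k)\<bar>" by linarith
    moreover have "\<bar>(t k - s) * u k f\<bar> \<le> (1 / Suc k) * c"
      unfolding abs_mult using tx(1,2)[of k] u_abs[of f c k] c by (intro mult_mono) auto
    moreover have "\<bar>t k * (f (x k) / D k)\<bar> \<le> (s + 1) * (c / Suc k)"
    proof -
      have "1 / real (Suc k) \<le> 1" by simp
      then have "t k \<le> s + 1" using tx(2)[of k] by linarith
      moreover have "\<bar>f (x k) / D k\<bar> \<le> c / Suc k"
        using c[OF tx(3)[of k]] D[of k] \<open>c \<ge> 0\<close> unfolding abs_divide by (intro frac_le) auto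
      ultimately show ?thesis
        unfolding abs_mult using tx(1)[of k] s1 by (intro mult_mono) auto
    qed
    moreover have "(c + (s + 1) * c) / Suc k = (1 / Suc k) * c + (s + 1) * (c / Suc k)"
      by (simp add: add_divide_distrib)
    ultimately show ?thesis by linarith
  qed
  define bnd where "bnd f = (SUP y\<in>X. \<bar>f y\<bar>)" for f :: "'a \<Rightarrow> real"
  have bnd: "\<bar>f y\<bar> \<le> bnd f" if bf: "bounded_on X f" and "y \<in> X" for f y
    unfolding bnd_def
  proof (rule cSUP_upper[OF \<open>y \<in> X\<close>])
    obtain c where "\<forall>x\<in>X. \<bar>f x\<bar> \<le> c" using bf by (auto simp: bounded_on_def)
    then show "bdd_above ((\<lambda>y. \<bar>f y\<bar>) ` X)" by (intro bdd_aboveI[of _ c]) auto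
  qed
  \<comment> \<open>The supremum \<open>bnd f\<close> is unspecified for unbounded \<open>f\<close>;
    the absolute value keeps 0 in the interval. Compactness of \<open>S\<close> is Tychonoff's
    theorem.\<close>
  define S where "S = {\<phi>. \<forall>f. \<phi> f \<in> {- \<bar>bnd f\<bar>..\<bar>bnd f\<bar>}}"
  have S: "compact S"
  proof -
    have "compactin (product_topology (\<lambda>_. euclidean) UNIV) (PiE UNIV (\<lambda>f. {- \<bar>bnd f\<bar>..\<bar>bnd f\<bar>}))"
      by (subst compactin_PiE) auto
    moreover have "PiE UNIV (\<lambda>f. {- \<bar>bnd f\<bar>..\<bar>bnd f\<bar>}) = S"
      by (auto simp: S_def PiE_def Pi_def)
    ultimately show ?thesis by (simp add: euclidean_product_topology)
  qed
  have uS: "u k \<in> S" for k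
  proof -
    have "\<bar>u k f\<bar> \<le> \<bar>bnd f\<bar>" for f
    proof (cases "bounded_on X f")
      case True
      show ?thesis by (rule order.trans[OF u_abs[OF bnd[OF True]]]) auto
    qed (simp add: u_def)
    then show ?thesis by (auto simp: S_def abs_le_iff minus_le_iff)
  qed
  obtain m where m: "\<And>C. closed C \<Longrightarrow> eventually (\<lambda>k. u k \<in> C) sequentially \<Longrightarrow> m \<in> C"
    using closed_cluster[of S u, OF S uS] by blast
  \<comment> \<open>Each relation required of \<open>m\<close> involves finitely many coordinates,
    so it is a closed condition and passes from the \<open>u k\<close> to the cluster point.\<close>
  have m_closed: "g m \<in> C" if "closed C" "continuous_on UNIV g" "eventually (\<lambda>k. g (u k) \<in> C) sequentially"
    for g :: "(('a \<Rightarrow> real) \<Rightarrow> real) \<Rightarrow> real" and C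
    using m[OF closed_coordinate[OF that(1,2)]] that(3) by simp
  show thesis
  proof (rule that[of s m])
    show "0 < s" using s1 by simp
    show "m one = 1" using m_closed[of "{1}" "\<lambda>\<phi>. \<phi> one"] u_one by (simp add: continuous_intros)
    show "m (\<lambda>x. f x + g x) = m f + m g" if "bounded_on X f" "bounded_on X g" for f g
      using m_closed[of "{0}" "\<lambda>\<phi>. \<phi> (\<lambda>x. f x + g x) - (\<phi> f + \<phi> g)"] u_add[OF that]
      by (simp add: continuous_intros)
    show "m (\<lambda>x. c * f x) = c * m f" if "bounded_on X f" for c f
      using m_closed[of "{0}" "\<lambda>\<phi>. \<phi> (\<lambda>x. c * f x) - c * \<phi> f"] u_cmult[OF that]
      by (simp add: continuous_intros)
    show "0 \<le> m f" if "bounded_on X f" "\<And>x. x \<in> X \<Longrightarrow> 0 \<le> f x" for f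
    proof -
      have "0 \<le> u k f" for k
        using u_mono[of "\<lambda>x. 0 * one x" f k] that u_cmult[of one k 0] bounded_on_cmult[of X one 0] by simp
      then show ?thesis using m_closed[of "{0..}" "\<lambda>\<phi>. \<phi> f"] by (simp add: continuous_intros)
    qed
    show "m (L f) = s * m f" if f: "bounded_on X f" for f
    proof -
      have "\<bar>m (L f) - s * m f\<bar> \<le> e" if "e > 0" for e
      proof -
        define c where "c = bnd f"
        have "(\<lambda>k. (c + (s + 1) * c) / Suc k) \<longlonglongrightarrow> 0"
          using LIMSEQ_Suc[OF lim_const_over_n] by simp
        then have "eventually (\<lambda>k. (c + (s + 1) * c) / Suc k < e) sequentially"
          using \<open>e > 0\<close> by (rule order_tendstoD)
        then have "eventually (\<lambda>k. \<bar>u k (L f) - s * u k f\<bar> \<in> {..e}) sequentially"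
        proof (rule eventually_mono)
          fix k assume "(c + (s + 1) * c) / Suc k < e"
          moreover have "\<bar>u k (L f) - s * u k f\<bar> \<le> (c + (s + 1) * c) / Suc k"
            by (rule u_L) (simp add: c_def bnd[OF f])
          ultimately show "\<bar>u k (L f) - s * u k f\<bar> \<in> {..e}" by simp
        qed
        then show ?thesis
          using m_closed[of "{..e}" "\<lambda>\<phi>. \<bar>\<phi> (L f) - s * \<phi> f\<bar>"] by (simp add: continuous_intros)
      qed
      then have "\<bar>m (L f) - s * m f\<bar> \<le> 0" by (rule field_le_epsilon) simp
      then show ?thesis by simp
    qed
  qed
qed

end

section \<open>Step functions over a system of cells\<close>

text \<open>An abstraction of the intervals of an ordered space. Complements are two intervals, and
  \<open>cell_partial\<close> expresses one-dimensionality: an interval has two ends, and each is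
  crossed by at most one member of a disjoint family.\<close>

locale cell_system = piecewise_injective X \<sigma> P
  for X :: "'a set" and \<sigma> P +
  fixes \<K> :: "'a set set"
  assumes X_cell: "X \<in> \<K>" and cell_subset: "\<And>K. K \<in> \<K> \<Longrightarrow> K \<subseteq> X"
    and cell_Int: "\<And>K K'. K \<in> \<K> \<Longrightarrow> K' \<in> \<K> \<Longrightarrow> K \<inter> K' \<in> \<K>"
    and cell_compl: "\<And>K. K \<in> \<K> \<Longrightarrow> \<exists>A\<in>\<K>. \<exists>B\<in>\<K>. A \<inter> B = {} \<and> X - K = A \<union> B"
    and P_cells: "P \<subseteq> \<K>"
    and cell_image: "\<And>B K. B \<in> P \<Longrightarrow> K \<in> \<K> \<Longrightarrow> K \<subseteq> B \<Longrightarrow> \<sigma> ` K \<in> \<K>"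
    and cell_vimage: "\<And>B K. B \<in> P \<Longrightarrow> K \<in> \<K> \<Longrightarrow> B \<inter> \<sigma> -` K \<in> \<K>"
    and cell_partial: "\<And>Q K. finite Q \<Longrightarrow> Q \<subseteq> \<K> \<Longrightarrow> disjoint Q \<Longrightarrow> K \<in> \<K> \<Longrightarrow>
      card {B \<in> Q. B \<inter> K \<noteq> {} \<and> \<not> B \<subseteq> K} \<le> 2"
begin

text \<open>That is, \<open>f\<close> is constant on the atoms of the algebra generated by
  \<open>Q\<close>.\<close>

definition determined_by :: "'a set set \<Rightarrow> ('a \<Rightarrow> real) \<Rightarrow> bool" where
  "determined_by Q f \<longleftrightarrow> (\<forall>p\<in>X. \<forall>q\<in>X. (\<forall>K\<in>Q. p \<in> K \<longleftrightarrow> q \<in> K) \<longrightarrow> f p = f q)"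

definition step :: "('a \<Rightarrow> real) \<Rightarrow> bool" where
  "step f \<longleftrightarrow> (\<forall>x. x \<notin> X \<longrightarrow> f x = 0) \<and> (\<exists>Q. finite Q \<and> Q \<subseteq> \<K> \<and> determined_by Q f)"

text \<open>\<open>w\<close> is the total weight of one particular representation; the same
  \<open>f\<close> may have many. It takes the place of a variation norm.\<close>

inductive weighted :: "real \<Rightarrow> ('a \<Rightarrow> real) \<Rightarrow> bool" where
  zero: "weighted 0 (\<lambda>_. 0)"
| cell: "weighted w f \<Longrightarrow> K \<in> \<K> \<Longrightarrow> 0 \<le> c \<Longrightarrow> weighted (w + c) (\<lambda>x. f x + c * indicator K x)"

lemma stepI:
  assumes "\<And>x. x \<notin> X \<Longrightarrow> f x = 0" "finite Q" "Q \<subseteq> \<K>"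
    "\<And>p q. p \<in> X \<Longrightarrow> q \<in> X \<Longrightarrow> (\<And>K. K \<in> Q \<Longrightarrow> p \<in> K \<longleftrightarrow> q \<in> K) \<Longrightarrow> f p = f q"
  shows "step f"
  unfolding step_def determined_by_def
proof (intro conjI exI[of _ Q] allI impI ballI)
  fix p q assume "p \<in> X" "q \<in> X" "\<forall>K\<in>Q. p \<in> K \<longleftrightarrow> q \<in> K"
  then show "f p = f q" by (intro assms(4)) auto
qed (use assms(1-3) in auto)

lemma step_outside: "step f \<Longrightarrow> x \<notin> X \<Longrightarrow> f x = 0"
  unfolding step_def by blast

lemma step_indicator: "K \<in> \<K> \<Longrightarrow> step (indicator K)"
  using cell_subset by (intro stepI[where Q="{K}"]) (auto simp: indicator_def)

lemma step_comb:
  assumes "step f" "step g" "h 0 0 = 0"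
  shows "step (\<lambda>x. h (f x) (g x))"
proof -
  obtain Q R where Q: "finite Q" "Q \<subseteq> \<K>" "determined_by Q f"
    and R: "finite R" "R \<subseteq> \<K>" "determined_by R g"
    using assms unfolding step_def by blast
  show ?thesis
  proof (rule stepI[where Q="Q \<union> R"])
    fix p q assume "p \<in> X" "q \<in> X" "\<And>K. K \<in> Q \<union> R \<Longrightarrow> (p \<in> K) = (q \<in> K)"
    then have "f p = f q" "g p = g q" using Q(3) R(3) unfolding determined_by_def by blast+
    then show "h (f p) (g p) = h (f q) (g q)" by simp
  qed (use assms Q(1,2) R(1,2) in \<open>auto simp: step_outside\<close>)
qed

lemma step_add: "step f \<Longrightarrow> step g \<Longrightarrow> step (\<lambda>x. f x + g x)"
  and step_diff: "step f \<Longrightarrow> step g \<Longrightarrow> step (\<lambda>x. f x - g x)"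
  and step_cmult: "step f \<Longrightarrow> step (\<lambda>x. c * f x)"
  by (rule step_comb; simp)+

lemma step_one: "step one"
  by (rule step_indicator[OF X_cell])

text \<open>\<open>f\<close> factors through the set of members of \<open>Q\<close> that contain the
  point, and \<open>Q\<close> has finitely many subsets.\<close>

lemma step_finite_range:
  assumes "step f" shows "finite (f ` X)"
proof -
  obtain Q where Q: "finite Q" "determined_by Q f"
    using assms unfolding step_def by blast
  define \<phi> where "\<phi> p = {K \<in> Q. p \<in> K}" for p
  have "finite (\<phi> ` X)" using Q(1) by (rule_tac finite_subset[of _ "Pow Q"]) (auto simp: \<phi>_def)
  moreover have "f p = f (inv_into X \<phi> (\<phi> p))" if "p \<in> X" for p
  proof -
    have "\<phi> p \<in> \<phi> ` X" using that by simp
    then have q: "inv_into X \<phi> (\<phi> p) \<in> X" "\<phi> (inv_into X \<phi> (\<phi> p)) = \<phi> p"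
      by (rule inv_into_into, rule f_inv_into_f)
    then have "\<forall>K\<in>Q. p \<in> K \<longleftrightarrow> inv_into X \<phi> (\<phi> p) \<in> K" unfolding \<phi>_def by blast
    with Q(2) that q(1) show ?thesis unfolding determined_by_def by blast
  qed
  then have "f ` X \<subseteq> (\<lambda>A. f (inv_into X \<phi> A)) ` \<phi> ` X"
    unfolding image_image by (rule image_subsetI[OF image_eqI])
  ultimately show ?thesis by (meson finite_imageI finite_subset)
qed

lemma bounded_step:
  assumes "step f" shows "bounded_on X f"
proof (rule bounded_onI)
  fix x assume "x \<in> X"
  then show "\<bar>f x\<bar> \<le> Max (abs ` f ` X)"
    using step_finite_range[OF assms] by (intro Max_ge) auto
qed

lemma weighted_nonneg: "weighted w f \<Longrightarrow> 0 \<le> f x"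
  by (induction rule: weighted.induct) auto

lemma step_weighted: "weighted w f \<Longrightarrow> step f"
proof (induction rule: weighted.induct)
  case zero
  show ?case by (rule stepI[where Q="{}"]) auto
qed (intro step_add step_cmult step_indicator)

lemma bounded_weighted: "weighted w f \<Longrightarrow> bounded_on X f"
  by (rule bounded_step[OF step_weighted])

lemma weighted_indicator:
  "K \<in> \<K> \<Longrightarrow> 0 \<le> c \<Longrightarrow> weighted c (\<lambda>x. c * indicator K x)"
  using weighted.cell[OF weighted.zero, of K c] by simp

lemma weighted_add:
  assumes "weighted w f" "weighted v g"
  shows "weighted (w + v) (\<lambda>x. f x + g x)"
  using assms(2)
proof (induction rule: weighted.induct)
  case (cell v g K c)
  then show ?case using weighted.cell[OF cell.IH, of K c] by (simp add: add.assoc)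
qed (use assms in simp)

lemma weighted_cmult:
  assumes "weighted w f" "0 \<le> c"
  shows "weighted (c * w) (\<lambda>x. c * f x)"
  using assms(1)
proof (induction rule: weighted.induct)
  case (cell w f K d)
  then show ?case
    using weighted.cell[OF cell.IH, of K "c * d"] assms(2) by (simp add: algebra_simps)
qed (use weighted.zero in simp)

lemma weighted_sum:
  assumes "finite F" "\<And>i. i \<in> F \<Longrightarrow> A i \<in> \<K>"
  shows "weighted (card F) (\<lambda>x. \<Sum>i\<in>F. indicator (A i) x)"
  using assms
proof (induction F rule: finite_induct)
  case (insert i F)
  have "weighted (real (card F) + 1) (\<lambda>x. (\<Sum>i\<in>F. indicator (A i) x) + 1 * indicator (A i) x)"
    by (intro weighted.cell insert) (use insert in auto)
  then show ?case using insert by (simp add: add.commute)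
qed (simp add: weighted.zero)

text \<open>A new cell \<open>C\<close> cuts \<open>K\<close> into its parts in \<open>C\<close> and
  in the two cells that make up the complement of \<open>C\<close>. On each part membership in
  \<open>C\<close> is decided, so the smaller \<open>Q\<close> determines \<open>f\<close>
  there.\<close>

lemma nonneg_step_weighted_aux:
  assumes "finite Q" "Q \<subseteq> \<K>" "K \<in> \<K>" "\<And>x. x \<in> K \<Longrightarrow> 0 \<le> f x"
    "\<And>p q. p \<in> K \<Longrightarrow> q \<in> K \<Longrightarrow> (\<And>B. B \<in> Q \<Longrightarrow> p \<in> B \<longleftrightarrow> q \<in> B) \<Longrightarrow> f p = f q"
  shows "\<exists>w. weighted w (\<lambda>x. f x * indicator K x)"
  using assms
proof (induction Q arbitrary: K rule: finite_induct)
  case empty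
  show ?case
  proof (cases "K = {}")
    case True
    then show ?thesis using weighted.zero by auto
  next
    case False
    then obtain k where k: "k \<in> K" by auto
    have "(\<lambda>x. f x * indicator K x) = (\<lambda>x. f k * indicator K x)"
      using empty.prems(4)[OF _ k] by (fastforce simp: indicator_def)
    then show ?thesis
      using weighted_indicator[OF empty.prems(2), of "f k"] empty.prems(3)[OF k] by auto
  qed
next
  case (insert C Q)
  obtain A B where AB: "A \<in> \<K>" "B \<in> \<K>" "A \<inter> B = {}" "X - C = A \<union> B"
    using cell_compl[of C] insert.prems(1) by auto
  have *: "\<exists>w. weighted w (\<lambda>x. f x * indicator (K \<inter> D) x)"
    if D: "D \<in> \<K>" "D \<subseteq> C \<or> D \<inter> C = {}" for D
  proof (rule insert.IH)
    fix p q assume pq: "p \<in> K \<inter> D" "q \<in> K \<inter> D" "\<And>B. B \<in> Q \<Longrightarrow> p \<in> B \<longleftrightarrow> q \<in> B"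
    then show "f p = f q" using D(2) by (intro insert.prems(4)) auto
  qed (use insert.prems(1-3) D cell_Int in auto)
  have disj: "A \<inter> C = {}" "B \<inter> C = {}" using AB by auto
  obtain u v w where "weighted u (\<lambda>x. f x * indicator (K \<inter> A) x)"
      "weighted v (\<lambda>x. f x * indicator (K \<inter> B) x)" "weighted w (\<lambda>x. f x * indicator (K \<inter> C) x)"
    using *[of A] *[of B] *[of C] AB disj insert.prems(1) by auto
  then have "weighted (u + v + w) (\<lambda>x. f x * indicator (K \<inter> A) x + f x * indicator (K \<inter> B) x
      + f x * indicator (K \<inter> C) x)"
    by (intro weighted_add)
  moreover have "(\<lambda>x. f x * indicator (K \<inter> A) x + f x * indicator (K \<inter> B) x + f x * indicator (K \<inter> C) x)
      = (\<lambda>x. f x * indicator K x)"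
  proof
    fix x
    have "x \<in> K \<Longrightarrow> x \<in> A \<or> x \<in> B \<or> x \<in> C"
      using AB(4) cell_subset[OF insert.prems(2)] by blast
    moreover have "\<not> (x \<in> A \<and> x \<in> B)" "\<not> (x \<in> A \<and> x \<in> C)" "\<not> (x \<in> B \<and> x \<in> C)"
      using AB(3) disj by auto
    ultimately show "f x * indicator (K \<inter> A) x + f x * indicator (K \<inter> B) x + f x * indicator (K \<inter> C) x
        = f x * indicator K x"
      unfolding indicator_def by auto
  qed
  ultimately show ?case by metis
qed

lemma nonneg_step_weighted:
  assumes "step f" "\<And>x. x \<in> X \<Longrightarrow> 0 \<le> f x"
  obtains w where "weighted w f"
proof -
  obtain Q where Q: "finite Q" "Q \<subseteq> \<K>" "determined_by Q f"
    using assms unfolding step_def by blast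
  have "\<exists>w. weighted w (\<lambda>x. f x * indicator X x)"
  proof (rule nonneg_step_weighted_aux[OF Q(1,2) X_cell])
    fix p q assume "p \<in> X" "q \<in> X" "\<And>B. B \<in> Q \<Longrightarrow> p \<in> B \<longleftrightarrow> q \<in> B"
    then show "f p = f q" using Q(3) unfolding determined_by_def by blast
  qed (rule assms(2))
  moreover have "f x * indicator X x = f x" for x
    using assms(1) by (cases "x \<in> X") (simp_all add: step_outside)
  ultimately show ?thesis using that by auto
qed

text \<open>A summand positive at \<open>x\<close> is already the lower bound, the others being
  nonnegative. Positivity of \<open>m\<close> on cells passes to step functions this way.\<close>

lemma weighted_pos_ge:
  assumes "weighted w f" "f x > 0"
  shows "\<exists>c>0. \<exists>K\<in>\<K>. K \<noteq> {} \<and> (\<forall>y. c * indicator K y \<le> f y)"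
  using assms
proof (induction rule: weighted.induct)
  case (cell w f K c)
  show ?case
  proof (cases "f x > 0")
    case True
    then obtain d B where "d > 0" "B \<in> \<K>" "B \<noteq> {}" and dB: "\<forall>y. d * indicator B y \<le> f y"
      using cell.IH by auto
    moreover have "d * indicator B y \<le> f y + c * indicator K y" for y
      using dB cell.hyps(3) by (smt (verit) indicator_pos_le mult_nonneg_nonneg)
    ultimately show ?thesis by blast
  next
    case False
    then have "c * indicator K x > 0"
      using cell.prems weighted_nonneg[OF cell.hyps(1), of x] by simp
    then have "x \<in> K" "c > 0"
      using cell.hyps(3) by (cases "x \<in> K"; simp)+
    then show ?thesis using cell.hyps weighted_nonneg[OF cell.hyps(1)]
      by (intro exI[of _ c]) (auto intro!: bexI[of _ K])
  qed
qed simp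

text \<open>Cut \<open>K\<close> along \<open>P\<close>; on each piece \<open>\<sigma>\<close> is
  injective, so \<open>L\<close> merely transports the indicator.\<close>

lemma L_cell:
  assumes "K \<in> \<K>"
  shows "L (indicator K) = (\<lambda>x. \<Sum>B\<in>P. indicator (\<sigma> ` (K \<inter> B)) x)"
proof -
  have "L (indicator K) = (\<lambda>x. \<Sum>B\<in>P. L (indicator (K \<inter> B)) x)"
    using Ln_sum[OF finite_P, of 1 "\<lambda>B. indicator (K \<inter> B)"] cell_subset[OF assms] Union_P
    by (subst indicator_decomp[OF finite_P disjoint_P]) auto
  also have "\<dots> = (\<lambda>x. \<Sum>B\<in>P. indicator (\<sigma> ` (K \<inter> B)) x)"
  proof (intro ext sum.cong refl)
    fix x B assume "B \<in> P"
    then have "L (indicator (K \<inter> B)) = indicator (\<sigma> ` (K \<inter> B))"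
      using cell_subset[OF assms] by (intro L_indicator_inj) (auto intro: inj_on_subset[OF inj_P])
    then show "L (indicator (K \<inter> B)) x = indicator (\<sigma> ` (K \<inter> B)) x" by simp
  qed
  finally show ?thesis .
qed

lemma step_L:
  assumes "step f" shows "step (L f)"
proof -
  have wc: "step (L g)" if "weighted w g" for w g
    using that
  proof (induction rule: weighted.induct)
    case zero
    show ?case using step_weighted[OF weighted.zero] Ln_zero[of 1] by simp
  next
    case (cell w f K c)
    have "weighted (card P) (L (indicator K))"
      unfolding L_cell[OF cell.hyps(2)]
      using cell.hyps P_cells cell_Int
      by (intro weighted_sum finite_P cell_image) auto
    then show ?case unfolding L_add L_cmult
      by (intro step_add step_cmult cell step_weighted)
  qed
  \<comment> \<open>Adding a constant makes the function nonnegative, hence weighted; linearity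
    removes the constant afterwards.\<close>
  obtain c where c: "0 \<le> c" "\<And>x. x \<in> X \<Longrightarrow> \<bar>f x\<bar> \<le> c"
    using bounded_step[OF assms] by (rule bounded_onE) auto
  have s: "step (\<lambda>x. f x + c * one x)" by (intro step_add step_cmult step_one assms)
  have "0 \<le> f x + c * one x" if "x \<in> X" for x using c(2)[OF that] that by simp
  then obtain w where "weighted w (\<lambda>x. f x + c * one x)"
    using nonneg_step_weighted[OF s] by blast
  then have "step (L (\<lambda>x. f x + c * one x))" by (rule wc)
  moreover obtain v where "weighted v (\<lambda>x. c * one x)"
    using weighted_indicator[OF X_cell c(1)] by auto
  then have "step (L (\<lambda>x. c * one x))" by (rule wc)
  ultimately have "step (\<lambda>x. L (\<lambda>x. f x + c * one x) x - L (\<lambda>x. c * one x) x)" by (rule step_diff)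
  then show ?thesis by (simp add: L_add)
qed

lemma step_Ln: "step f \<Longrightarrow> step ((L ^^ n) f)"
  by (induction n) (auto intro: step_L)

text \<open>That \<open>N\<close> iterations are injective on each member is expressed by
  \<open>L ^^ N\<close> taking indicators of subcells to indicators. The partition for
  \<open>Suc N\<close> refines \<open>P\<close> by the preimages of the one for \<open>N\<close>;
  its members may be empty.\<close>

lemma iterated_partition:
  "\<exists>Q. finite Q \<and> Q \<subseteq> \<K> \<and> disjoint Q \<and> \<Union>Q = X \<and>
     (\<forall>B\<in>Q. \<forall>K\<in>\<K>. K \<subseteq> B \<longrightarrow> (\<exists>K'\<in>\<K>. (L ^^ N) (indicator K) = indicator K'))"
proof (induction N)
  case 0
  show ?case using X_cell by (intro exI[of _ "{X}"]) auto
next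
  case (Suc N)
  then obtain Q where Q: "finite Q" "Q \<subseteq> \<K>" "disjoint Q" "\<Union>Q = X"
    "\<forall>B\<in>Q. \<forall>K\<in>\<K>. K \<subseteq> B \<longrightarrow> (\<exists>K'\<in>\<K>. (L ^^ N) (indicator K) = indicator K')"
    by (elim exE conjE) (rule that)
  define R where "R = {B \<inter> \<sigma> -` C | B C. B \<in> P \<and> C \<in> Q}"
  have "finite R" using finite_P Q(1) unfolding R_def by (intro finite_image_set2) simp_all
  moreover have "R \<subseteq> \<K>" using cell_vimage Q(2) by (auto simp: R_def)
  moreover have "disjoint R"
  proof (rule disjointI)
    fix A A' assume A: "A \<in> R" "A' \<in> R" "A \<noteq> A'"
    then obtain B C B' C' where *: "A = B \<inter> \<sigma> -` C" "A' = B' \<inter> \<sigma> -` C'" "B \<in> P" "C \<in> Q" "B' \<in> P" "C' \<in> Q"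
      unfolding R_def by blast
    with A have "B \<noteq> B' \<or> C \<noteq> C'" by auto
    then have "B \<inter> B' = {} \<or> C \<inter> C' = {}" using * disjoint_P Q(3) by (auto dest: disjointD)
    then show "A \<inter> A' = {}" using * by auto
  qed
  moreover have "\<Union>R = X"
  proof
    show "\<Union>R \<subseteq> X" using Union_P by (auto simp: R_def)
    show "X \<subseteq> \<Union>R"
    proof
      fix x assume x: "x \<in> X"
      then obtain B C where "B \<in> P" "x \<in> B" "C \<in> Q" "\<sigma> x \<in> C" using Union_P Q(4) maps[OF x] by blast
      then show "x \<in> \<Union>R" unfolding R_def by blast
    qed
  qed
  moreover have "\<exists>K'\<in>\<K>. (L ^^ Suc N) (indicator K) = indicator K'" if "A \<in> R" "K \<in> \<K>" "K \<subseteq> A" for A K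
  proof -
    obtain B C where BC: "A = B \<inter> \<sigma> -` C" "B \<in> P" "C \<in> Q" using \<open>A \<in> R\<close> unfolding R_def by blast
    have "L (indicator K) = indicator (\<sigma> ` K)"
      using BC that cell_subset by (intro L_indicator_inj) (auto intro: inj_on_subset[OF inj_P])
    moreover have "\<sigma> ` K \<in> \<K>" using BC that by (intro cell_image[of B]) auto
    then have "\<exists>K'\<in>\<K>. (L ^^ N) (indicator (\<sigma> ` K)) = indicator K'"
      by (intro Q(5)[rule_format, OF BC(3)]) (use BC that in auto)
    ultimately show ?thesis by (simp add: funpow_Suc_right del: funpow.simps)
  qed
  ultimately show ?case by blast
qed

end

section \<open>Asymptotics of the transfer operator of an exact map\<close>

text \<open>\<open>exact\<close> counts preimages: at time \<open>n\<close> every point has one in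
  \<open>K\<close>. \<open>two_cells\<close> supplies a second preimage and with it growth.\<close>

locale exact_cell_system = cell_system +
  assumes exact: "\<And>K. K \<in> \<K> \<Longrightarrow> K \<noteq> {} \<Longrightarrow> \<exists>n. \<forall>x\<in>X. 1 \<le> (L ^^ n) (indicator K) x"
    and two_cells: "\<exists>K\<in>\<K>. \<exists>K'\<in>\<K>. K \<noteq> {} \<and> K' \<noteq> {} \<and> K \<inter> K' = {}"
begin

lemma X_nonempty: "X \<noteq> {}"
  using two_cells cell_subset by blast

text \<open>A cell \<open>K\<close> that misses some \<open>y\<close> covers \<open>X\<close> only
  after a positive number of iterations, so the last of them must hit every
  \<open>x\<close>.\<close>

lemma L_one_ge: "x \<in> X \<Longrightarrow> 1 \<le> L one x"
proof -
  assume x: "x \<in> X"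
  obtain K K' where K: "K \<in> \<K>" "K' \<in> \<K>" "K \<noteq> {}" "K' \<noteq> {}" "K \<inter> K' = {}"
    using two_cells by blast
  obtain n where n: "\<forall>x\<in>X. 1 \<le> (L ^^ n) (indicator K) x" using exact K by blast
  obtain y where y: "y \<in> X" "y \<notin> K" using K cell_subset[of K'] by blast
  have "n \<noteq> 0" using n[rule_format, OF y(1)] y by (cases n) auto
  then obtain k where k: "n = Suc k" by (cases n) auto
  have "{y \<in> X. \<sigma> y = x} \<noteq> {}"
  proof
    assume e: "{y \<in> X. \<sigma> y = x} = {}"
    have "L g x = 0" for g by (simp only: L_def e sum.empty if_cancel)
    then have "(L ^^ n) (indicator K) x = 0" by (simp add: k)
    then show False using n x by auto
  qed
  then have "1 \<le> card {y \<in> X. \<sigma> y = x}" using finite_fibre[of x] by (simp add: Suc_le_eq card_gt_0_iff)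
  then show ?thesis using x finite_fibre[of x] by (simp add: L_def indicator_def)
qed

lemma Ln_ge_mono:
  assumes "\<And>x. x \<in> X \<Longrightarrow> 1 \<le> (L ^^ n) f x" "n \<le> k" "x \<in> X"
  shows "1 \<le> (L ^^ k) f x"
  using assms(2,3)
proof (induction k arbitrary: x rule: dec_induct)
  case (step k)
  have "1 \<le> L one x" using step L_one_ge by blast
  also have "\<dots> \<le> L ((L ^^ k) f) x" using step.IH by (intro L_mono) auto
  finally show ?case by simp
qed (use assms in blast)

lemma exact_finite:
  assumes "finite Q" "Q \<subseteq> \<K>" "{} \<notin> Q"
  shows "\<exists>n0. \<forall>n\<ge>n0. \<forall>K\<in>Q. \<forall>x\<in>X. 1 \<le> (L ^^ n) (indicator K) x"
proof -
  have "\<forall>K\<in>Q. \<exists>n. \<forall>x\<in>X. 1 \<le> (L ^^ n) (indicator K) x"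
    using exact assms(2,3) by (metis subsetD)
  then obtain n where n: "\<And>K x. K \<in> Q \<Longrightarrow> x \<in> X \<Longrightarrow> 1 \<le> (L ^^ n K) (indicator K) x" by metis
  \<comment> \<open>The sum of the individual times serves as a common time.\<close>
  have "1 \<le> (L ^^ k) (indicator K) x" if "sum n Q \<le> k" "K \<in> Q" "x \<in> X" for k K x
  proof (rule Ln_ge_mono)
    show "n K \<le> k" using member_le_sum[of K Q n] that assms(1) by simp
  qed (use n that in auto)
  then show ?thesis by blast
qed

lemma Ln_one_ge_two: "\<exists>n. \<forall>x\<in>X. 2 \<le> (L ^^ n) one x"
proof -
  obtain K K' where K: "K \<in> \<K>" "K' \<in> \<K>" "K \<noteq> {}" "K' \<noteq> {}" "K \<inter> K' = {}"
    using two_cells by blast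
  obtain n where "\<forall>k\<ge>n. \<forall>A\<in>{K, K'}. \<forall>x\<in>X. 1 \<le> (L ^^ k) (indicator A) x"
    using exact_finite[of "{K, K'}"] K by blast
  then have n: "\<forall>A\<in>{K, K'}. \<forall>x\<in>X. 1 \<le> (L ^^ n) (indicator A) x" by blast
  have "2 \<le> (L ^^ n) one x" if "x \<in> X" for x
  proof -
    have "2 \<le> (L ^^ n) (indicator K) x + (L ^^ n) (indicator K') x" using n that by force
    also have "\<dots> = (L ^^ n) (\<lambda>x. indicator K x + indicator K' x) x" by (simp add: Ln_add)
    also have "\<dots> \<le> (L ^^ n) one x"
      using K that by (intro Ln_mono) (auto simp: indicator_def)
    finally show ?thesis .
  qed
  then show ?thesis by blast
qed

end

text \<open>\<open>m\<close> stands for integration against the scaling measure, before that measure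
  has been constructed.\<close>

locale conformal_system = exact_cell_system +
  fixes s :: real and m :: "('a \<Rightarrow> real) \<Rightarrow> real"
  assumes s_pos: "0 < s" and m_one: "m one = 1"
    and m_add: "\<And>f g. bounded_on X f \<Longrightarrow> bounded_on X g \<Longrightarrow> m (\<lambda>x. f x + g x) = m f + m g"
    and m_cmult: "\<And>c f. bounded_on X f \<Longrightarrow> m (\<lambda>x. c * f x) = c * m f"
    and m_nonneg: "\<And>f. bounded_on X f \<Longrightarrow> (\<And>x. x \<in> X \<Longrightarrow> 0 \<le> f x) \<Longrightarrow> 0 \<le> m f"
    and m_L: "\<And>f. bounded_on X f \<Longrightarrow> m (L f) = s * m f"
begin

section \<open>Masses of cells and the growth of weights\<close>

lemma m_diff: "bounded_on X f \<Longrightarrow> bounded_on X g \<Longrightarrow> m (\<lambda>x. f x - g x) = m f - m g"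
  using m_add[of f "\<lambda>x. (-1) * g x"] m_cmult[of g "-1"] bounded_on_cmult[of X g "-1"] by simp

lemma m_mono:
  assumes "bounded_on X f" "bounded_on X g" "\<And>x. x \<in> X \<Longrightarrow> f x \<le> g x"
  shows "m f \<le> m g"
  using m_nonneg[OF bounded_on_diff[OF assms(2,1)]] assms m_diff[OF assms(2,1)] by simp

lemma m_zero: "m (\<lambda>_. 0) = 0"
  using m_cmult[of one 0] by simp

lemma m_sum:
  "finite F \<Longrightarrow> (\<And>i. i \<in> F \<Longrightarrow> bounded_on X (f i)) \<Longrightarrow> m (\<lambda>x. \<Sum>i\<in>F. f i x) = (\<Sum>i\<in>F. m (f i))"
proof (induction F rule: finite_induct)
  case (insert i F)
  have "bounded_on X (\<lambda>x. \<Sum>i\<in>F. f i x)"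
    using insert(1) insert.prems
  proof (induction F rule: finite_induct)
    case empty
    show ?case by (rule bounded_onI[where c=0]) simp
  next
    case (insert j F)
    then show ?case by (auto intro!: bounded_on_add)
  qed
  then show ?case using insert by (simp add: m_add)
qed (simp add: m_zero)

lemma m_Ln: "bounded_on X f \<Longrightarrow> m ((L ^^ n) f) = s ^ n * m f"
  by (induction n) (auto simp: m_L bounded_Ln)

lemma m_indicator_nonneg: "0 \<le> m (indicator A)"
  by (rule m_nonneg) auto

lemma m_indicator_mono: "A \<subseteq> B \<Longrightarrow> m (indicator A) \<le> m (indicator B)"
  by (rule m_mono) (auto simp: indicator_def)

lemma m_cell_le_one: "K \<in> \<K> \<Longrightarrow> m (indicator K) \<le> 1"
  using m_indicator_mono[OF cell_subset] m_one by simp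

text \<open>\<open>s ^ n * m f\<close> is the value of \<open>m\<close> at the iterate, which
  dominates \<open>one\<close>. Exactness thereby makes \<open>m\<close> positive on nonempty
  cells.\<close>

lemma m_pos_of_Ln_ge:
  assumes "bounded_on X f" "\<And>x. x \<in> X \<Longrightarrow> 1 \<le> (L ^^ n) f x"
  shows "0 < m f"
proof -
  have "m one \<le> m ((L ^^ n) f)"
    using assms by (intro m_mono bounded_Ln) auto
  then have "0 < s ^ n * m f" using m_Ln[OF assms(1)] m_one by simp
  then show ?thesis using s_pos by (simp add: zero_less_mult_iff)
qed

lemma m_cell_pos: "K \<in> \<K> \<Longrightarrow> K \<noteq> {} \<Longrightarrow> 0 < m (indicator K)"
  using exact[of K] m_pos_of_Ln_ge[of "indicator K"] by fastforce

lemma m_step_pos: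
  assumes "step f" "\<And>x. x \<in> X \<Longrightarrow> 0 \<le> f x" "f x > 0"
  shows "0 < m f"
proof -
  obtain w where "weighted w f" using nonneg_step_weighted[OF assms(1,2)] by blast
  from weighted_pos_ge[OF this assms(3)] obtain c K
    where c: "c > 0" "K \<in> \<K>" "K \<noteq> {}" "\<And>y. c * indicator K y \<le> f y" by blast
  have "0 < c * m (indicator K)" using c m_cell_pos by simp
  also have "\<dots> = m (\<lambda>y. c * indicator K y)" by (simp add: m_cmult)
  also have "\<dots> \<le> m f" using c(4) by (intro m_mono bounded_step[OF assms(1)] bounded_on_cmult) auto
  finally show ?thesis .
qed

text \<open>Iterating on a cell \<open>K\<close>, at most two members of the partition meet \<open>K\<close> without being contained
  in it, while the number of those contained in \<open>K\<close> is controlled by the mass of \<open>K\<close>. This plays the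
  role of a Lasota--Yorke inequality.\<close>
lemma weighted_Ln_cell:
  "\<exists>C\<ge>0. \<forall>K\<in>\<K>. \<exists>w. weighted w ((L ^^ N) (indicator K)) \<and> w \<le> 2 + C * m (indicator K)"
proof -
  obtain Q where Q: "finite Q" "Q \<subseteq> \<K>" "disjoint Q" "\<Union>Q = X"
    "\<forall>B\<in>Q. \<forall>K\<in>\<K>. K \<subseteq> B \<longrightarrow> (\<exists>K'\<in>\<K>. (L ^^ N) (indicator K) = indicator K')"
    using iterated_partition[of N] by (elim exE conjE) (rule that)
  \<comment> \<open>The masses of the members are inverted next, so the empty cell, of mass 0, is
    removed.\<close>
  define Q' where "Q' = Q - {{}}"
  \<comment> \<open>Only \<open>1 \<le> C * m (indicator B)\<close> for all these \<open>B\<close>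
    matters: it lets mass count the members inside \<open>K\<close>.\<close>
  define C where "C = (\<Sum>B\<in>Q'. 1 / m (indicator B))"
  have mQ': "0 < m (indicator B)" if "B \<in> Q'" for B
    using that Q(2) by (auto simp: Q'_def intro!: m_cell_pos)
  have C: "1 \<le> C * m (indicator B)" if "B \<in> Q'" for B
  proof -
    have "1 / m (indicator B) \<le> C"
      unfolding C_def by (rule member_le_sum[OF that]) (use Q(1) in \<open>auto simp: Q'_def m_indicator_nonneg\<close>)
    then show ?thesis using mQ'[OF that] by (simp add: field_simps)
  qed
  have "C \<ge> 0" unfolding C_def by (intro sum_nonneg) (auto simp: m_indicator_nonneg)
  moreover have "\<exists>w. weighted w ((L ^^ N) (indicator K)) \<and> w \<le> 2 + C * m (indicator K)"
    if K: "K \<in> \<K>" for K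
  proof -
    define R where "R = {B \<in> Q. B \<inter> K \<noteq> {}}"
    define R1 where "R1 = {B \<in> Q. B \<inter> K \<noteq> {} \<and> \<not> B \<subseteq> K}"
    define R2 where "R2 = {B \<in> Q'. B \<subseteq> K}"
    have fin: "finite R" "finite R1" "finite R2" using Q(1) by (auto simp: R_def R1_def R2_def Q'_def)
    have "\<forall>B\<in>R. \<exists>K'\<in>\<K>. (L ^^ N) (indicator (K \<inter> B)) = indicator K'"
      using Q(2) K cell_Int by (intro ballI Q(5)[rule_format]) (auto simp: R_def)
    then obtain A where A: "\<And>B. B \<in> R \<Longrightarrow> A B \<in> \<K> \<and> (L ^^ N) (indicator (K \<inter> B)) = indicator (A B)"
      by metis
    have "indicator K = (\<lambda>x. \<Sum>B\<in>R. indicator (K \<inter> B) x :: real)"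
    proof (rule indicator_decomp)
      show "disjoint R" using Q(3) by (auto simp: R_def disjoint_def)
      show "K \<subseteq> \<Union>R" using cell_subset[OF K] Q(4) by (auto simp: R_def)
    qed (rule fin)
    then have "(L ^^ N) (indicator K) = (\<lambda>x. \<Sum>B\<in>R. (L ^^ N) (indicator (K \<inter> B)) x)"
      by (simp add: Ln_sum fin)
    also have "\<dots> = (\<lambda>x. \<Sum>B\<in>R. indicator (A B) x)" using A by (intro ext sum.cong) auto
    finally have "weighted (card R) ((L ^^ N) (indicator K))"
      using weighted_sum[of R A] A fin by simp
    moreover have "real (card R) \<le> 2 + C * m (indicator K)"
    proof -
      have "R = R1 \<union> R2" by (auto simp: R_def R1_def R2_def Q'_def)
      then have "card R \<le> card R1 + card R2" by (simp add: card_Un_le)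
      moreover have "card R1 \<le> 2" unfolding R1_def by (rule cell_partial[OF Q(1-3) K])
      moreover have "real (card R2) \<le> C * m (indicator K)"
      proof -
        have "real (card R2) = (\<Sum>B\<in>R2. 1)" by simp
        also have "\<dots> \<le> (\<Sum>B\<in>R2. C * m (indicator B))" by (intro sum_mono C) (auto simp: R2_def)
        also have "\<dots> = C * m (\<lambda>x. \<Sum>B\<in>R2. indicator B x)" using fin by (simp add: m_sum sum_distrib_left)
        \<comment> \<open>Intersecting with the union changes no member and brings the sum into the
          form of \<open>indicator_decomp\<close>.\<close>
        also have "(\<lambda>x. \<Sum>B\<in>R2. indicator B x :: real) = (\<lambda>x. \<Sum>B\<in>R2. indicator (\<Union>R2 \<inter> B) x)"
          by (intro ext sum.cong arg_cong2[where f=indicator]) auto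
        also have "\<dots> = indicator (\<Union>R2)"
          using Q(3) fin by (intro indicator_decomp[symmetric]) (auto simp: R2_def Q'_def disjoint_def)
        also have "C * m (indicator (\<Union>R2)) \<le> C * m (indicator K)"
          using \<open>C \<ge> 0\<close> by (intro mult_left_mono m_indicator_mono) (auto simp: R2_def)
        finally show ?thesis .
      qed
      ultimately show ?thesis by linarith
    qed
    ultimately show ?thesis by blast
  qed
  ultimately show ?thesis by blast
qed

text \<open>The cell estimate summed over a representation. \<open>C\<close> depends on
  \<open>N\<close>, but the factor 2 does not, so \<open>N\<close> can later be chosen with
  \<open>s ^ N\<close> larger.\<close>

lemma weighted_Ln:
  "\<exists>C\<ge>0. \<forall>w f. weighted w f \<longrightarrow> (\<exists>v. weighted v ((L ^^ N) f) \<and> v \<le> 2 * w + C * m f)"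
proof -
  obtain C where C: "C \<ge> 0"
    "\<forall>K\<in>\<K>. \<exists>w. weighted w ((L ^^ N) (indicator K)) \<and> w \<le> 2 + C * m (indicator K)"
    using weighted_Ln_cell[of N] by blast
  have "\<exists>v. weighted v ((L ^^ N) f) \<and> v \<le> 2 * w + C * m f" if "weighted w f" for w f
    using that
  proof (induction rule: weighted.induct)
    case zero
    show ?case using weighted.zero by (auto simp: Ln_zero m_zero)
  next
    case (cell w f K c)
    obtain u where u: "weighted u ((L ^^ N) f)" "u \<le> 2 * w + C * m f" using cell.IH by blast
    obtain v where v: "weighted v ((L ^^ N) (indicator K))" "v \<le> 2 + C * m (indicator K)"
      using C cell.hyps by blast
    have "weighted (u + c * v) ((L ^^ N) (\<lambda>x. f x + c * indicator K x))"
      unfolding Ln_add Ln_cmult by (intro weighted_add weighted_cmult u v cell.hyps)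
    moreover have "m (\<lambda>x. f x + c * indicator K x) = m f + c * m (indicator K)"
      using bounded_weighted[OF cell.hyps(1)] by (simp add: m_add m_cmult bounded_on_cmult)
    moreover have "c * v \<le> c * (2 + C * m (indicator K))" using v(2) cell.hyps(3) by (rule mult_left_mono)
    ultimately show ?case using u(2) by (intro exI[of _ "u + c * v"]) (auto simp: algebra_simps)
  qed
  with C(1) show ?thesis by blast
qed

text \<open>One more block doubles the term \<open>C * m f * s ^ (N * k)\<close> and adds another
  copy of it. These three copies fit into the next power because \<open>4 \<le> s ^ N\<close>, so
  \<open>C\<close> does not grow with \<open>k\<close>.\<close>

lemma weighted_iterate:
  assumes "4 \<le> s ^ N"
  shows "\<exists>C\<ge>0. \<forall>w f k. weighted w f \<longrightarrow>
    (\<exists>v. weighted v ((L ^^ (N * k)) f) \<and> v \<le> 2 ^ k * w + C * m f * s ^ (N * k))"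
proof -
  obtain C where C: "C \<ge> 0"
    "\<forall>w f. weighted w f \<longrightarrow> (\<exists>v. weighted v ((L ^^ N) f) \<and> v \<le> 2 * w + C * m f)"
    using weighted_Ln[of N] by (elim exE conjE) (rule that)
  have "\<exists>v. weighted v ((L ^^ (N * k)) f) \<and> v \<le> 2 ^ k * w + C * m f * s ^ (N * k)"
    if wf: "weighted w f" for w f k
  proof (induction k)
    case 0
    have "0 \<le> C * m f"
      using C(1) m_nonneg[OF bounded_weighted[OF wf] weighted_nonneg[OF wf]] by simp
    then show ?case using wf by (intro exI[of _ w]) auto
  next
    case (Suc k)
    have bf: "bounded_on X f" by (rule bounded_weighted[OF wf])
    have mf: "0 \<le> C * m f * s ^ (N * k)"
      using C(1) m_nonneg[OF bf weighted_nonneg[OF wf]] s_pos by simp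
    obtain v where v: "weighted v ((L ^^ (N * k)) f)" "v \<le> 2 ^ k * w + C * m f * s ^ (N * k)"
      using Suc by blast
    obtain u where u: "weighted u ((L ^^ N) ((L ^^ (N * k)) f))" "u \<le> 2 * v + C * m ((L ^^ (N * k)) f)"
      using C(2)[rule_format, OF v(1)] by blast
    have "u \<le> 2 * (2 ^ k * w + C * m f * s ^ (N * k)) + C * m f * s ^ (N * k)"
      using u(2) v(2) m_Ln[OF bf, of "N * k"] by (simp add: mult_ac)
    also have "\<dots> \<le> 2 ^ Suc k * w + 4 * (C * m f * s ^ (N * k))" using mf by simp
    also have "\<dots> \<le> 2 ^ Suc k * w + s ^ N * (C * m f * s ^ (N * k))"
      using mult_right_mono[OF assms mf] by simp
    finally have "u \<le> 2 ^ Suc k * w + C * m f * s ^ (N * Suc k)" by (simp add: power_add mult_ac)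
    moreover have "(L ^^ N) ((L ^^ (N * k)) f) = (L ^^ (N * Suc k)) f" by (simp add: funpow_add)
    ultimately show ?case using u(1) by auto
  qed
  with C(1) show ?thesis by blast
qed

text \<open>A cell of mass at least \<open>\<delta>\<close> contains a member of a fixed finite partition into nonempty cells of
  mass less than \<open>\<delta> / 2\<close>, since otherwise two of them would cover it.\<close>
lemma uniform_exactness:
  assumes "0 < \<delta>" "4 \<le> s ^ N"
  shows "\<exists>p0. \<forall>p\<ge>p0. \<forall>w f. weighted w f \<longrightarrow> (\<forall>x\<in>X. m f - \<delta> * w \<le> (L ^^ p) f x)"
proof -
  \<comment> \<open>With this \<open>l\<close>, iterating \<open>N * l\<close> times magnifies mass
    by more than \<open>2 / \<delta>\<close>. As images of partition members have mass at most 1,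
    the members have mass below \<open>\<delta> / 2\<close>.\<close>
  have "(1 / s ^ N) ^ l = 1 / s ^ (N * l)" for l
    by (simp add: power_mult power_one_over)
  moreover obtain l where "(1 / s ^ N) ^ l < \<delta> / 2"
    using real_arch_pow_inv[of "\<delta> / 2" "1 / s ^ N"] assms s_pos by (auto simp: field_simps)
  ultimately have l: "1 / s ^ (N * l) < \<delta> / 2" by simp
  obtain Q where Q: "finite Q" "Q \<subseteq> \<K>" "disjoint Q" "\<Union>Q = X"
    "\<forall>B\<in>Q. \<forall>K\<in>\<K>. K \<subseteq> B \<longrightarrow> (\<exists>K'\<in>\<K>. (L ^^ (N * l)) (indicator K) = indicator K')"
    using iterated_partition[of "N * l"] by (elim exE conjE) (rule that)
  have small: "m (indicator B) < \<delta> / 2" if BQ: "B \<in> Q" for B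
  proof -
    obtain K' where K': "K' \<in> \<K>" "(L ^^ (N * l)) (indicator B) = indicator K'"
      using Q(2,5) BQ by blast
    have "s ^ (N * l) * m (indicator B) \<le> 1"
      using m_Ln[of "indicator B" "N * l"] K' m_cell_le_one[OF K'(1)] by simp
    then have "m (indicator B) \<le> 1 / s ^ (N * l)" using s_pos by (simp add: field_simps)
    with l show ?thesis by simp
  qed
  have "finite (Q - {{}})" "Q - {{}} \<subseteq> \<K>" "{} \<notin> Q - {{}}" using Q(1,2) by auto
  then obtain p0 where p0: "\<forall>p\<ge>p0. \<forall>B\<in>Q - {{}}. \<forall>x\<in>X. 1 \<le> (L ^^ p) (indicator B) x"
    by (rule exE[OF exact_finite]) (rule that)
  have cell_case: "m (indicator K) - \<delta> \<le> (L ^^ p) (indicator K) x"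
    if K: "K \<in> \<K>" and p: "p0 \<le> p" and x: "x \<in> X" for K p x
  proof (cases "\<exists>B\<in>Q - {{}}. B \<subseteq> K")
    case True
    then obtain B where B: "B \<in> Q - {{}}" "B \<subseteq> K" by blast
    have "m (indicator K) - \<delta> \<le> 1" using m_cell_le_one[OF K] assms by simp
    also have "1 \<le> (L ^^ p) (indicator B) x" using p0 p B(1) x by blast
    also have "\<dots> \<le> (L ^^ p) (indicator K) x" using B x by (intro Ln_mono) (auto simp: indicator_def)
    finally show ?thesis .
  next
    case False
    define R where "R = {B \<in> Q. B \<inter> K \<noteq> {} \<and> \<not> B \<subseteq> K}"
    have "finite R" using Q(1) by (simp add: R_def)
    have "m (indicator K) \<le> m (\<lambda>x. \<Sum>B\<in>R. indicator B x)"
    proof (rule m_mono)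
      show "bounded_on X (\<lambda>x. \<Sum>B\<in>R. indicator B x)"
        by (rule bounded_weighted[OF weighted_sum[of R "\<lambda>B. B"]])
          (use Q(2) \<open>finite R\<close> in \<open>auto simp: R_def\<close>)
      fix y assume "y \<in> X"
      show "indicator K y \<le> (\<Sum>B\<in>R. indicator B y :: real)"
      proof (cases "y \<in> K")
        case True
        then obtain B where B: "B \<in> Q" "y \<in> B" using Q(4) \<open>y \<in> X\<close> by auto
        then have "B \<in> R" using True False by (auto simp: R_def)
        then have "indicator B y \<le> (\<Sum>B\<in>R. indicator B y :: real)"
          by (rule member_le_sum) (use \<open>finite R\<close> in auto)
        then show ?thesis using B True by simp
      qed (simp add: sum_nonneg)
    qed simp
    also have "\<dots> = (\<Sum>B\<in>R. m (indicator B))" using \<open>finite R\<close> by (simp add: m_sum)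
    also have "\<dots> \<le> (\<Sum>B\<in>R. \<delta> / 2)" using small by (intro sum_mono less_imp_le) (auto simp: R_def)
    also have "\<dots> = card R * (\<delta> / 2)" by simp
    also have "\<dots> \<le> 2 * (\<delta> / 2)"
      using cell_partial[OF Q(1-3) K] assms unfolding R_def by (intro mult_right_mono) auto
    finally have "m (indicator K) - \<delta> \<le> 0" by simp
    also have "0 \<le> (L ^^ p) (indicator K) x" using x by (intro Ln_nonneg) auto
    finally show ?thesis .
  qed
  \<comment> \<open>A cell with coefficient \<open>c\<close> loses at most
    \<open>\<delta> * c\<close>, which adds up to \<open>\<delta> * w\<close>.\<close>
  have "m f - \<delta> * w \<le> (L ^^ p) f x" if "weighted w f" "p0 \<le> p" "x \<in> X" for p w f x
    using that(1)
  proof (induction rule: weighted.induct)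
    case (cell w f K c)
    have "m (\<lambda>x. f x + c * indicator K x) = m f + c * m (indicator K)"
      using bounded_weighted[OF cell.hyps(1)] by (simp add: m_add m_cmult bounded_on_cmult)
    moreover have "c * (m (indicator K) - \<delta>) \<le> c * (L ^^ p) (indicator K) x"
      by (intro mult_left_mono cell_case cell.hyps that)
    ultimately show ?case using cell.IH by (simp add: Ln_add Ln_cmult algebra_simps)
  qed (simp add: m_zero Ln_zero)
  then show ?thesis by blast
qed

text \<open>Two preimages of every point at time \<open>n\<close> give \<open>2 \<le> s ^ n\<close>
  under \<open>m\<close>; squaring gives 4.\<close>

lemma expanding: "\<exists>N. 4 \<le> s ^ N"
proof -
  obtain n where n: "\<forall>x\<in>X. 2 \<le> (L ^^ n) one x" using Ln_one_ge_two by blast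
  have "m (\<lambda>x. 2 * one x) \<le> m ((L ^^ n) one)"
    using n by (intro m_mono bounded_Ln bounded_on_cmult) auto
  then have "2 \<le> s ^ n" by (simp add: m_cmult m_Ln m_one)
  then have "2 ^ 2 \<le> (s ^ n) ^ 2" by (intro power_mono) auto
  then show ?thesis by (auto simp: power_mult[symmetric])
qed

text \<open>The time depends on \<open>h\<close>, since mass may need long to overtake the weight of
  \<open>h\<close>; \<open>c\<close> and \<open>D\<close> do not. The upper bound for
  \<open>one\<close> uses multiples of the same \<open>N\<close>, so that the two bounds can be
  compared.\<close>

lemma lower_bound:
  "\<exists>N c D. 0 < c \<and> 0 < D \<and> (\<forall>k. \<forall>x\<in>X. (L ^^ (N * k)) one x \<le> D * s ^ (N * k)) \<and>
     (\<forall>h. step h \<longrightarrow> (\<forall>x\<in>X. 0 \<le> h x) \<longrightarrow> (\<exists>k. \<forall>x\<in>X. c * m h * s ^ (N * k) \<le> (L ^^ (N * k)) h x))"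
proof -
  obtain N where N: "4 \<le> s ^ N" using expanding by blast
  then have "N \<noteq> 0" by (cases N) auto
  obtain C where C: "C \<ge> 0" "\<forall>w f k. weighted w f \<longrightarrow>
      (\<exists>v. weighted v ((L ^^ (N * k)) f) \<and> v \<le> 2 ^ k * w + C * m f * s ^ (N * k))"
    using weighted_iterate[OF N] by (elim exE conjE) (rule that)
  \<comment> \<open>The extra 1 pays for the initial weight once mass has overtaken it.\<close>
  define D where "D = C + 1"
  have D: "0 < D" using C(1) by (simp add: D_def)
  \<comment> \<open>This makes the loss \<open>\<delta> * v\<close> at most half of the mass
    reached.\<close>
  define \<delta> where "\<delta> = 1 / (2 * D)"
  have "0 < \<delta>" using D by (simp add: \<delta>_def)
  obtain p0 where p0: "\<forall>p\<ge>p0. \<forall>w f. weighted w f \<longrightarrow> (\<forall>x\<in>X. m f - \<delta> * w \<le> (L ^^ p) f x)"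
    using uniform_exactness[OF \<open>0 < \<delta>\<close> N] by (elim exE) (rule that)
  \<comment> \<open>Half of the mass survives, and the power converts from time \<open>N * k\<close>
    to time \<open>N * (p0 + k)\<close>.\<close>
  define c where "c = 1 / (2 * s ^ (N * p0))"
  have "0 < c" using s_pos by (simp add: c_def)
  have pow2: "2 ^ k \<le> s ^ (N * k)" for k
    using power_mono[of 2 "s ^ N" k] N by (simp add: power_mult)
  have weight_ge: "f x \<le> w" if "weighted w f" for w f x
    using that
  proof (induction rule: weighted.induct)
    case (cell w f K c)
    have "c * indicator K x \<le> c" using cell.hyps(3) by (auto simp: indicator_def)
    then show ?case using cell.IH by simp
  qed simp
  have upper: "(L ^^ (N * k)) one x \<le> D * s ^ (N * k)" for k x
  proof -
    have "weighted 1 one" using weighted_indicator[OF X_cell, of 1] by simp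
    then obtain v where v: "weighted v ((L ^^ (N * k)) one)" "v \<le> 2 ^ k * 1 + C * m one * s ^ (N * k)"
      using C(2) by blast
    have "(L ^^ (N * k)) one x \<le> v" by (rule weight_ge[OF v(1)])
    also have "\<dots> \<le> D * s ^ (N * k)" using v(2) pow2[of k] by (simp add: D_def m_one algebra_simps)
    finally show ?thesis .
  qed
  have lower: "\<exists>k. \<forall>x\<in>X. c * m h * s ^ (N * k) \<le> (L ^^ (N * k)) h x"
    if h: "step h" "\<forall>x\<in>X. 0 \<le> h x" for h
  proof (cases "m h > 0")
    case False
    have "m h = 0" using False m_nonneg[OF bounded_step[OF h(1)]] h(2) by force
    then show ?thesis using h(2) by (intro exI[of _ 0]) simp
  next
    case True
    obtain w where w: "weighted w h" using nonneg_step_weighted[OF h(1)] h(2) by blast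
    \<comment> \<open>Then \<open>w \<le> 2 ^ k * m h\<close>, so the inherited weight satisfies
      \<open>2 ^ k * w \<le> 4 ^ k * m h \<le> s ^ (N * k) * m h\<close>.\<close>
    obtain k where k: "w / m h < 2 ^ k" using real_arch_pow[of 2] by auto
    have "2 ^ k * w \<le> 2 ^ k * (2 ^ k * m h)" using k True by (intro mult_left_mono) (auto simp: field_simps)
    also have "\<dots> = 4 ^ k * m h" by (simp flip: power_mult_distrib mult.assoc)
    also have "\<dots> \<le> s ^ (N * k) * m h"
      using power_mono[of 4 "s ^ N" k] N True by (intro mult_right_mono) (auto simp: power_mult)
    finally have kw: "2 ^ k * w \<le> s ^ (N * k) * m h" .
    obtain v where v: "weighted v ((L ^^ (N * k)) h)" "v \<le> 2 ^ k * w + C * m h * s ^ (N * k)"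
      using C(2)[rule_format, OF w] by blast
    have vD: "v \<le> D * (m h * s ^ (N * k))" using v(2) kw by (simp add: D_def algebra_simps)
    have "c * m h * s ^ (N * (p0 + k)) \<le> (L ^^ (N * (p0 + k))) h x" if x: "x \<in> X" for x
    proof -
      have "\<delta> * v \<le> \<delta> * (D * (m h * s ^ (N * k)))" using vD \<open>0 < \<delta>\<close> by (intro mult_left_mono) auto
      also have "\<dots> = m h * s ^ (N * k) / 2" using D by (simp add: \<delta>_def)
      finally have "m h * s ^ (N * k) / 2 \<le> m ((L ^^ (N * k)) h) - \<delta> * v"
        by (simp add: m_Ln[OF bounded_step[OF h(1)]] mult.commute)
      \<comment> \<open>Waiting \<open>N * p0 \<ge> p0\<close> steps keeps the total time a multiple
        of \<open>N\<close>.\<close>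
      also have "\<dots> \<le> (L ^^ (N * p0)) ((L ^^ (N * k)) h) x"
        using \<open>N \<noteq> 0\<close> by (intro p0[rule_format] v x) simp
      also have "\<dots> = (L ^^ (N * (p0 + k))) h x" by (simp add: funpow_add add_mult_distrib2)
      finally show ?thesis using s_pos by (simp add: c_def power_add add_mult_distrib2)
    qed
    then show ?thesis by blast
  qed
  show ?thesis using \<open>0 < c\<close> D upper lower by blast
qed

text \<open>The largest \<open>\<alpha>\<close> with \<open>\<alpha> (L ^^ n) one \<le> (L ^^ n) f\<close> approaches \<open>m f\<close>, because applying the lower
  bound to the difference diminishes the distance to \<open>m f\<close> by a fixed factor.\<close>
theorem Ln_ge_approx:
  assumes f: "step f" and e: "0 < e"
  shows "\<exists>n. \<forall>x\<in>X. (m f - e) * (L ^^ n) one x \<le> (L ^^ n) f x"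
proof -
  obtain N c D where c: "0 < c" "0 < D" and upper: "\<forall>k. \<forall>x\<in>X. (L ^^ (N * k)) one x \<le> D * s ^ (N * k)"
    and lower: "\<forall>h. step h \<longrightarrow> (\<forall>x\<in>X. 0 \<le> h x) \<longrightarrow> (\<exists>k. \<forall>x\<in>X. c * m h * s ^ (N * k) \<le> (L ^^ (N * k)) h x)"
    using lower_bound by (elim exE conjE) (rule that)
  \<comment> \<open>\<open>\<theta> * D \<le> c\<close> lets the lower bound for a gap
    \<open>r\<close> absorb the multiple \<open>\<theta> * r\<close> of \<open>one\<close>; the cap
    1/2 keeps \<open>1 - \<theta>\<close> positive.\<close>
  define \<theta> where "\<theta> = min (1/2) (c / D)"
  have \<theta>: "0 < \<theta>" "\<theta> < 1" "\<theta> * D \<le> c" using c by (auto simp: \<theta>_def min_def field_simps)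
  obtain b where b: "0 \<le> b" "\<And>x. x \<in> X \<Longrightarrow> \<bar>f x\<bar> \<le> b"
    using bounded_step[OF f] by (rule bounded_onE) auto
  \<comment> \<open>As \<open>m f - A \<le> - b\<close>, the induction can start at time 0.\<close>
  define A where "A = \<bar>m f\<bar> + b"
  have "0 \<le> A" using b by (simp add: A_def)
  have "\<exists>q. \<forall>x\<in>X. (m f - (1 - \<theta>) ^ j * A) * (L ^^ (N * q)) one x \<le> (L ^^ (N * q)) f x" for j
  proof (induction j)
    case 0
    have "m f - A \<le> f x" if "x \<in> X" for x using b(2)[OF that] by (simp add: A_def)
    then show ?case by (intro exI[of _ 0]) simp
  next
    case (Suc j)
    define r where "r = (1 - \<theta>) ^ j * A"
    have "0 \<le> r" using \<theta> \<open>0 \<le> A\<close> by (simp add: r_def)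
    obtain q where q: "\<And>x. x \<in> X \<Longrightarrow> (m f - r) * (L ^^ (N * q)) one x \<le> (L ^^ (N * q)) f x"
      using Suc unfolding r_def by blast
    \<comment> \<open>The excess of \<open>f\<close> over the current multiple of
      \<open>one\<close>; its value under \<open>m\<close> is exactly the gap
      \<open>r\<close>.\<close>
    define h where "h = (\<lambda>x. f x - (m f - r) * one x)"
    have sh: "step h" unfolding h_def by (intro step_diff step_cmult step_one f)
    have Lh: "(L ^^ n) h = (\<lambda>x. (L ^^ n) f x - (m f - r) * (L ^^ n) one x)" for n
      unfolding h_def Ln_diff Ln_cmult ..
    have mh: "m h = r"
      unfolding h_def
      by (simp add: m_diff[OF bounded_step[OF f] bounded_on_cmult[OF bounded_step[OF step_one]]]
          m_cmult m_one)
    obtain k where k: "\<forall>x\<in>X. c * m ((L ^^ (N * q)) h) * s ^ (N * k) \<le> (L ^^ (N * k)) ((L ^^ (N * q)) h) x"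
    proof -
    have "\<forall>x\<in>X. 0 \<le> (L ^^ (N * q)) h x" using q by (simp add: Lh)
    then have "\<exists>k. \<forall>x\<in>X. c * m ((L ^^ (N * q)) h) * s ^ (N * k) \<le> (L ^^ (N * k)) ((L ^^ (N * q)) h) x"
      using lower step_Ln[OF sh, of "N * q"] by blast
    then show ?thesis using that by blast
  qed
    have "(m f - (1 - \<theta>) * r) * (L ^^ (N * (k + q))) one x \<le> (L ^^ (N * (k + q))) f x" if x: "x \<in> X" for x
    proof -
      have "\<theta> * r * (L ^^ (N * (k + q))) one x \<le> \<theta> * r * (D * s ^ (N * (k + q)))"
        using \<theta> \<open>0 \<le> r\<close> by (intro mult_left_mono upper[rule_format] x) auto
      also have "\<dots> = (\<theta> * D) * (r * s ^ (N * (k + q)))" by simp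
      also have "\<dots> \<le> c * (r * s ^ (N * (k + q)))"
        using \<theta> \<open>0 \<le> r\<close> s_pos by (intro mult_right_mono) auto
      also have "\<dots> = c * m ((L ^^ (N * q)) h) * s ^ (N * k)"
        by (simp add: m_Ln[OF bounded_step[OF sh]] mh power_add add_mult_distrib2)
      also have "\<dots> \<le> (L ^^ (N * k)) ((L ^^ (N * q)) h) x" using k x by blast
      also have "\<dots> = (L ^^ (N * (k + q))) h x" by (simp add: funpow_add add_mult_distrib2)
      finally show ?thesis unfolding Lh by (simp add: algebra_simps)
    qed
    then show ?case unfolding r_def by (intro exI[of _ "k + q"]) (simp add: mult.assoc)
  qed
  moreover obtain j where j: "(1 - \<theta>) ^ j * A < e"
  proof -
    have "(\<lambda>j. (1 - \<theta>) ^ j * A) \<longlonglongrightarrow> 0 * A" using \<theta> by (intro tendsto_mult_right LIMSEQ_realpow_zero) auto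
    then have "eventually (\<lambda>j. (1 - \<theta>) ^ j * A < e) sequentially" using e by (intro order_tendstoD) auto
    then show ?thesis using that by (auto simp: eventually_sequentially)
  qed
  ultimately obtain q where q: "\<And>x. x \<in> X \<Longrightarrow> (m f - (1 - \<theta>) ^ j * A) * (L ^^ (N * q)) one x \<le> (L ^^ (N * q)) f x"
    by blast
  have "(m f - e) * (L ^^ (N * q)) one x \<le> (L ^^ (N * q)) f x" if "x \<in> X" for x
  proof -
    have "(m f - e) * (L ^^ (N * q)) one x \<le> (m f - (1 - \<theta>) ^ j * A) * (L ^^ (N * q)) one x"
      using j Ln_nonneg_one[OF that] by (intro mult_right_mono) auto
    also have "\<dots> \<le> (L ^^ (N * q)) f x" by (rule q[OF that])
    finally show ?thesis .
  qed
  then show ?thesis by blast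
qed

text \<open>With error \<open>m f\<close> the coefficient of \<open>one\<close> in the approximation
  vanishes.\<close>

corollary Ln_nonneg_of_m_pos:
  assumes "step f" "0 < m f"
  shows "\<exists>n. \<forall>x\<in>X. 0 \<le> (L ^^ n) f x"
proof -
  obtain n where n: "\<forall>x\<in>X. (m f - m f) * (L ^^ n) one x \<le> (L ^^ n) f x"
    using Ln_ge_approx[OF assms] by blast
  then show ?thesis by auto
qed

end

theorem (in exact_cell_system) exists_conformal:
  obtains s m where "conformal_system X \<sigma> P \<K> s m"
proof -
  obtain s m where *: "0 < s" "m one = 1"
    "\<And>f g. bounded_on X f \<Longrightarrow> bounded_on X g \<Longrightarrow> m (\<lambda>x. f x + g x) = m f + m g"
    "\<And>c f. bounded_on X f \<Longrightarrow> m (\<lambda>x. c * f x) = c * m f"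
    "\<And>f. bounded_on X f \<Longrightarrow> (\<And>x. x \<in> X \<Longrightarrow> 0 \<le> f x) \<Longrightarrow> 0 \<le> m f"
    "\<And>f. bounded_on X f \<Longrightarrow> m (L f) = s * m f"
    by (rule exists_eigenfunctional[OF X_nonempty L_one_ge]) auto
  have "conformal_system X \<sigma> P \<K> s m"
  proof unfold_locales
    show "0 \<le> m f" if "bounded_on X f" "\<And>x. x \<in> X \<Longrightarrow> 0 \<le> f x" for f
      using that by (rule *(5))
  qed (simp_all add: *)
  then show thesis by (rule that)
qed

section \<open>Cells as a basis of a compact topology\<close>

locale cell_space = cell_system +
  fixes T :: "'a topology"
  assumes topspace_T: "topspace T = X"
    and openin_iff_cells: "\<And>U. openin T U \<longleftrightarrow> U \<subseteq> X \<and> (\<forall>p\<in>U. \<exists>K\<in>\<K>. p \<in> K \<and> K \<subseteq> U)"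
    and compact_T: "compact_space T" and countable_cells: "countable \<K>"
begin

lemma openin_cell: "K \<in> \<K> \<Longrightarrow> openin T K"
  using cell_subset by (auto simp: openin_iff_cells)

text \<open>An atom of the algebra generated by finitely many cells is a finite intersection of
  cells and complements of cells, and both are open.\<close>

lemma step_open:
  assumes "step f"
  shows "openin T {p \<in> X. f p \<in> S}"
proof (subst openin_subopen, intro ballI)
  fix p assume p: "p \<in> {p \<in> X. f p \<in> S}"
  obtain Q where Q: "finite Q" "Q \<subseteq> \<K>" "determined_by Q f"
    using assms unfolding step_def by blast
  define U where "U = X \<inter> (\<Inter>K\<in>Q. if p \<in> K then K else X - K)"
  have piece: "openin T (if p \<in> K then K else X - K)" if "K \<in> Q" for K
  proof -
    have K: "K \<in> \<K>" using that Q(2) by auto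
    obtain A B where AB: "A \<in> \<K>" "B \<in> \<K>" "X - K = A \<union> B" using cell_compl[OF K] by blast
    have "openin T (X - K)" unfolding AB(3) using AB by (intro openin_Un openin_cell)
    then show ?thesis using openin_cell[OF K] by simp
  qed
  have "openin T U"
  proof (cases "Q = {}")
    case False
    show ?thesis
      unfolding U_def by (rule openin_Int[OF openin_cell[OF X_cell] openin_INT2[OF Q(1) False piece]])
  qed (use openin_cell[OF X_cell] in \<open>simp add: U_def\<close>)
  moreover have "p \<in> U" using p by (auto simp: U_def)
  moreover have "U \<subseteq> {p \<in> X. f p \<in> S}"
  proof
    fix q assume q: "q \<in> U"
    then have "q \<in> X" "\<forall>K\<in>Q. p \<in> K \<longleftrightarrow> q \<in> K" by (auto simp: U_def split: if_splits)
    then have "f p = f q" using Q(3) p unfolding determined_by_def by blast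
    then show "q \<in> {p \<in> X. f p \<in> S}" using p \<open>q \<in> X\<close> by simp
  qed
  ultimately show "\<exists>U. openin T U \<and> p \<in> U \<and> U \<subseteq> {p \<in> X. f p \<in> S}" by blast
qed

text \<open>The cells on which \<open>f\<close> is constant cover the space; compactness leaves
  finitely many, and these determine \<open>f\<close>.\<close>

lemma step_of_locally_constant:
  assumes "\<And>k. openin T {p \<in> X. f p = k}" "\<And>p. p \<notin> X \<Longrightarrow> f p = 0"
  shows "step f"
proof -
  define \<U> where "\<U> = {K \<in> \<K>. \<exists>k. \<forall>p\<in>K. f p = k}"
  have "\<forall>K\<in>\<U>. openin T K" by (auto simp: \<U>_def openin_cell)
  moreover have "topspace T \<subseteq> \<Union>\<U>"
  proof
    fix p assume "p \<in> topspace T"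
    then have "p \<in> {q \<in> X. f q = f p}" by (simp add: topspace_T)
    then obtain K where "K \<in> \<K>" "p \<in> K" "K \<subseteq> {q \<in> X. f q = f p}"
      using assms(1)[of "f p"] unfolding openin_iff_cells by blast
    then show "p \<in> \<Union>\<U>" by (auto simp: \<U>_def)
  qed
  ultimately obtain Q where Q: "finite Q" "Q \<subseteq> \<U>" "topspace T \<subseteq> \<Union>Q"
    using compact_T unfolding compact_space_alt by meson
  show ?thesis
  proof (rule stepI[OF assms(2) Q(1)])
    show "Q \<subseteq> \<K>" using Q(2) by (auto simp: \<U>_def)
    fix p q assume pq: "p \<in> X" "q \<in> X" "\<And>K. K \<in> Q \<Longrightarrow> p \<in> K \<longleftrightarrow> q \<in> K"
    obtain K where "K \<in> Q" "p \<in> K" using Q(3) pq(1) by (auto simp: topspace_T)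
    moreover from this have "q \<in> K" using pq(3) by blast
    ultimately have "K \<in> \<U>" "p \<in> K" "q \<in> K" using Q(2) by auto
    then show "f p = f q" by (auto simp: \<U>_def)
  qed
qed

end

section \<open>The split interval\<close>

text \<open>\<open>side c p\<close> says that \<open>p\<close> is at least \<open>c\<^sup>+\<close>; the point \<open>0\<close>, which is never split, counts
  as \<open>0\<^sup>+\<close>.\<close>
definition side :: "real \<Rightarrow> real \<times> bool \<Rightarrow> bool" where
  "side c p \<longleftrightarrow> c < fst p \<or> (fst p = c \<and> (snd p \<or> c = 0))"

text \<open>The order interval from \<open>c\<^sup>+\<close> to \<open>d\<^sup>-\<close>, empty if
  \<open>d \<le> c\<close>. The point 1 acts as \<open>1\<^sup>-\<close>, since it has no plus
  copy.\<close>

definition cell :: "real set \<Rightarrow> real \<Rightarrow> real \<Rightarrow> (real \<times> bool) set" where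
  "cell D c d = {p \<in> split_points D. side c p \<and> \<not> side d p}"

lemma side_mono: "side d p \<Longrightarrow> c \<le> d \<Longrightarrow> side c p"
  by (auto simp: side_def)

text \<open>Density lets the cuts at points of \<open>D\<close> separate all points; countability
  leaves an unsplit point in every nonempty cell.\<close>

locale split_interval =
  fixes D :: "real set"
  assumes D_subset: "D \<subseteq> {0..1}" and zero_D: "0 \<in> D" and one_D: "1 \<in> D"
    and countable_D: "countable D"
    and dense_D: "\<And>x y. 0 \<le> x \<Longrightarrow> x < y \<Longrightarrow> y \<le> 1 \<Longrightarrow> \<exists>e\<in>D. x < e \<and> e < y"
begin

abbreviation X :: "(real \<times> bool) set" where "X \<equiv> split_points D"

abbreviation TX :: "(real \<times> bool) topology" where "TX \<equiv> split_topology D"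

definition cells :: "(real \<times> bool) set set" where
  "cells = {cell D c d | c d. c \<in> D \<and> d \<in> D}"

lemma cellsI: "c \<in> D \<Longrightarrow> d \<in> D \<Longrightarrow> cell D c d \<in> cells"
  by (auto simp: cells_def)

lemma cellsE:
  assumes "K \<in> cells"
  obtains c d where "c \<in> D" "d \<in> D" "K = cell D c d"
  using assms by (auto simp: cells_def)

lemma fst_X: "p \<in> X \<Longrightarrow> 0 \<le> fst p \<and> fst p \<le> 1"
  using D_subset by (auto simp: split_points_def)

lemma D_bounds: "e \<in> D \<Longrightarrow> 0 \<le> e \<and> e \<le> 1"
  using D_subset by auto

lemma False_X: "0 \<le> u \<Longrightarrow> u \<le> 1 \<Longrightarrow> (u, False) \<in> X"
  by (auto simp: split_points_def)

lemma side_zero: "p \<in> X \<Longrightarrow> side 0 p"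
  using fst_X[of p] by (auto simp: side_def)

lemma not_side_one: "p \<in> X \<Longrightarrow> \<not> side 1 p"
  using fst_X[of p] by (auto simp: side_def split_points_def)

lemma side_nonsplit: "c \<in> D \<Longrightarrow> u \<notin> D \<Longrightarrow> side c (u, b) \<longleftrightarrow> c < u"
  by (auto simp: side_def)

text \<open>Different first components are separated by a cut from the dense set \<open>D\<close>;
  the two copies of a split point are separated by the cut at that point.\<close>

lemma split_less_iff_side:
  assumes "p \<in> X" "q \<in> X"
  shows "split_less q p \<longleftrightarrow> (\<exists>e\<in>D. side e p \<and> \<not> side e q)"
proof
  assume "split_less q p"
  then consider "fst q < fst p" | "fst q = fst p" "\<not> snd q" "snd p" by (auto simp: split_less_def)
  then show "\<exists>e\<in>D. side e p \<and> \<not> side e q"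
  proof cases
    case 1
    then obtain e where "e \<in> D" "fst q < e" "e < fst p" using dense_D fst_X assms by blast
    then show ?thesis by (auto simp: side_def)
  next
    case 2
    then have "fst p \<in> D" "fst p \<noteq> 0" using assms(1) by (auto simp: split_points_def)
    then show ?thesis using 2 by (intro bexI[of _ "fst p"]) (auto simp: side_def)
  qed
next
  assume "\<exists>e\<in>D. side e p \<and> \<not> side e q"
  then show "split_less q p"
    using fst_X[OF assms(1)] fst_X[OF assms(2)] by (force simp: side_def split_less_def)
qed

text \<open>Equalities between points of \<open>X\<close> are proved below by comparing them with
  every cut.\<close>

lemma eq_of_sides:
  assumes "p \<in> X" "q \<in> X" "\<And>e. e \<in> D \<Longrightarrow> side e p \<longleftrightarrow> side e q"
  shows "p = q"
proof -
  have "\<not> split_less q p" "\<not> split_less p q" using assms by (auto simp: split_less_iff_side)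
  then show ?thesis by (auto simp: split_less_def prod_eq_iff)
qed

lemma side_max: "side (max c c') p \<longleftrightarrow> side c p \<and> side c' p"
  by (metis max_def linear side_mono)

lemma side_min: "side (min c c') p \<longleftrightarrow> side c p \<or> side c' p"
  by (metis min_def linear side_mono)

lemma cell_Int_cell: "cell D c d \<inter> cell D c' d' = cell D (max c c') (min d d')"
  by (auto simp: cell_def side_max side_min)

lemma cell_max_min:
  assumes "c \<in> D" "c' \<in> D" shows "max c c' \<in> D" "min c c' \<in> D"
  using assms by (auto simp: max_def min_def)

lemma cells_Int: "K \<in> cells \<Longrightarrow> K' \<in> cells \<Longrightarrow> K \<inter> K' \<in> cells"
  by (elim cellsE) (simp add: cell_Int_cell cellsI cell_max_min)

lemma cell_empty: "d \<le> c \<Longrightarrow> cell D c d = {}"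
  by (auto simp: cell_def dest: side_mono)

lemma cell_zero_one: "cell D 0 1 = X"
  by (auto simp: cell_def side_zero not_side_one)

lemma exists_nonsplit:
  assumes "x < y"
  obtains u where "u \<notin> D" "x < u" "u < y"
proof -
  have "uncountable ({x<..<y} - D)"
    using assms countable_D by (intro uncountable_minus_countable) (auto simp: uncountable_open_interval)
  then have "{x<..<y} - D \<noteq> {}" by (metis countable_empty)
  then obtain z where "z \<in> {x<..<y} - D" by blast
  then show thesis using that[of z] by simp
qed

lemma nonsplit_in_cell:
  assumes "c \<in> D" "d \<in> D" "u \<notin> D" "c < u" "u < d"
  shows "(u, False) \<in> cell D c d"
proof -
  have "0 \<le> u" "u \<le> 1" using assms D_bounds[of c] D_bounds[of d] by auto
  then show ?thesis using assms by (simp add: cell_def False_X side_nonsplit)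
qed

lemma cell_nonempty_iff:
  assumes "c \<in> D" "d \<in> D"
  shows "cell D c d \<noteq> {} \<longleftrightarrow> c < d"
proof
  assume "c < d"
  then obtain u where "u \<notin> D" "c < u" "u < d" by (rule exists_nonsplit)
  then show "cell D c d \<noteq> {}" using nonsplit_in_cell assms by blast
qed (use cell_empty in force)

lemma cell_compl:
  assumes "K \<in> cells"
  shows "\<exists>A\<in>cells. \<exists>B\<in>cells. A \<inter> B = {} \<and> X - K = A \<union> B"
proof -
  obtain c d where K: "c \<in> D" "d \<in> D" "K = cell D c d" using assms by (rule cellsE)
  show ?thesis
  proof (cases "c \<le> d")
    case True
    have "cell D 0 c \<inter> cell D d 1 = {}" using True by (auto simp: cell_def dest: side_mono)
    moreover have "X - K = cell D 0 c \<union> cell D d 1"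
      by (auto simp: K cell_def side_zero not_side_one)
    ultimately show ?thesis using K zero_D one_D by (blast intro: cellsI)
  next
    case False
    \<comment> \<open>Here \<open>K\<close> is empty; \<open>cell D 0 0\<close> writes the empty set
      as a cell.\<close>
    then have "X - K = cell D 0 1 \<union> cell D 0 0" by (simp add: K cell_empty cell_zero_one)
    moreover have "cell D 0 1 \<inter> cell D 0 0 = {}" by (simp add: cell_empty)
    ultimately show ?thesis using zero_D one_D by (blast intro: cellsI)
  qed
qed

text \<open>A cell that meets \<open>cell D c d\<close> without being contained in it contains \<open>c\<^sup>-\<close> or \<open>d\<^sup>-\<close>.\<close>
lemma cell_partial:
  assumes "finite Q" "Q \<subseteq> cells" "disjoint Q" "K \<in> cells"
  shows "card {B \<in> Q. B \<inter> K \<noteq> {} \<and> \<not> B \<subseteq> K} \<le> 2"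
proof -
  obtain c d where K: "c \<in> D" "d \<in> D" "K = cell D c d" using assms(4) by (rule cellsE)
  have one: "card {B \<in> Q. x \<in> B} \<le> 1" for x
    using assms(1,3) by (auto simp: disjoint_def card_le_Suc0_iff_eq)
  have "B \<in> {B \<in> Q. (c, False) \<in> B} \<union> {B \<in> Q. (d, False) \<in> B}"
    if B: "B \<in> Q" "B \<inter> K \<noteq> {}" "\<not> B \<subseteq> K" for B
  proof -
    obtain c' d' where B': "c' \<in> D" "d' \<in> D" "B = cell D c' d'"
      using assms(2) B(1) by (meson cellsE subsetD)
    obtain p where p: "p \<in> B" "p \<in> K" using B by auto
    obtain q where q: "q \<in> B" "q \<notin> K" using B by auto
    \<comment> \<open>If \<open>B\<close> has points on both sides of the cut at \<open>e\<close>,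
      then \<open>e\<close> lies strictly between its ends, so \<open>B\<close> contains
      \<open>e\<^sup>-\<close>.\<close>
    have cut: "(e, False) \<in> B" if "e \<in> D" "x \<in> B" "y \<in> B" "side e x" "\<not> side e y" for e x y
    proof -
      have "c' < e" "e < d'" using that(2-5) side_mono not_le unfolding B' cell_def by blast+
      then show ?thesis using D_bounds[OF that(1)] D_bounds[OF B'(1)] by (auto simp: B' cell_def False_X side_def)
    qed
    have "side c p" "\<not> side d p" "q \<in> X" using p q(1) by (auto simp: K B' cell_def)
    then have "\<not> side c q \<or> side d q" using q(2) by (auto simp: K cell_def)
    then show ?thesis
      using cut[OF K(1) p(1) q(1) \<open>side c p\<close>] cut[OF K(2) q(1) p(1) _ \<open>\<not> side d p\<close>] B(1) by blast
  qed
  then have "{B \<in> Q. B \<inter> K \<noteq> {} \<and> \<not> B \<subseteq> K} \<subseteq> {B \<in> Q. (c, False) \<in> B} \<union> {B \<in> Q. (d, False) \<in> B}"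
    by blast
  then have "card {B \<in> Q. B \<inter> K \<noteq> {} \<and> \<not> B \<subseteq> K} \<le> card ({B \<in> Q. (c, False) \<in> B} \<union> {B \<in> Q. (d, False) \<in> B})"
    using assms(1) by (intro card_mono) auto
  also have "\<dots> \<le> 1 + 1" by (rule order.trans[OF card_Un_le add_mono[OF one one]])
  finally show ?thesis by simp
qed

section \<open>The order topology and its compactness\<close>

lemma upper_ray:
  assumes "e \<in> D" "e \<noteq> 0" "e \<noteq> 1"
  shows "{q \<in> X. side e q} = {q \<in> X. split_less (e, False) q}"
  using assms by (auto simp: side_def split_less_def)

lemma lower_ray:
  assumes "e \<in> D" "e \<noteq> 0" "e \<noteq> 1"
  shows "{q \<in> X. \<not> side e q} = {q \<in> X. split_less q (e, True)}"
  using assms by (auto simp: side_def split_less_def)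

text \<open>Nothing lies strictly between \<open>e\<^sup>-\<close> and \<open>e\<^sup>+\<close>, so
  both halves of the cut are open rays. The ends 0 and 1 have no such pair.\<close>

lemma generated_rays:
  assumes "e \<in> D" "e \<noteq> 0" "e \<noteq> 1"
  shows "openin TX {q \<in> X. side e q}" "openin TX {q \<in> X. \<not> side e q}"
proof -
  have "(e, False) \<in> X" "(e, True) \<in> X" using assms D_bounds[of e] by (auto simp: split_points_def)
  then show "openin TX {q \<in> X. side e q}" "openin TX {q \<in> X. \<not> side e q}"
    unfolding upper_ray[OF assms] lower_ray[OF assms] split_topology_def openin_topology_generated_by_iff
    by (auto intro!: generate_topology_on.Basis)
qed

lemma openin_X: "openin TX X"
proof -
  obtain e where e: "e \<in> D" "0 < e" "e < 1" using dense_D[of 0 1] by auto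
  then have "X = {q \<in> X. side e q} \<union> {q \<in> X. \<not> side e q}" by auto
  then show ?thesis using generated_rays[of e] e openin_Un by fastforce
qed

lemma openin_side: "e \<in> D \<Longrightarrow> openin TX {q \<in> X. side e q = b}"
proof -
  assume e: "e \<in> D"
  consider "e = 0" | "e = 1" | "e \<noteq> 0" "e \<noteq> 1" by blast
  then show ?thesis
  proof cases
    case 1
    then have "{q \<in> X. side e q = b} = (if b then X else {})" using side_zero by auto
    then show ?thesis using openin_X by simp
  next
    case 2
    then have "{q \<in> X. side e q = b} = (if b then {} else X)" using not_side_one by auto
    then show ?thesis using openin_X by simp
  next
    case 3
    then show ?thesis using generated_rays[OF e] by (cases b) auto
  qed
qed

lemma openin_cell: "K \<in> cells \<Longrightarrow> openin TX K"
proof (elim cellsE)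
  fix c d assume "c \<in> D" "d \<in> D" "K = cell D c d"
  moreover have "cell D c d = {q \<in> X. side c q = True} \<inter> {q \<in> X. side d q = False}"
    by (auto simp: cell_def)
  ultimately show ?thesis using openin_Int[OF openin_side[of c True] openin_side[of d False]] by simp
qed

text \<open>The cells form a base: they are closed under intersection, and each point of a ray is
  divided from the end of the ray by a cut.\<close>

lemma openin_iff:
  "openin TX U \<longleftrightarrow> U \<subseteq> X \<and> (\<forall>p\<in>U. \<exists>K\<in>cells. p \<in> K \<and> K \<subseteq> U)"
proof
  assume "openin TX U"
  then have "generate_topology_on ((\<lambda>p. {q \<in> X. split_less q p}) ` X \<union> (\<lambda>p. {q \<in> X. split_less p q}) ` X) U"
    by (simp add: split_topology_def openin_topology_generated_by_iff)
  then show "U \<subseteq> X \<and> (\<forall>p\<in>U. \<exists>K\<in>cells. p \<in> K \<and> K \<subseteq> U)"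
  proof (induction rule: generate_topology_on.induct)
    case (Int U V)
    have "\<exists>K\<in>cells. p \<in> K \<and> K \<subseteq> U \<inter> V" if pUV: "p \<in> U \<inter> V" for p
    proof -
      obtain K K' where "K \<in> cells" "p \<in> K" "K \<subseteq> U" "K' \<in> cells" "p \<in> K'" "K' \<subseteq> V"
        using Int.IH pUV by blast
      then show ?thesis using cells_Int by (intro bexI[of _ "K \<inter> K'"]) auto
    qed
    then show ?case using Int.IH by blast
  next
    case (UN \<U>)
    then have "\<exists>K\<in>cells. p \<in> K \<and> K \<subseteq> \<Union>\<U>" if "p \<in> \<Union>\<U>" for p
      using that by (meson Union_iff Union_upper order.trans)
    moreover have "\<Union>\<U> \<subseteq> X" using UN by blast
    ultimately show ?case by blast
  next
    case (Basis U)
    then show ?case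
    proof (elim UnE imageE)
      fix p assume p: "p \<in> X" "U = {q \<in> X. split_less q p}"
      have "\<exists>K\<in>cells. q \<in> K \<and> K \<subseteq> U" if q: "q \<in> U" for q
      proof -
        obtain e where e: "e \<in> D" "side e p" "\<not> side e q"
          using q p by (auto simp: split_less_iff_side)
        then have "q \<in> cell D 0 e" using q p by (auto simp: cell_def side_zero)
        moreover have "cell D 0 e \<subseteq> U" using e p by (auto simp: cell_def split_less_iff_side)
        ultimately show ?thesis using e zero_D cellsI by blast
      qed
      then show ?thesis using p by blast
    next
      fix p assume p: "p \<in> X" "U = {q \<in> X. split_less p q}"
      have "\<exists>K\<in>cells. q \<in> K \<and> K \<subseteq> U" if q: "q \<in> U" for q
      proof -
        obtain e where e: "e \<in> D" "side e q" "\<not> side e p"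
          using q p by (auto simp: split_less_iff_side)
        then have "q \<in> cell D e 1" using q p by (auto simp: cell_def not_side_one)
        moreover have "cell D e 1 \<subseteq> U" using e p by (auto simp: cell_def split_less_iff_side)
        ultimately show ?thesis using e one_D cellsI by blast
      qed
      then show ?thesis using p by blast
    qed
  qed simp
next
  assume "U \<subseteq> X \<and> (\<forall>p\<in>U. \<exists>K\<in>cells. p \<in> K \<and> K \<subseteq> U)"
  then show "openin TX U"
    by (subst openin_subopen) (metis openin_cell)
qed

lemma topspace_split [simp]: "topspace TX = X"
proof
  show "topspace TX \<subseteq> X"
    using openin_topspace[of TX] unfolding openin_iff by (rule conjunct1)
qed (rule openin_subset[OF openin_X])

text \<open>Density of the unsplit points, by which statements about \<open>\<sigma>\<close> are
  reduced to statements about \<open>\<tau>\<close>.\<close>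

lemma open_contains_nonsplit:
  assumes "openin TX U" "U \<noteq> {}"
  obtains u where "u \<notin> D" "0 < u" "u < 1" "(u, False) \<in> U"
proof -
  obtain p where "p \<in> U" using assms(2) by blast
  then obtain K where K: "K \<in> cells" "p \<in> K" "K \<subseteq> U" using assms(1)[unfolded openin_iff] by blast
  obtain c d where cd: "c \<in> D" "d \<in> D" "K = cell D c d" using K(1) by (rule cellsE)
  then have "c < d" using cell_nonempty_iff K(2) by blast
  then obtain u where u: "u \<notin> D" "c < u" "u < d" by (rule exists_nonsplit)
  moreover have "(u, False) \<in> U" using nonsplit_in_cell[OF cd(1,2) u] K cd by auto
  moreover have "0 < u" "u < 1" using u D_bounds[OF cd(1)] D_bounds[OF cd(2)] by auto
  ultimately show thesis by (rule_tac that)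
qed

text \<open>A tube lemma for the collapse map: the one or two points over \<open>x\<close> lie in
  cells that together contain everything over a neighbourhood of \<open>x\<close>. Compactness of
  \<open>X\<close> then follows from that of the unit interval.\<close>

lemma fibre_cover:
  assumes "\<And>U. U \<in> \<U> \<Longrightarrow> openin TX U" "X \<subseteq> \<Union>\<U>" "0 \<le> x" "x \<le> 1"
  shows "\<exists>T. open T \<and> x \<in> T \<and> (\<exists>\<V>. finite \<V> \<and> \<V> \<subseteq> \<U> \<and> {p \<in> X. fst p \<in> T} \<subseteq> \<Union>\<V>)"
proof -
  have pt: "\<exists>U\<in>\<U>. \<exists>c\<in>D. \<exists>d\<in>D. p \<in> cell D c d \<and> cell D c d \<subseteq> U" if p: "p \<in> X" for p
  proof -
    obtain U where U: "U \<in> \<U>" "p \<in> U" using assms(2) p by blast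
    then obtain K where "K \<in> cells" "p \<in> K" "K \<subseteq> U" using assms(1) openin_iff by metis
    then show ?thesis using U(1) by (blast elim: cellsE)
  qed
  obtain U c d where m: "U \<in> \<U>" "c \<in> D" "d \<in> D" "(x, False) \<in> cell D c d" "cell D c d \<subseteq> U"
    using pt[OF False_X[OF assms(3,4)]] by blast
  show ?thesis
  proof (cases "x \<in> D - {0, 1}")
    case True
    then have "(x, True) \<in> X" by (auto simp: split_points_def)
    then obtain V e f where r: "V \<in> \<U>" "e \<in> D" "f \<in> D" "(x, True) \<in> cell D e f" "cell D e f \<subseteq> V"
      using pt by blast
    \<comment> \<open>The cell around \<open>x\<^sup>-\<close> takes care of the points left of the
      cut at \<open>x\<close>, the cell around \<open>x\<^sup>+\<close> of those on its
      right.\<close>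
    have "c < x" "x \<le> d" "e \<le> x" "x < f" using m(4) r(4) True by (auto simp: cell_def side_def)
    have "p \<in> U \<union> V" if p: "p \<in> X" "c < fst p" "fst p < f" for p
    proof (cases "side x p")
      case True
      then have "p \<in> cell D e f" using p \<open>e \<le> x\<close> by (auto simp: cell_def side_def)
      then show ?thesis using r by auto
    next
      case False
      then have "p \<in> cell D c d" using p \<open>x \<le> d\<close> by (auto simp: cell_def side_def)
      then show ?thesis using m by auto
    qed
    then show ?thesis using m(1) r(1) \<open>c < x\<close> \<open>x < f\<close>
      by (intro exI[of _ "{c<..<f}"] conjI exI[of _ "{U, V}"]) auto
  next
    case False
    \<comment> \<open>At an end of the unit interval the neighbourhood reaches out to -1 or 2, since
      no points lie beyond.\<close>
    have *: "p \<in> U" if p: "p \<in> X" "(if x = 0 then -1 else c) < fst p" "fst p < (if x = 1 then 2 else d)" for p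
    proof -
      have "side c p" using p m(4) fst_X[OF p(1)] D_bounds[OF m(2)]
        by (cases "x = 0") (auto simp: cell_def side_def)
      moreover have "\<not> side d p" using p m(4) fst_X[OF p(1)] D_bounds[OF m(3)]
        by (cases "x = 1") (auto simp: cell_def side_def split_points_def)
      ultimately show ?thesis using p m(5) by (auto simp: cell_def)
    qed
    have c: "(if x = 0 then -1 else c) < x"
      using m(2,4) False assms(3) by (auto simp: cell_def side_def)
    have d: "x < (if x = 1 then 2 else d)"
    proof (cases "x = 1 \<or> x \<notin> D")
      case True
      then show ?thesis using m(3,4) by (cases "x = d") (auto simp: cell_def side_def)
    next
      case F: False
      with False have "x = 0" by auto
      then show ?thesis using m(3,4) D_bounds[OF m(3)] by (auto simp: cell_def side_def)
    qed
    show ?thesis using m(1) c d *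
      by (intro exI[of _ "{(if x = 0 then -1 else c)<..<(if x = 1 then 2 else d)}"] conjI exI[of _ "{U}"])
         (auto simp del: if_split_asm)
  qed
qed

lemma compact_split: "compact_space TX"
  unfolding compact_space_alt
proof (intro allI impI, elim conjE)
  fix \<U> assume U: "\<forall>U\<in>\<U>. openin TX U" "topspace TX \<subseteq> \<Union>\<U>"
  have "\<forall>x\<in>{0..1}. \<exists>T. open T \<and> x \<in> T \<and> (\<exists>\<V>. finite \<V> \<and> \<V> \<subseteq> \<U> \<and> {p \<in> X. fst p \<in> T} \<subseteq> \<Union>\<V>)"
    using U by (auto intro!: fibre_cover)
  from bchoice[OF this] obtain T where T: "\<forall>x\<in>{0..1}. open (T x) \<and> x \<in> T x \<and>
      (\<exists>\<V>. finite \<V> \<and> \<V> \<subseteq> \<U> \<and> {p \<in> X. fst p \<in> T x} \<subseteq> \<Union>\<V>)" by (elim exE)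
  then have "\<forall>x\<in>{0..1}. \<exists>\<V>. finite \<V> \<and> \<V> \<subseteq> \<U> \<and> {p \<in> X. fst p \<in> T x} \<subseteq> \<Union>\<V>" by blast
  from bchoice[OF this] obtain \<V> where V: "\<forall>x\<in>{0..1}. finite (\<V> x) \<and> \<V> x \<subseteq> \<U> \<and>
      {p \<in> X. fst p \<in> T x} \<subseteq> \<Union>(\<V> x)" by (elim exE)
  obtain F where F: "finite F" "F \<subseteq> {0..1::real}" "{0..1} \<subseteq> (\<Union>x\<in>F. T x)"
    by (rule compactE_image[of "{0..1::real}" "{0..1}" T]) (use T in auto)
  have VF: "finite (\<V> x)" "\<V> x \<subseteq> \<U>" "{p \<in> X. fst p \<in> T x} \<subseteq> \<Union>(\<V> x)" if "x \<in> F" for x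
    using V F(2) that by blast+
  have "finite (\<Union>x\<in>F. \<V> x)" "(\<Union>x\<in>F. \<V> x) \<subseteq> \<U>"
    using F(1) VF(1,2) by (simp, blast)
  moreover have "topspace TX \<subseteq> \<Union>(\<Union>x\<in>F. \<V> x)"
  proof
    fix p assume "p \<in> topspace TX"
    then have p: "p \<in> X" by simp
    then have "fst p \<in> {0..1}" using fst_X by simp
    then obtain x where "x \<in> F" "fst p \<in> T x" using F by blast
    then show "p \<in> \<Union>(\<Union>x\<in>F. \<V> x)" using VF(3)[of x] p by blast
  qed
  ultimately show "\<exists>\<F>. finite \<F> \<and> \<F> \<subseteq> \<U> \<and> topspace TX \<subseteq> \<Union>\<F>" by blast
qed

end

section \<open>Monotone branches on the split interval\<close>

text \<open>\<open>inc\<close> gives the orientation, so that \<open>(x < y) = inc\<close> covers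
  increasing and decreasing branches at once. \<open>\<sigma>\<close> and \<open>g\<close> are
  linked at unsplit points only.\<close>

locale split_branch = split_interval +
  fixes \<sigma> :: "real \<times> bool \<Rightarrow> real \<times> bool" and g :: "real \<Rightarrow> real" and l r :: real and inc :: bool
  assumes \<sigma>_cont: "continuous_map TX TX \<sigma>"
    and lr: "l \<in> D" "r \<in> D" "l < r"
    and g_cont: "continuous_on {l..r} g"
    and g_range: "\<And>x. x \<in> {l..r} \<Longrightarrow> g x \<in> {0..1}"
    and g_mono: "\<And>x y. x \<in> {l..r} \<Longrightarrow> y \<in> {l..r} \<Longrightarrow> x \<noteq> y \<Longrightarrow> g x < g y \<longleftrightarrow> (x < y) = inc"
    and g_D: "\<And>x. x \<in> {l..r} \<Longrightarrow> g x \<in> D \<longleftrightarrow> x \<in> D"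
    and \<sigma>_g: "\<And>u. u \<notin> D \<Longrightarrow> l < u \<Longrightarrow> u < r \<Longrightarrow> fst (\<sigma> (u, False)) = g u"
begin

lemma \<sigma>_X: "p \<in> X \<Longrightarrow> \<sigma> p \<in> X"
  using \<sigma>_cont by (auto simp: continuous_map_def)

text \<open>Both sides of the equivalence are locally constant in \<open>p\<close>, so an unsplit
  point \<open>u\<close> can replace \<open>p\<close>; there they become \<open>g c < g u\<close>
  and \<open>c < u\<close>.\<close>

lemma side_\<sigma>:
  assumes p: "p \<in> cell D l r" and c: "c \<in> D" "l \<le> c" "c \<le> r"
  shows "side (g c) (\<sigma> p) \<longleftrightarrow> side c p = inc"
proof -
  have gc: "g c \<in> D" using c g_D by auto
  have pX: "p \<in> X" using p by (auto simp: cell_def)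
  define U where "U = {q \<in> X. \<sigma> q \<in> {z \<in> X. side (g c) z = side (g c) (\<sigma> p)}}"
  have "openin TX U"
    using openin_continuous_map_preimage[OF \<sigma>_cont openin_side[OF gc]] unfolding U_def by simp
  then have "openin TX (U \<inter> cell D l r \<inter> {q \<in> X. side c q = side c p})"
    by (rule openin_Int[OF openin_Int[OF _ openin_cell[OF cellsI[OF lr(1,2)]]] openin_side[OF c(1)]])
  moreover have "p \<in> U \<inter> cell D l r \<inter> {q \<in> X. side c q = side c p}"
    using p pX \<sigma>_X by (auto simp: U_def)
  ultimately obtain u where u: "u \<notin> D" "0 < u" "u < 1"
      "(u, False) \<in> U \<inter> cell D l r \<inter> {q \<in> X. side c q = side c p}"
    using open_contains_nonsplit by blast
  have "\<not> r < u" "l < u" "u \<noteq> r"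
    using u(1,4) lr side_nonsplit[OF lr(1) u(1), of False] side_nonsplit[OF lr(2) u(1), of False]
    by (auto simp: cell_def)
  then have ulr: "l < u" "u < r" by auto
  have gu: "g u \<notin> D" using g_D[of u] ulr u(1) by auto
  have "side (g c) (\<sigma> p) = side (g c) (\<sigma> (u, False))" using u(4) by (auto simp: U_def)
  also have "\<dots> \<longleftrightarrow> g c < g u"
    using side_nonsplit[OF gc gu, of "snd (\<sigma> (u, False))"] \<sigma>_g[OF u(1) ulr] by (metis prod.collapse)
  also have "\<dots> \<longleftrightarrow> (c < u) = inc" using c ulr u(1) by (intro g_mono) auto
  also have "\<dots> \<longleftrightarrow> side c p = inc" using u(1,4) c(1) by (auto simp: side_nonsplit)
  finally show ?thesis .
qed

text \<open>The image determines the position of \<open>p\<close> relative to cuts within the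
  branch; all other cuts lie beyond the ends of the cell.\<close>

lemma inj_on_branch: "inj_on \<sigma> (cell D l r)"
proof (rule inj_onI)
  fix p q assume pq: "p \<in> cell D l r" "q \<in> cell D l r" "\<sigma> p = \<sigma> q"
  show "p = q"
  proof (rule eq_of_sides)
    fix e assume e: "e \<in> D"
    consider "e < l" | "l \<le> e" "e \<le> r" | "r < e" by linarith
    then show "side e p = side e q"
    proof cases
      case 1
      then show ?thesis using pq(1,2) side_mono[of l p e] side_mono[of l q e] by (auto simp: cell_def)
    next
      case 2
      then show ?thesis using side_\<sigma>[OF pq(1) e] side_\<sigma>[OF pq(2) e] pq(3) by auto
    next
      case 3
      then show ?thesis using pq(1,2) side_mono[of e p r] side_mono[of e q r] by (auto simp: cell_def)
    qed
  qed (use pq in \<open>auto simp: cell_def\<close>)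
qed

lemma g_eq:
  assumes "x \<in> {l..r}" "y \<in> {l..r}" shows "g x = g y \<longleftrightarrow> x = y"
  using g_mono[OF assms] g_mono[OF assms(2,1)] by (cases x y rule: linorder_cases) auto

lemma g_less: "x \<in> {l..r} \<Longrightarrow> y \<in> {l..r} \<Longrightarrow> g x < g y \<longleftrightarrow> (if inc then x < y else y < x)"
  using g_mono[of x y] by (cases "x = y") auto

lemma g_le: "x \<in> {l..r} \<Longrightarrow> y \<in> {l..r} \<Longrightarrow> g x \<le> g y \<longleftrightarrow> (if inc then x \<le> y else y \<le> x)"
  using g_less[of y x] by (auto simp: not_less[symmetric])

lemma g_IVT:
  assumes "l \<le> c" "c \<le> d" "d \<le> r" "min (g c) (g d) \<le> y" "y \<le> max (g c) (g d)"
  obtains x where "c \<le> x" "x \<le> d" "g x = y"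
proof -
  have "continuous_on {c..d} g" by (rule continuous_on_subset[OF g_cont]) (use assms in auto)
  then show thesis
    using assms IVT'[of g c y d] IVT2'[of g d y c] that by (cases "g c \<le> g d") (auto simp: min_def max_def)
qed

text \<open>By the intermediate value theorem a cut that \<open>g\<close> does not attain lies
  outside its range, so everything over the range is on one side of it.\<close>

lemma side_outside:
  assumes "e \<in> D" "\<And>x. l \<le> x \<Longrightarrow> x \<le> r \<Longrightarrow> g x \<noteq> e" "q \<in> X" "min (g l) (g r) \<le> fst q" "fst q \<le> max (g l) (g r)"
  shows "side e q \<longleftrightarrow> e < g l"
proof -
  have "\<not> (min (g l) (g r) \<le> e \<and> e \<le> max (g l) (g r))"
    using g_IVT[of l r e] assms(2) lr by (metis less_imp_le order_refl)
  then show ?thesis using assms(4,5) by (auto simp: side_def min_def max_def split: if_splits)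
qed

lemma fst_\<sigma>_bounds:
  assumes "p \<in> cell D l r"
  shows "min (g l) (g r) \<le> fst (\<sigma> p)" "fst (\<sigma> p) \<le> max (g l) (g r)"
proof -
  have p: "side l p" "\<not> side r p" using assms by (auto simp: cell_def)
  then have "side (g l) (\<sigma> p) = inc" "side (g r) (\<sigma> p) = (\<not> inc)"
    using side_\<sigma>[OF assms, of l] side_\<sigma>[OF assms, of r] lr by auto
  then show "min (g l) (g r) \<le> fst (\<sigma> p)" "fst (\<sigma> p) \<le> max (g l) (g r)"
    by (cases inc; auto simp: side_def)+
qed

text \<open>At 0 only the upper side exists and at 1 only the lower one.\<close>

lemma exists_point:
  assumes "0 \<le> x" "x \<le> 1" "x \<in> D \<Longrightarrow> (x = 0 \<longrightarrow> b) \<and> (x = 1 \<longrightarrow> \<not> b)"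
  obtains p where "p \<in> X" "fst p = x" "x \<in> D \<Longrightarrow> side x p = b"
proof (cases "b \<and> x \<in> D - {0, 1}")
  case True
  then show thesis by (intro that[of "(x, True)"]) (auto simp: split_points_def side_def)
next
  case False
  then show thesis using assms by (intro that[of "(x, False)"]) (auto simp: split_points_def side_def)
qed

text \<open>The ends of the image are the images of the ends, exchanged when the branch decreases. A
  preimage of \<open>q\<close> is found by the intermediate value theorem in the first component,
  and then the right copy is selected.\<close>

lemma branch_image:
  assumes "K \<in> cells" "K \<subseteq> cell D l r"
  shows "\<sigma> ` K \<in> cells"
proof -
  obtain c0 d0 where K0: "c0 \<in> D" "d0 \<in> D" "K = cell D c0 d0" using assms(1) by (rule cellsE)
  define c where "c = max c0 l"
  define d where "d = min d0 r"
  have cd: "c \<in> D" "d \<in> D" using K0 lr cell_max_min by (auto simp: c_def d_def)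
  have K: "K = cell D c d"
    using assms(2) cell_Int_cell[of c0 d0 l r] K0 by (auto simp: c_def d_def)
  show ?thesis
  proof (cases "c < d")
    case False
    then have "\<sigma> ` K = cell D 0 0" using cell_empty by (simp add: K)
    then show ?thesis using zero_D cellsI by simp
  next
    case True
    have lcdr: "l \<le> c" "c < d" "d \<le> r" using True by (auto simp: c_def d_def)
    define c' where "c' = (if inc then g c else g d)"
    define d' where "d' = (if inc then g d else g c)"
    have D': "c' \<in> D" "d' \<in> D" using cd lcdr g_D by (auto simp: c'_def d'_def)
    have "\<sigma> ` K = cell D c' d'"
    proof
      show "\<sigma> ` K \<subseteq> cell D c' d'"
      proof (rule image_subsetI)
        fix p assume p: "p \<in> K"
        then have "side c p" "\<not> side d p" "p \<in> cell D l r" using assms(2) by (auto simp: K cell_def)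
        then show "\<sigma> p \<in> cell D c' d'"
          using side_\<sigma>[of p c] side_\<sigma>[of p d] cd lcdr \<sigma>_X[of p]
          by (auto simp: cell_def c'_def d'_def)
      qed
    next
      show "cell D c' d' \<subseteq> \<sigma> ` K"
      proof
        fix q assume q: "q \<in> cell D c' d'"
        define y where "y = fst q"
        have qX: "q \<in> X" and qs: "side c' q" "\<not> side d' q" using q by (auto simp: cell_def)
        have y: "c' \<le> y" "y \<le> d'" using qs by (auto simp: side_def y_def)
        have "g c < g d \<longleftrightarrow> inc" using g_less[of c d] lcdr by auto
        then have "min (g c) (g d) \<le> y" "y \<le> max (g c) (g d)"
          using y by (auto simp: c'_def d'_def split: if_splits)
        then obtain x where x: "c \<le> x" "x \<le> d" "g x = y"
          using g_IVT[of c d y] lcdr by auto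
        have xlr: "x \<in> {l..r}" using x lcdr by auto
        \<comment> \<open>The side on which the preimage must lie: a decreasing branch exchanges
          sides. \<open>bc\<close> and \<open>bd\<close> keep it within \<open>K\<close> when
          \<open>x\<close> is an end.\<close>
        define b where "b \<longleftrightarrow> side y q = inc"
        have bc: "x = c \<Longrightarrow> b" and bd: "x = d \<Longrightarrow> \<not> b"
          using qs x(3) by (auto simp: b_def c'_def d'_def split: if_splits)
        have "0 \<le> x" "x \<le> 1" using x D_bounds[OF cd(1)] D_bounds[OF cd(2)] by auto
        moreover have "(x = 0 \<longrightarrow> b) \<and> (x = 1 \<longrightarrow> \<not> b)"
          using x D_bounds[OF cd(1)] D_bounds[OF cd(2)] bc bd by force
        ultimately obtain p where p: "p \<in> X" "fst p = x" "x \<in> D \<Longrightarrow> side x p = b"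
          using exists_point[of x b] by blast
        have sidep: "side e p \<longleftrightarrow> (if e = x then b else e < x)" if "e \<in> D" for e
          using p that by (auto simp: side_def)
        have pK: "p \<in> K"
          unfolding K cell_def using p(1) sidep[OF cd(1)] sidep[OF cd(2)] x bc bd by auto
        then have pl: "p \<in> cell D l r" using assms(2) by auto
        have "\<sigma> p = q"
        proof (rule eq_of_sides[OF \<sigma>_X[OF p(1)] qX])
          fix e assume e: "e \<in> D"
          show "side e (\<sigma> p) = side e q"
          \<comment> \<open>A cut that is attained by \<open>g\<close> is pulled back to a cut at
            \<open>z\<close>; any other cut has \<open>\<sigma> p\<close> and \<open>q\<close> on
            the same side.\<close>
          proof (cases "\<exists>z. l \<le> z \<and> z \<le> r \<and> g z = e")
            case True
            then obtain z where z: "z \<in> {l..r}" "g z = e" by auto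
            then have zD: "z \<in> D" using e g_D by auto
            have "side e (\<sigma> p) \<longleftrightarrow> side z p = inc" using side_\<sigma>[OF pl zD] z by auto
            also have "\<dots> \<longleftrightarrow> side e q"
            proof (cases "z = x")
              case True
              then show ?thesis using sidep[OF zD] z x(3) by (auto simp: b_def)
            next
              case False
              then have "e \<noteq> y" using g_eq[OF z(1) xlr] z(2) x(3) by simp
              then have "side e q \<longleftrightarrow> e < y" by (auto simp: side_def y_def)
              then show ?thesis using sidep[OF zD] False g_mono[OF z(1) xlr False] z(2) x(3) by auto
            qed
            finally show ?thesis .
          next
            case False
            have "min (g l) (g r) \<le> y" "y \<le> max (g l) (g r)"
              using x(3) xlr lr g_le[of l x] g_le[of x r] g_le[of r x] g_le[of x l]
              by (cases inc; simp add: min_le_iff_disj le_max_iff_disj)+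
            then show ?thesis
              using side_outside[OF e, of "\<sigma> p"] side_outside[OF e, of q] False qX \<sigma>_X[OF p(1)]
                fst_\<sigma>_bounds[OF pl] by (auto simp: y_def)
          qed
        qed
        then show "q \<in> \<sigma> ` K" using pK by blast
      qed
    qed
    then show ?thesis using D' cellsI by simp
  qed
qed

text \<open>A cut attained by \<open>g\<close> pulls back to a cut within the branch; otherwise the
  preimage is the whole branch or empty.\<close>

lemma branch_vimage_side:
  assumes "e \<in> D"
  shows "{p \<in> cell D l r. side e (\<sigma> p) = b} \<in> cells"
proof (cases "\<exists>z. l \<le> z \<and> z \<le> r \<and> g z = e")
  case True
  then obtain z where z: "l \<le> z" "z \<le> r" "g z = e" by auto
  then have zD: "z \<in> D" using assms g_D by auto
  have "{p \<in> cell D l r. side e (\<sigma> p) = b} = {p \<in> cell D l r. side z p = (b = inc)}"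
    using side_\<sigma>[OF _ zD z(1,2)] z(3) by auto
  also have "\<dots> = (if b = inc then cell D z r else cell D l z)"
    using z by (auto simp: cell_def dest: side_mono)
  finally show ?thesis using lr zD cellsI by simp
next
  case False
  have "side e (\<sigma> p) \<longleftrightarrow> e < g l" if p: "p \<in> cell D l r" for p
  proof (rule side_outside[OF assms])
    show "\<sigma> p \<in> X" using p \<sigma>_X by (simp add: cell_def)
  qed (use False fst_\<sigma>_bounds[OF p] in auto)
  then have "{p \<in> cell D l r. side e (\<sigma> p) = b} = {p \<in> cell D l r. (e < g l) = b}" by auto
  also have "\<dots> = (if (e < g l) = b then cell D l r else cell D 0 0)" by (auto simp: cell_empty)
  finally show ?thesis using lr zero_D cellsI by simp
qed

lemma branch_vimage:
  assumes "K \<in> cells"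
  shows "cell D l r \<inter> \<sigma> -` K \<in> cells"
proof -
  obtain c d where K: "c \<in> D" "d \<in> D" "K = cell D c d" using assms by (rule cellsE)
  have "cell D l r \<inter> \<sigma> -` K = {p \<in> cell D l r. side c (\<sigma> p) = True} \<inter> {p \<in> cell D l r. side d (\<sigma> p) = False}"
    using \<sigma>_X by (auto simp: K cell_def)
  then show ?thesis
    by (simp only: cells_Int[OF branch_vimage_side[OF K(1)] branch_vimage_side[OF K(2)]])
qed

end

section \<open>Piecewise monotonic interval maps\<close>

text \<open>The end values are the infimum and the supremum of the values. A further point between
  an end and \<open>x\<close> makes the inequalities at the ends strict.\<close>

lemma strict_mono_on_extend_Icc:
  fixes h :: "real \<Rightarrow> real"
  assumes cd: "c < d" and mono: "strict_mono_on {c<..<d} h" and cont: "continuous_on {c<..<d} h"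
    and range: "h ` {c<..<d} \<subseteq> {0..1}"
  obtains G where "continuous_on {c..d} G" "strict_mono_on {c..d} G" "\<And>x. x \<in> {c<..<d} \<Longrightarrow> G x = h x"
    "G ` {c..d} \<subseteq> {0..1}"
proof -
  define A where "A = h ` {c<..<d}"
  define G where "G x = (if x \<le> c then Inf A else if d \<le> x then Sup A else h x)" for x
  have A01: "0 \<le> z \<and> z \<le> 1" if "z \<in> A" for z using range that by (auto simp: A_def)
  have A: "bdd_below A" "bdd_above A" "A \<noteq> {}"
    using A01 cd by (auto intro!: bdd_belowI[of A 0] bdd_aboveI[of A 1]) (auto simp: A_def)
  have hA: "h x \<in> A" if "c < x" "x < d" for x using that by (auto simp: A_def)
  have less: "h x < h y" if "c < x" "x < y" "y < d" for x y
    using mono that by (intro strict_mono_onD[OF mono]) auto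
  have Inf_less: "Inf A < h x" if x: "c < x" "x < d" for x
  proof -
    obtain y where "c < y" "y < x" using x dense by blast
    then have "Inf A \<le> h y" "h y < h x" using x by (auto intro!: cInf_lower A hA less)
    then show ?thesis by simp
  qed
  have less_Sup: "h x < Sup A" if x: "c < x" "x < d" for x
  proof -
    obtain y where "x < y" "y < d" using x dense by blast
    then have "h y \<le> Sup A" "h x < h y" using x by (auto intro!: cSup_upper A hA less)
    then show ?thesis by simp
  qed
  have Gh: "G x = h x" if "x \<in> {c<..<d}" for x using that by (simp add: G_def)
  have "strict_mono_on {c..d} G"
  proof (rule strict_mono_onI)
    fix x y assume xy: "x \<in> {c..d}" "y \<in> {c..d}" "x < y"
    obtain z where z: "c < z" "z < d" using cd dense by blast
    have "Inf A < Sup A" using Inf_less[OF z] less_Sup[OF z] by simp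
    then show "G x < G y"
      using xy Inf_less less_Sup less by (auto simp: G_def)
  qed
  moreover have "continuous_on {c..d} G"
  proof (rule continuous_on_IccI)
    show "(G \<longlongrightarrow> G c) (at_right c)"
    proof (rule order_tendstoI)
      fix y assume "y < G c"
      then have "y < Inf A" by (simp add: G_def)
      then show "eventually (\<lambda>x. y < G x) (at_right c)"
        by - (rule eventually_mono[OF eventually_at_right_real[OF cd]], use Inf_less in \<open>force simp: G_def\<close>)
    next
      fix y assume "G c < y"
      then have "Inf A < y" by (simp add: G_def)
      then obtain z where z: "c < z" "z < d" "h z < y" using cInf_less_iff[OF A(3,1)] by (auto simp: A_def)
      show "eventually (\<lambda>x. G x < y) (at_right c)"
        by - (rule eventually_mono[OF eventually_at_right_real[OF z(1)]], use z less in \<open>force simp: G_def\<close>)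
    qed
    show "(G \<longlongrightarrow> G d) (at_left d)"
    proof (rule order_tendstoI)
      fix y assume "G d < y"
      then have "Sup A < y" using cd by (simp add: G_def)
      then show "eventually (\<lambda>x. G x < y) (at_left d)"
        by - (rule eventually_mono[OF eventually_at_left_real[OF cd]], use less_Sup in \<open>force simp: G_def\<close>)
    next
      fix y assume "y < G d"
      then have "y < Sup A" using cd by (simp add: G_def)
      then obtain z where z: "c < z" "z < d" "y < h z" using less_cSup_iff[OF A(3,2)] by (auto simp: A_def)
      show "eventually (\<lambda>x. y < G x) (at_left d)"
        by - (rule eventually_mono[OF eventually_at_left_real[OF z(2)]], use z less in \<open>force simp: G_def\<close>)
    qed
    fix x assume x: "c < x" "x < d"
    then have "(h \<longlongrightarrow> h x) (at x)"
      using cont by (auto simp: continuous_on_eq_continuous_at isCont_def)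
    moreover have "eventually (\<lambda>y. h y = G y) (at x)"
      using x Gh eventually_at_in_open'[of "{c<..<d}" x] by (auto elim!: eventually_mono)
    ultimately show "G \<midarrow>x\<rightarrow> G x"
      using x Gh[of x] by (metis filterlim_cong greaterThanLessThan_iff)
  qed (rule cd)
  moreover have "G ` {c..d} \<subseteq> {0..1}"
  proof -
    have "0 \<le> Inf A" using A A01 by (intro cInf_greatest) auto
    moreover have "Sup A \<le> 1" using A A01 by (intro cSup_least) auto
    moreover have "Inf A \<le> Sup A" using A by (rule_tac cInf_le_cSup)
    ultimately show ?thesis using A01 hA by (auto simp: G_def)
  qed
  ultimately show thesis using that Gh by blast
qed

definition order_on :: "real set \<Rightarrow> bool \<Rightarrow> (real \<Rightarrow> real) \<Rightarrow> bool" where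
  "order_on S inc f \<longleftrightarrow> (\<forall>x\<in>S. \<forall>y\<in>S. x \<noteq> y \<longrightarrow> (f x < f y \<longleftrightarrow> (x < y) = inc))"

lemma branch_properties:
  assumes lr: "a i < a (Suc i)" and mono: "monotonic_on_interval \<tau> (a i) (a (Suc i))"
    and range: "\<tau> ` {a i<..<a (Suc i)} \<subseteq> {0..1}"
  shows "continuous_on {a i..a (Suc i)} (branch \<tau> a i)"
    and "x \<in> {a i..a (Suc i)} \<Longrightarrow> branch \<tau> a i x \<in> {0..1}"
    and "x \<in> {a i<..<a (Suc i)} \<Longrightarrow> branch \<tau> a i x = \<tau> x"
    and "\<exists>inc. order_on {a i..a (Suc i)} inc (branch \<tau> a i)"
proof -
  define c d where "c = a i" and "d = a (Suc i)"
  have cd: "c < d" using lr by (simp add: c_def d_def)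
  have cont: "continuous_on {c<..<d} \<tau>" using mono by (simp add: monotonic_on_interval_def c_def d_def)
  have rng: "\<tau> ` {c<..<d} \<subseteq> {0..1}" using range by (simp add: c_def d_def)
  obtain G inc where G: "continuous_on {c..d} G" "\<And>x. x \<in> {c<..<d} \<Longrightarrow> G x = \<tau> x" "G ` {c..d} \<subseteq> {0..1}"
    "order_on {c..d} inc G"
  proof -
    from mono consider "strict_mono_on {c<..<d} \<tau>" | "strict_antimono_on {c<..<d} \<tau>"
      by (auto simp: monotonic_on_interval_def c_def d_def)
    then show thesis
    proof cases
      case 1
      obtain G where G: "continuous_on {c..d} G" "strict_mono_on {c..d} G" "\<And>x. x \<in> {c<..<d} \<Longrightarrow> G x = \<tau> x"
        "G ` {c..d} \<subseteq> {0..1}" using strict_mono_on_extend_Icc[OF cd 1 cont rng] by blast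
      have "order_on {c..d} True G"
        unfolding order_on_def using strict_mono_onD[OF G(2)] by (metis less_asym linorder_neq_iff)
      then show ?thesis using G that by blast
    next
      case 2
      \<comment> \<open>The reflection \<open>1 - \<tau>\<close> reduces decreasing maps to
        increasing ones and preserves the unit interval.\<close>
      have m: "strict_mono_on {c<..<d} (\<lambda>x. 1 - \<tau> x)"
        using 2 by (auto simp: monotone_on_def)
      have r: "(\<lambda>x. 1 - \<tau> x) ` {c<..<d} \<subseteq> {0..1}" using rng by auto
      have ct: "continuous_on {c<..<d} (\<lambda>x. 1 - \<tau> x)" using cont by (intro continuous_intros)
      obtain G where G: "continuous_on {c..d} G" "strict_mono_on {c..d} G" "\<And>x. x \<in> {c<..<d} \<Longrightarrow> G x = 1 - \<tau> x"
        "G ` {c..d} \<subseteq> {0..1}" using strict_mono_on_extend_Icc[OF cd m ct r] by blast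
      have "order_on {c..d} False (\<lambda>x. 1 - G x)"
        unfolding order_on_def using strict_mono_onD[OF G(2)] by (smt (verit))
      moreover have "continuous_on {c..d} (\<lambda>x. 1 - G x)" using G(1) by (intro continuous_intros)
      moreover have "(\<lambda>x. 1 - G x) ` {c..d} \<subseteq> {0..1}" using G(4) by auto
      moreover have "1 - G x = \<tau> x" if "x \<in> {c<..<d}" for x using G(3)[OF that] by simp
      ultimately show ?thesis using that by blast
    qed
  qed
  have eq: "branch \<tau> a i x = G x" if x: "x \<in> {c..d}" for x
    unfolding branch_def c_def[symmetric] d_def[symmetric]
  proof (rule tendsto_Lim)
    \<comment> \<open>\<open>Lim\<close> has a determined value only at limit points, and the ends
      are limit points of the open interval too.\<close>
    have "x islimpt {c<..<d}"
    proof (cases "x < d")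
      case True
      then show ?thesis
        using x by (intro islimpt_subset[OF islimpt_greaterThanLessThan1[OF True]]) auto
    next
      case False
      then show ?thesis using x islimpt_greaterThanLessThan2[OF cd] by simp
    qed
    then show "\<not> trivial_limit (at x within {c<..<d})" by (simp add: trivial_limit_within)
    have "(G \<longlongrightarrow> G x) (at x within {c..d})" using G(1) x by (simp add: continuous_on_def)
    then have "(G \<longlongrightarrow> G x) (at x within {c<..<d})" by (rule tendsto_within_subset) auto
    moreover have "eventually (\<lambda>y. G y = \<tau> y) (at x within {c<..<d})"
      using G(2) by (auto simp: eventually_at_filter)
    ultimately show "(\<tau> \<longlongrightarrow> G x) (at x within {c<..<d})" by (rule Lim_transform_eventually)
  qed
  show "continuous_on {a i..a (Suc i)} (branch \<tau> a i)"
    using G(1) eq by (subst continuous_on_cong[OF refl, of _ _ G]) (auto simp: c_def d_def)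
  show "x \<in> {a i..a (Suc i)} \<Longrightarrow> branch \<tau> a i x \<in> {0..1}"
    using G(3) eq[of x] unfolding c_def d_def image_subset_iff by simp
  show "x \<in> {a i<..<a (Suc i)} \<Longrightarrow> branch \<tau> a i x = \<tau> x"
    using G(2) eq by (auto simp: c_def d_def)
  show "\<exists>inc. order_on {a i..a (Suc i)} inc (branch \<tau> a i)"
    using G(4) eq unfolding c_def d_def order_on_def by auto
qed

section \<open>Generalized orbits and the set of split points\<close>

lemma hat_image_mono: "A \<subseteq> B \<Longrightarrow> hat_image \<tau> n a A \<subseteq> hat_image \<tau> n a B"
  by (auto simp: hat_image_def)

lemma hat_vimage_mono: "A \<subseteq> B \<Longrightarrow> hat_vimage \<tau> n a A \<subseteq> hat_vimage \<tau> n a B"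
  by (auto simp: hat_vimage_def)

lemma hat_image_Un: "hat_image \<tau> n a (\<Union>k\<in>I. A k) = (\<Union>k\<in>I. hat_image \<tau> n a (A k))"
  by (auto simp: hat_image_def)

lemma hat_vimage_Un: "hat_vimage \<tau> n a (\<Union>k\<in>I. A k) = (\<Union>k\<in>I. hat_vimage \<tau> n a (A k))"
  by (auto simp: hat_vimage_def)

locale exact_interval_map =
  fixes \<tau> :: "real \<Rightarrow> real" and n :: nat and a :: "nat \<Rightarrow> real"
    and \<sigma> :: "real \<times> bool \<Rightarrow> real \<times> bool"
  assumes range: "\<tau> \<in> {0..1} \<rightarrow> {0..1}" and partition: "monotonic_partition \<tau> n a"
    and top_exact: "topologically_exact \<tau> n a"
    and map: "associated_map \<tau> n a \<sigma>"
begin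

abbreviation D :: "real set" where "D \<equiv> I1 \<tau> n a"
abbreviation hat :: "real set \<Rightarrow> real set" where "hat \<equiv> hat_image \<tau> n a"

lemma a_mono: "i \<le> j \<Longrightarrow> j \<le> n \<Longrightarrow> a i \<le> a j"
proof (induction j rule: dec_induct)
  case (step j)
  have "a j < a (Suc j)" using partition step by (auto simp: monotonic_partition_def)
  then show ?case using step by simp
qed simp

lemma a_bounds: "i \<le> n \<Longrightarrow> 0 \<le> a i \<and> a i \<le> 1"
  using a_mono[of 0 i] a_mono[of i n] partition by (auto simp: monotonic_partition_def)

lemma a_less: "i < n \<Longrightarrow> a i < a (Suc i)"
  using partition by (auto simp: monotonic_partition_def)

lemma monotonic_on_piece: "i < n \<Longrightarrow> monotonic_on_interval \<tau> (a i) (a (Suc i))"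
  using partition by (auto simp: monotonic_partition_def)

lemma range_on_piece: "i < n \<Longrightarrow> \<tau> ` {a i<..<a (Suc i)} \<subseteq> {0..1}"
proof -
  assume "i < n"
  then have "{a i<..<a (Suc i)} \<subseteq> {0..1}" using a_bounds[of i] a_bounds[of "Suc i"] by auto
  then show ?thesis using range by blast
qed

lemma branch_facts:
  assumes i: "i < n"
  shows "continuous_on {a i..a (Suc i)} (branch \<tau> a i)"
    and "x \<in> {a i..a (Suc i)} \<Longrightarrow> branch \<tau> a i x \<in> {0..1}"
    and "x \<in> {a i<..<a (Suc i)} \<Longrightarrow> branch \<tau> a i x = \<tau> x"
    and "\<exists>inc. order_on {a i..a (Suc i)} inc (branch \<tau> a i)"
  by (fact branch_properties[OF a_less[OF i] monotonic_on_piece[OF i] range_on_piece[OF i]])+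

lemma branch_inj: "i < n \<Longrightarrow> inj_on (branch \<tau> a i) {a i..a (Suc i)}"
proof (rule inj_onI)
  fix x y assume "i < n" and xy: "x \<in> {a i..a (Suc i)}" "y \<in> {a i..a (Suc i)}" "branch \<tau> a i x = branch \<tau> a i y"
  obtain inc where "order_on {a i..a (Suc i)} inc (branch \<tau> a i)" using branch_facts(4)[OF \<open>i < n\<close>] by blast
  then have "x \<noteq> y \<Longrightarrow> (branch \<tau> a i x < branch \<tau> a i y \<longleftrightarrow> (x < y) = inc) \<and>
      (branch \<tau> a i y < branch \<tau> a i x \<longleftrightarrow> (y < x) = inc)"
    using xy(1,2) unfolding order_on_def by metis
  then show "x = y" using xy(3) by (cases x y rule: linorder_cases) auto
qed

definition invariant :: "real set \<Rightarrow> bool" where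
  "invariant S \<longleftrightarrow> S \<subseteq> {0..1} \<and> hat S \<subseteq> S \<and> hat_vimage \<tau> n a S \<subseteq> S"

lemma hat_image_subset: "hat A \<subseteq> {0..1}"
  using branch_facts(2) by (force simp: hat_image_def)

lemma hat_vimage_subset: "hat_vimage \<tau> n a A \<subseteq> {0..1}"
proof
  fix x assume "x \<in> hat_vimage \<tau> n a A"
  then obtain i where "i < n" "a i \<le> x" "x \<le> a (Suc i)" by (auto simp: hat_vimage_def)
  then show "x \<in> {0..1}" using a_bounds[of i] a_bounds[of "Suc i"] by auto
qed

lemma invariant_unit: "invariant {0..1}"
  using hat_image_subset hat_vimage_subset by (simp add: invariant_def)

lemma generalized_orbit_eq: "generalized_orbit \<tau> n a x = \<Inter>{S. invariant S \<and> x \<in> S}"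
  unfolding generalized_orbit_def invariant_def by (rule arg_cong[where f=Inter]) auto

lemma invariant_orbit:
  assumes "x \<in> {0..1}" shows "invariant (generalized_orbit \<tau> n a x)"
proof -
  have *: "generalized_orbit \<tau> n a x \<subseteq> S" if "invariant S" "x \<in> S" for S
    using that by (auto simp: generalized_orbit_eq)
  have le: "hat (generalized_orbit \<tau> n a x) \<subseteq> S"
    "hat_vimage \<tau> n a (generalized_orbit \<tau> n a x) \<subseteq> S" if "invariant S" "x \<in> S" for S
    using hat_image_mono[OF *[OF that]] hat_vimage_mono[OF *[OF that]] that(1)
    unfolding invariant_def by blast+
  have Inter: "A \<subseteq> generalized_orbit \<tau> n a x" if "\<And>S. invariant S \<Longrightarrow> x \<in> S \<Longrightarrow> A \<subseteq> S" for A
    unfolding generalized_orbit_eq by (rule Inter_greatest) (use that in blast)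
  show ?thesis
    unfolding invariant_def using *[OF invariant_unit assms] Inter[OF le(1)] Inter[OF le(2)] by blast
qed

lemma orbit_self: "x \<in> generalized_orbit \<tau> n a x"
  by (auto simp: generalized_orbit_eq)

lemma invariant_D: "invariant D"
proof -
  have "\<And>i. i \<le> n \<Longrightarrow> invariant (generalized_orbit \<tau> n a (a i))"
    using a_bounds by (intro invariant_orbit) auto
  then show ?thesis
    unfolding invariant_def I1_def hat_image_Un hat_vimage_Un by blast
qed

lemma a_in_D: "i \<le> n \<Longrightarrow> a i \<in> D"
  using orbit_self by (auto simp: I1_def)

text \<open>Invariance in both directions means that branches neither create nor destroy split
  points.\<close>

lemma branch_D:
  assumes "i < n" "x \<in> {a i..a (Suc i)}"
  shows "branch \<tau> a i x \<in> D \<longleftrightarrow> x \<in> D"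
proof
  assume "branch \<tau> a i x \<in> D"
  then have "x \<in> hat_vimage \<tau> n a D" using assms by (auto simp: hat_vimage_def)
  then show "x \<in> D" using invariant_D by (auto simp: invariant_def)
next
  assume "x \<in> D"
  then have "branch \<tau> a i x \<in> hat D"
    unfolding hat_image_def using assms by (intro UN_I[of i] imageI) auto
  then show "branch \<tau> a i x \<in> D" using invariant_D by (auto simp: invariant_def)
qed

text \<open>The orbit is bounded from above by repeatedly adjoining images and preimages; finitely
  many injective branches keep each stage countable.\<close>

lemma countable_orbit:
  assumes "x \<in> {0..1}" shows "countable (generalized_orbit \<tau> n a x)"
proof -
  define F where "F S = S \<union> hat S \<union> hat_vimage \<tau> n a S" for S
  define S where "S = (\<Union>k. (F ^^ k) {x})"
  have cF: "countable (F A)" if "countable A" for A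
  proof -
    have "countable {x \<in> {a i..a (Suc i)}. branch \<tau> a i x \<in> A}" if i: "i < n" for i
    proof (rule countable_image_inj_on)
      show "countable (branch \<tau> a i ` {x \<in> {a i..a (Suc i)}. branch \<tau> a i x \<in> A})"
        by (rule countable_subset[OF _ \<open>countable A\<close>]) auto
      show "inj_on (branch \<tau> a i) {x \<in> {a i..a (Suc i)}. branch \<tau> a i x \<in> A}"
        by (rule inj_on_subset[OF branch_inj[OF i]]) auto
    qed
    then have "countable (hat_vimage \<tau> n a A)" unfolding hat_vimage_def by (intro countable_UN) auto
    moreover have "countable (hat A)"
      unfolding hat_image_def using that by (intro countable_UN countable_image) auto
    ultimately show ?thesis using that by (simp add: F_def)
  qed
  have "countable ((F ^^ k) {x})" for k by (induction k) (auto intro: cF)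
  then have "countable S" by (simp add: S_def)
  have FS: "hat ((F ^^ k) {x}) \<subseteq> (F ^^ Suc k) {x}"
      "hat_vimage \<tau> n a ((F ^^ k) {x}) \<subseteq> (F ^^ Suc k) {x}" for k by (auto simp: F_def)
  have "invariant S"
    unfolding invariant_def
  proof (intro conjI)
    have "(F ^^ k) {x} \<subseteq> {0..1}" for k
      using assms hat_image_subset hat_vimage_subset by (induction k) (auto simp: F_def)
    then show "S \<subseteq> {0..1}" unfolding S_def by blast
    show "hat S \<subseteq> S" "hat_vimage \<tau> n a S \<subseteq> S"
      unfolding S_def hat_image_Un hat_vimage_Un using FS by blast+
  qed
  moreover have "x \<in> S" unfolding S_def by (rule UN_I[of 0]) auto
  ultimately have "generalized_orbit \<tau> n a x \<subseteq> S" by (auto simp: generalized_orbit_eq)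
  then show ?thesis using \<open>countable S\<close> countable_subset by blast
qed

lemma countable_I1: "countable D"
  unfolding I1_def using a_bounds by (intro countable_UN countable_orbit) auto

lemma hat_image_full:
  assumes "0 \<le> x" "x < y" "y \<le> 1"
  shows "\<exists>k. (hat ^^ k) {x<..<y} = {0..1}"
proof -
  have "openin (top_of_set {0..1}) {x<..<y}"
    using assms by (intro openin_open[THEN iffD2] exI[of _ "{x<..<y}"]) auto
  moreover have "{x<..<y} \<noteq> {}" using assms by simp
  ultimately show ?thesis using top_exact unfolding topologically_exact_def by blast
qed

text \<open>By exactness some iterate of the interval contains the point 0 of \<open>D\<close>, and
  membership in \<open>D\<close> is pulled back along the branches.\<close>

lemma dense_I1:
  assumes "0 \<le> x" "x < y" "y \<le> 1"
  shows "\<exists>e\<in>D. x < e \<and> e < y"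
proof -
  define U where "U = {x<..<y}"
  obtain k where k: "(hat ^^ k) U = {0..1}"
    using hat_image_full[OF assms] by (auto simp: U_def)
  have pull: "U \<inter> D \<noteq> {}" if "(hat ^^ k) U \<inter> D \<noteq> {}" for k
    using that
  proof (induction k)
    case (Suc k)
    from Suc.prems obtain i z where "i < n" "z \<in> (hat ^^ k) U" "z \<in> {a i..a (Suc i)}"
        "branch \<tau> a i z \<in> D"
      unfolding funpow.simps o_apply hat_image_def[of _ _ _ "(hat ^^ k) U"] by blast
    then have "z \<in> (hat ^^ k) U \<inter> D" using branch_D by auto
    then show ?case using Suc.IH by blast
  qed simp
  have "0 \<in> D" using a_in_D[of 0] partition by (simp add: monotonic_partition_def)
  then have "0 \<in> (hat ^^ k) U \<inter> D" unfolding k by simp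
  then have "U \<inter> D \<noteq> {}" by (intro pull) blast
  then show ?thesis by (auto simp: U_def)
qed

sublocale split_interval D
proof
  show "D \<subseteq> {0..1}" using invariant_D by (simp add: invariant_def)
  show "0 \<in> D" "1 \<in> D" using a_in_D[of 0] a_in_D[of n] partition by (auto simp: monotonic_partition_def)
qed (use countable_I1 dense_I1 in auto)

lemma \<sigma>_nonsplit:
  assumes "u \<in> {0..1}" "u \<notin> D"
  shows "fst (\<sigma> (u, False)) = \<tau> u"
  using map assms by (auto simp: associated_map_def X_top_def I0_def False_X)

lemma \<sigma>_continuous: "continuous_map TX TX \<sigma>"
  using map by (simp add: associated_map_def X_top_def)

lemma split_branches:
  assumes i: "i < n"
  shows "\<exists>inc. split_branch D \<sigma> (branch \<tau> a i) (a i) (a (Suc i)) inc"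
proof -
  obtain inc where inc: "order_on {a i..a (Suc i)} inc (branch \<tau> a i)" using branch_facts(4)[OF i] by blast
  have "split_branch D \<sigma> (branch \<tau> a i) (a i) (a (Suc i)) inc"
  proof
    show "fst (\<sigma> (u, False)) = branch \<tau> a i u" if "u \<notin> D" "a i < u" "u < a (Suc i)" for u
    proof -
      have "u \<in> {0..1}" using that a_bounds[of i] a_bounds[of "Suc i"] i by auto
      then show ?thesis using \<sigma>_nonsplit that branch_facts(3)[OF i, of u] by auto
    qed
    show "branch \<tau> a i x < branch \<tau> a i y \<longleftrightarrow> (x < y) = inc"
      if "x \<in> {a i..a (Suc i)}" "y \<in> {a i..a (Suc i)}" "x \<noteq> y" for x y using inc that unfolding order_on_def by blast
  qed (use i a_in_D a_less branch_facts branch_D \<sigma>_continuous in auto)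
  then show ?thesis by blast
qed

section \<open>The exact cell system of an interval map\<close>

definition branch_cells :: "(real \<times> bool) set set" where
  "branch_cells = (\<lambda>i. cell D (a i) (a (Suc i))) ` {..<n}"

lemma branch_cellsE:
  assumes "B \<in> branch_cells"
  obtains i inc where "i < n" "B = cell D (a i) (a (Suc i))"
    "split_branch D \<sigma> (branch \<tau> a i) (a i) (a (Suc i)) inc"
proof -
  obtain i where "i < n" "B = cell D (a i) (a (Suc i))" using assms by (auto simp: branch_cells_def)
  then show thesis using split_branches that by blast
qed

text \<open>\<open>p\<close> is above the cut at \<open>a 0 = 0\<close> and below the cut at
  \<open>a n = 1\<close>, so the side changes at some index.\<close>

lemma in_some_branch_cell:
  assumes "p \<in> X" shows "\<exists>i<n. p \<in> cell D (a i) (a (Suc i))"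
proof -
  have "\<exists>i<k. side (a i) p \<and> \<not> side (a (Suc i)) p" if "\<not> side (a k) p" for k
    using that
  proof (induction k)
    case 0
    then show ?case using side_zero[OF assms] partition by (simp add: monotonic_partition_def)
  next
    case (Suc k)
    then show ?case by (cases "side (a k) p") (auto intro: less_SucI)
  qed
  moreover have "\<not> side (a n) p" using not_side_one[OF assms] partition by (simp add: monotonic_partition_def)
  ultimately show ?thesis using assms unfolding cell_def by blast
qed

sublocale sys: cell_system X \<sigma> branch_cells cells
proof
  show "finite branch_cells" by (simp add: branch_cells_def)
  show "\<Union>branch_cells = X"
    using in_some_branch_cell by (auto simp: branch_cells_def cell_def)
  show "disjoint branch_cells"
  proof (rule disjointI)
    fix B B' assume BB: "B \<in> branch_cells" "B' \<in> branch_cells" "B \<noteq> B'"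
    have *: "cell D (a i) (a (Suc i)) \<inter> cell D (a j) (a (Suc j)) = {}" if "i < j" "j < n" for i j
      using that a_mono[of "Suc i" j] by (auto simp: cell_def dest: side_mono[of "a j"])
    show "B \<inter> B' = {}"
      using BB * by (auto simp: branch_cells_def) (metis Int_commute disjoint_iff linorder_neqE_nat)+
  qed
  show "inj_on \<sigma> B" if "B \<in> branch_cells" for B
    using that by (elim branch_cellsE) (simp add: split_branch.inj_on_branch)
  show "\<sigma> x \<in> X" if "x \<in> X" for x
    using \<sigma>_continuous that by (auto simp: continuous_map_def)
  show "X \<in> cells" using cellsI[OF zero_D one_D] by (simp add: cell_zero_one)
  show "K \<subseteq> X" if "K \<in> cells" for K using that by (auto simp: cells_def cell_def)
  show "branch_cells \<subseteq> cells" using a_in_D by (auto simp: branch_cells_def intro!: cellsI)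
  show "\<sigma> ` K \<in> cells" if "B \<in> branch_cells" "K \<in> cells" "K \<subseteq> B" for B K
    using that(1) by (rule branch_cellsE) (metis split_branch.branch_image that(2,3))
  show "B \<inter> \<sigma> -` K \<in> cells" if "B \<in> branch_cells" "K \<in> cells" for B K
    using that(1) by (rule branch_cellsE) (metis split_branch.branch_vimage that(2))
qed (use cells_Int cell_compl cell_partial in auto)

lemma countable_cells: "countable cells"
proof -
  have "cells = (\<lambda>(c, d). cell D c d) ` (D \<times> D)" by (auto simp: cells_def)
  then show ?thesis using countable_I1 by simp
qed

sublocale sys: cell_space X \<sigma> branch_cells cells TX
  by unfold_locales (use openin_iff compact_split countable_cells in auto)

text \<open>If the target is unsplit, so is every earlier point of the chain. Such points avoid the
  partition, so \<open>\<sigma>\<close> follows the branches there.\<close>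

lemma \<sigma>_reaches_nonsplit:
  assumes "c \<in> D" "d \<in> D" "x \<in> (hat ^^ k) {c<..<d}" "x \<notin> D"
  shows "\<exists>p\<in>cell D c d. (\<sigma> ^^ k) p = (x, False)"
  using assms(3,4)
proof (induction k arbitrary: x)
  case 0
  then show ?case using nonsplit_in_cell[OF assms(1,2), of x] by auto
next
  case (Suc k)
  then obtain i y where i: "i < n" and y: "y \<in> (hat ^^ k) {c<..<d}" "y \<in> {a i..a (Suc i)}"
      "x = branch \<tau> a i y"
    by (auto simp: hat_image_def[of _ _ _ "(hat ^^ k) {c<..<d}"])
  have yD: "y \<notin> D" using branch_D[OF i y(2)] y(3) Suc.prems(2) by simp
  then obtain p where p: "p \<in> cell D c d" "(\<sigma> ^^ k) p = (y, False)" using Suc.IH[OF y(1)] by blast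
  have ne: "y \<noteq> a i" "y \<noteq> a (Suc i)" using yD a_in_D[of i] a_in_D[of "Suc i"] i by auto
  have y01: "y \<in> {0..1}" using y(2) a_bounds[of i] a_bounds[of "Suc i"] i by auto
  have "fst (\<sigma> (y, False)) = x"
    using \<sigma>_nonsplit[OF y01 yD] branch_facts(3)[OF i, of y] y(2,3) ne by auto
  moreover have "\<sigma> (y, False) \<in> X" using sys.maps False_X y01 by auto
  ultimately have "\<sigma> (y, False) = (x, False)"
    using Suc.prems(2) by (cases "\<sigma> (y, False)") (auto simp: split_points_def)
  then show ?case using p by (intro bexI[of _ p]) auto
qed

sublocale sys: exact_cell_system X \<sigma> branch_cells cells
proof
  fix K assume K: "K \<in> cells" "K \<noteq> {}"
  obtain c d where cd: "c \<in> D" "d \<in> D" "K = cell D c d" using K(1) by (rule cellsE)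
  then have "c < d" using K(2) cell_nonempty_iff by blast
  obtain k where k: "(hat ^^ k) {c<..<d} = {0..1}"
    using hat_image_full[of c d] D_bounds[OF cd(1)] D_bounds[OF cd(2)] \<open>c < d\<close> by auto
  define f where "f = (sys.L ^^ k) (indicator K)"
  have "sys.step f" unfolding f_def by (intro sys.step_Ln sys.step_indicator K)
  \<comment> \<open>The set where the bound fails is open; if it were nonempty, it would contain an
    unsplit point, and that point is reached from \<open>K\<close>.\<close>
  then have op: "openin TX {p \<in> X. f p \<in> {..<1}}" by (rule sys.step_open)
  have "{p \<in> X. f p \<in> {..<1}} = {}"
  proof (rule ccontr)
    assume "{p \<in> X. f p \<in> {..<1}} \<noteq> {}"
    then obtain u where u: "u \<notin> D" "0 < u" "u < 1" "(u, False) \<in> {p \<in> X. f p \<in> {..<1}}"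
      using open_contains_nonsplit[OF op] by blast
    then have "u \<in> (hat ^^ k) {c<..<d}" using k by simp
    then obtain p where p: "p \<in> K" "(\<sigma> ^^ k) p = (u, False)"
      using \<sigma>_reaches_nonsplit[OF cd(1,2)] u(1) cd(3) by blast
    have "indicator K p \<le> f ((\<sigma> ^^ k) p)"
      unfolding f_def using sys.cell_subset[OF K(1)] p by (intro sys.Ln_point_le) auto
    then show False using p u(4) by simp
  qed
  then show "\<exists>n. \<forall>x\<in>X. 1 \<le> (sys.L ^^ n) (indicator K) x"
    unfolding f_def by (intro exI[of _ k]) force
next
  obtain e where e: "e \<in> D" "0 < e" "e < 1" using dense_D[of 0 1] by auto
  have "cell D 0 e \<noteq> {}" "cell D e 1 \<noteq> {}" using cell_nonempty_iff e zero_D one_D by auto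
  moreover have "cell D 0 e \<inter> cell D e 1 = {}" by (auto simp: cell_def)
  ultimately show "\<exists>K\<in>cells. \<exists>K'\<in>cells. K \<noteq> {} \<and> K' \<noteq> {} \<and> K \<inter> K' = {}"
    using cellsI[OF zero_D e(1)] cellsI[OF e(1) one_D] by blast
qed

end

section \<open>The dimension group and its state\<close>

lemma of_int_indicator: "of_int (indicator A x) = indicator A x"
  by (simp add: indicator_def)

locale conformal_space = cell_space X \<sigma> P \<K> T + conformal_system X \<sigma> P \<K> s m
  for X :: "'a set" and \<sigma> P \<K> T s m
begin

abbreviation real_fun :: "('a \<Rightarrow> int) \<Rightarrow> 'a \<Rightarrow> real" where "real_fun f \<equiv> \<lambda>x. real_of_int (f x)"
abbreviation C :: "('a \<Rightarrow> int) set" where "C \<equiv> C_int T"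
abbreviation cls :: "('a \<Rightarrow> int) \<Rightarrow> ('a \<Rightarrow> int) set" where "cls \<equiv> DG_class T \<sigma>"
abbreviation G :: "('a \<Rightarrow> int) set unital_ordered_group" where "G \<equiv> DG T \<sigma>"

text \<open>This passes between the integer-valued functions that define the group and the real
  analysis of \<open>L\<close>.\<close>

lemma C_iff_step: "f \<in> C \<longleftrightarrow> step (real_fun f)"
proof
  assume f: "f \<in> C"
  show "step (real_fun f)"
  proof (rule step_of_locally_constant)
    fix k :: real
    have "openin T {p \<in> topspace T. f p \<in> {i. real_of_int i = k}}"
      using f by (intro openin_continuous_map_preimage[of T "discrete_topology UNIV"]) (auto simp: C_int_def)
    then show "openin T {p \<in> X. real_of_int (f p) = k}" by (simp add: topspace_T)
  qed (use f in \<open>auto simp: C_int_def topspace_T\<close>)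
next
  assume f: "step (real_fun f)"
  have "openin T {p \<in> X. f p \<in> U}" for U
    using step_open[OF f, of "real_of_int ` U"] by (simp add: inj_image_mem_iff inj_def)
  moreover have "f p = 0" if "p \<notin> X" for p using step_outside[OF f that] by simp
  ultimately show "f \<in> C" by (auto simp: C_int_def continuous_map_def topspace_T)
qed

lemma C_add: "f \<in> C \<Longrightarrow> g \<in> C \<Longrightarrow> (\<lambda>x. f x + g x) \<in> C"
  and C_diff: "f \<in> C \<Longrightarrow> g \<in> C \<Longrightarrow> (\<lambda>x. f x - g x) \<in> C"
  and C_cmult: "f \<in> C \<Longrightarrow> (\<lambda>x. c * f x) \<in> C"
  using step_add[of "real_fun f" "real_fun g"] step_diff[of "real_fun f" "real_fun g"]
    step_cmult[of "real_fun f" "real_of_int c"] by (simp_all add: C_iff_step)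

lemma C_uminus: "f \<in> C \<Longrightarrow> (\<lambda>x. - f x) \<in> C"
  using C_cmult[of f "-1"] by simp

lemma C_one: "indicator X \<in> C"
  using step_one by (simp add: C_iff_step of_int_indicator)

lemma C_zero: "(\<lambda>x. 0) \<in> C"
  using C_cmult[OF C_one, of 0] by simp

lemma C_bounded: "f \<in> C \<Longrightarrow> bounded_on X (real_fun f)"
  by (rule bounded_step) (simp add: C_iff_step)

lemma transfer_L: "real_fun (transfer T \<sigma> f) = L (real_fun f)"
  by (auto simp: transfer_def L_def topspace_T)

lemma transfer_Ln: "real_fun ((transfer T \<sigma> ^^ k) f) = (L ^^ k) (real_fun f)"
  by (induction k) (simp_all add: transfer_L)

lemma transfer_eq_iff:
  "(transfer T \<sigma> ^^ k) f = (transfer T \<sigma> ^^ k) g \<longleftrightarrow> (L ^^ k) (real_fun f) = (L ^^ k) (real_fun g)"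
  by (simp only: transfer_Ln[symmetric] fun_eq_iff of_int_eq_iff)

lemma transfer_nonneg_iff:
  "(\<forall>x. 0 \<le> (transfer T \<sigma> ^^ k) f x) \<longleftrightarrow> (\<forall>x. 0 \<le> (L ^^ k) (real_fun f) x)"
  by (simp only: transfer_Ln[symmetric] of_int_0_le_iff)

lemma DG_rel_iff:
  "(f, g) \<in> DG_rel T \<sigma> \<longleftrightarrow> f \<in> C \<and> g \<in> C \<and> (\<exists>k. (L ^^ k) (real_fun f) = (L ^^ k) (real_fun g))"
  by (auto simp: DG_rel_def transfer_eq_iff)

lemma Ln_eq_mono:
  assumes "(L ^^ k) f = (L ^^ k) g" "k \<le> j" shows "(L ^^ j) f = (L ^^ j) g"
proof -
  have "(L ^^ j) h = (L ^^ (j - k)) ((L ^^ k) h)" for h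
    using assms(2) funpow_add[of "j - k" k L] by simp
  then show ?thesis using assms(1) by simp
qed

lemma equiv_DG: "equiv C (DG_rel T \<sigma>)"
proof (rule equivI)
  show "refl_on C (DG_rel T \<sigma>)" by (auto simp: refl_on_def DG_rel_iff)
  show "sym (DG_rel T \<sigma>)" by (rule symI) (auto simp: DG_rel_iff, metis)
  show "trans (DG_rel T \<sigma>)"
  proof (rule transI)
    fix f g h assume fg: "(f, g) \<in> DG_rel T \<sigma>" "(g, h) \<in> DG_rel T \<sigma>"
    then obtain j k where jk: "(L ^^ j) (real_fun f) = (L ^^ j) (real_fun g)"
        "(L ^^ k) (real_fun g) = (L ^^ k) (real_fun h)" by (auto simp: DG_rel_iff)
    have "(L ^^ max j k) (real_fun f) = (L ^^ max j k) (real_fun h)"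
      using Ln_eq_mono[OF jk(1), of "max j k"] Ln_eq_mono[OF jk(2), of "max j k"] by simp
    then show "(f, h) \<in> DG_rel T \<sigma>" using fg unfolding DG_rel_iff by blast
  qed
qed (auto simp: DG_rel_iff)

lemma cls_eq_iff:
  "f \<in> C \<Longrightarrow> g \<in> C \<Longrightarrow> cls f = cls g \<longleftrightarrow> (\<exists>k. (L ^^ k) (real_fun f) = (L ^^ k) (real_fun g))"
  unfolding DG_class_def by (simp add: eq_equiv_class_iff[OF equiv_DG] DG_rel_iff)

lemma mem_cls_iff: "f \<in> C \<Longrightarrow> h \<in> cls f \<longleftrightarrow> h \<in> C \<and> cls h = cls f"
proof -
  assume f: "f \<in> C"
  have "h \<in> cls f \<longleftrightarrow> (f, h) \<in> DG_rel T \<sigma>" by (simp add: DG_class_def)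
  then show ?thesis using f cls_eq_iff[of f h] by (metis DG_rel_iff)
qed

lemma carrier_DG: "carrier G = cls ` C"
  by (auto simp: DG_def quotient_def DG_class_def)

lemma one_DG: "\<one>\<^bsub>G\<^esub> = cls (\<lambda>x. 0)"
  by (simp add: DG_def)

lemma order_unit_DG: "order_unit G = cls (indicator X)"
  by (simp add: DG_def topspace_T)

lemma cls_add_cong:
  assumes "f \<in> C" "g \<in> C" "f' \<in> C" "g' \<in> C" "cls f' = cls f" "cls g' = cls g"
  shows "cls (\<lambda>x. f' x + g' x) = cls (\<lambda>x. f x + g x)"
proof -
  obtain j k where jk: "(L ^^ j) (real_fun f') = (L ^^ j) (real_fun f)"
      "(L ^^ k) (real_fun g') = (L ^^ k) (real_fun g)" using assms by (auto simp: cls_eq_iff)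
  have "(L ^^ max j k) (\<lambda>x. real_fun f' x + real_fun g' x) = (L ^^ max j k) (\<lambda>x. real_fun f x + real_fun g x)"
    using Ln_eq_mono[OF jk(1), of "max j k"] Ln_eq_mono[OF jk(2), of "max j k"] by (simp add: Ln_add)
  then show ?thesis using assms(1-4) by (subst cls_eq_iff) (auto intro!: C_add exI[of _ "max j k"])
qed

text \<open>The class of the sum is the same for all representatives, so the union in the definition
  has only one distinct member.\<close>

lemma mult_DG:
  assumes "f \<in> C" "g \<in> C"
  shows "cls f \<otimes>\<^bsub>G\<^esub> cls g = cls (\<lambda>x. f x + g x)"
proof -
  have "cls f \<otimes>\<^bsub>G\<^esub> cls g = (\<Union>f'\<in>cls f. \<Union>g'\<in>cls g. cls (\<lambda>x. f' x + g' x))" by (simp add: DG_def)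
  also have "\<dots> = (\<Union>f'\<in>cls f. \<Union>g'\<in>cls g. cls (\<lambda>x. f x + g x))"
    by (intro SUP_cong refl cls_add_cong) (simp_all only: mem_cls_iff[OF assms(1)] mem_cls_iff[OF assms(2)] assms)
  also have "\<dots> = cls (\<lambda>x. f x + g x)"
  proof -
    have "f \<in> cls f" "g \<in> cls g" using assms by (simp_all add: mem_cls_iff)
    then show ?thesis by blast
  qed
  finally show ?thesis .
qed

lemma group_DG: "group G"
proof (rule groupI)
  show "x \<otimes>\<^bsub>G\<^esub> y \<in> carrier G" if "x \<in> carrier G" "y \<in> carrier G" for x y
    using that by (auto simp: carrier_DG mult_DG intro!: C_add)
  show "\<one>\<^bsub>G\<^esub> \<in> carrier G" by (auto simp: carrier_DG one_DG C_zero)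
  show "x \<otimes>\<^bsub>G\<^esub> y \<otimes>\<^bsub>G\<^esub> z = x \<otimes>\<^bsub>G\<^esub> (y \<otimes>\<^bsub>G\<^esub> z)" if "x \<in> carrier G" "y \<in> carrier G" "z \<in> carrier G" for x y z
    using that by (auto simp: carrier_DG mult_DG C_add add.assoc)
  show "\<one>\<^bsub>G\<^esub> \<otimes>\<^bsub>G\<^esub> x = x" if "x \<in> carrier G" for x
    using that by (auto simp: carrier_DG one_DG mult_DG C_zero)
  show "\<exists>y\<in>carrier G. y \<otimes>\<^bsub>G\<^esub> x = \<one>\<^bsub>G\<^esub>" if x: "x \<in> carrier G" for x
  proof -
    obtain f where f: "f \<in> C" "x = cls f" using x by (auto simp: carrier_DG)
    then show ?thesis
      by (intro bexI[of _ "cls (\<lambda>x. - f x)"]) (auto simp: carrier_DG one_DG mult_DG C_uminus)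
  qed
qed

lemma inv_DG: "f \<in> C \<Longrightarrow> inv\<^bsub>G\<^esub> (cls f) = cls (\<lambda>x. - f x)"
  by (rule group.inv_equality[OF group_DG]) (auto simp: carrier_DG one_DG mult_DG C_uminus)

text \<open>Equality after \<open>k\<close> transfers gives equality of \<open>s ^ k * m\<close>,
  and \<open>s ^ k\<close> cancels.\<close>

lemma m_cls_cong:
  assumes "f \<in> C" "g \<in> C" "cls f = cls g" shows "m (real_fun f) = m (real_fun g)"
proof -
  obtain k where "(L ^^ k) (real_fun f) = (L ^^ k) (real_fun g)" using assms by (auto simp: cls_eq_iff)
  then have "s ^ k * m (real_fun f) = s ^ k * m (real_fun g)"
    using assms by (simp flip: m_Ln add: C_bounded)
  then show ?thesis using s_pos by simp
qed

text \<open>A nonnegative iterate is either zero, giving the neutral class, or has positive mass.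
  Conversely, positive mass makes some iterate nonnegative, by
  \<open>Ln_nonneg_of_m_pos\<close>.\<close>

lemma pos_cone_iff:
  assumes h: "h \<in> C"
  shows "cls h \<in> pos_cone G \<longleftrightarrow> 0 < m (real_fun h) \<or> cls h = \<one>\<^bsub>G\<^esub>"
proof
  assume "cls h \<in> pos_cone G"
  then obtain f k where f: "cls h = cls f" "f \<in> C" "\<forall>x. 0 \<le> (L ^^ k) (real_fun f) x"
    by (auto simp: DG_def transfer_nonneg_iff)
  show "0 < m (real_fun h) \<or> cls h = \<one>\<^bsub>G\<^esub>"
  proof (cases "\<exists>x. 0 < (L ^^ k) (real_fun f) x")
    case True
    have "step ((L ^^ k) (real_fun f))" using f(2) by (intro step_Ln) (simp add: C_iff_step)
    then have "0 < m ((L ^^ k) (real_fun f))" using True f(3) m_step_pos by blast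
    then have "0 < s ^ k * m (real_fun f)" using f(2) by (simp add: m_Ln C_bounded)
    then have "0 < m (real_fun f)" using s_pos by (simp add: zero_less_mult_iff)
    then show ?thesis using m_cls_cong[OF h f(2,1)] by simp
  next
    case False
    then have "(L ^^ k) (real_fun f) = (\<lambda>x. 0)" using f(3) by (intro ext) (metis less_eq_real_def)
    then have "(L ^^ k) (real_fun f) = (L ^^ k) (real_fun (\<lambda>x. 0))" by (simp add: Ln_zero)
    then have "cls f = cls (\<lambda>x. 0)" using f(2) C_zero cls_eq_iff by blast
    then show ?thesis using f(1) by (simp add: one_DG)
  qed
next
  assume "0 < m (real_fun h) \<or> cls h = \<one>\<^bsub>G\<^esub>"
  then show "cls h \<in> pos_cone G"
  proof
    assume "0 < m (real_fun h)"
    moreover have st: "step (real_fun h)" using h by (simp add: C_iff_step)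
    ultimately obtain k where k: "\<forall>x\<in>X. 0 \<le> (L ^^ k) (real_fun h) x" using Ln_nonneg_of_m_pos by blast
    have "0 \<le> (L ^^ k) (real_fun h) x" for x
      using k step_outside[OF step_Ln[OF st]] by (cases "x \<in> X") auto
    then show ?thesis using h by (auto simp: DG_def transfer_nonneg_iff)
  next
    assume "cls h = \<one>\<^bsub>G\<^esub>"
    then show ?thesis
      unfolding one_DG using C_zero by (auto simp: DG_def transfer_nonneg_iff Ln_zero intro!: exI[of _ "\<lambda>x. 0"])
  qed
qed

lemma group_le_iff:
  assumes "f \<in> C" "g \<in> C"
  shows "group_le G (cls f) (cls g) \<longleftrightarrow> m (real_fun f) < m (real_fun g) \<or> cls f = cls g"
proof -
  have "(L ^^ k) (real_fun (\<lambda>x. g x - f x)) = (L ^^ k) (real_fun (\<lambda>x. 0)) \<longleftrightarrow>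
      (L ^^ k) (real_fun f) = (L ^^ k) (real_fun g)" for k
    by (auto simp: Ln_diff Ln_zero fun_eq_iff)
  then have "cls (\<lambda>x. g x - f x) = \<one>\<^bsub>G\<^esub> \<longleftrightarrow> cls f = cls g"
    unfolding one_DG cls_eq_iff[OF C_diff[OF assms(2,1)] C_zero] cls_eq_iff[OF assms] by simp
  moreover have "m (real_fun (\<lambda>x. g x - f x)) = m (real_fun g) - m (real_fun f)"
    using assms by (simp add: m_diff C_bounded)
  moreover have "group_le G (cls f) (cls g) \<longleftrightarrow> cls (\<lambda>x. g x - f x) \<in> pos_cone G"
    using assms by (simp add: group_le_def inv_DG mult_DG C_uminus)
  ultimately show ?thesis using pos_cone_iff[OF C_diff[OF assms(2,1)]] by simp
qed

text \<open>A nontrivial ideal contains a class of positive mass; by the Archimedean property its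
  multiples dominate every class of positive mass, and such classes generate the group by
  differences.\<close>

lemma simple_DG: "simple_ordered_group G"
  unfolding simple_ordered_group_def
proof (intro allI impI)
  fix J assume J: "order_ideal G J"
  then have sub: "subgroup J G"
    and diff: "\<And>x. x \<in> J \<Longrightarrow> \<exists>y\<in>J \<inter> pos_cone G. \<exists>z\<in>J \<inter> pos_cone G. x = y \<otimes>\<^bsub>G\<^esub> inv\<^bsub>G\<^esub> z"
    and conv: "\<And>x y. x \<in> carrier G \<Longrightarrow> y \<in> J \<Longrightarrow> group_le G \<one>\<^bsub>G\<^esub> x \<Longrightarrow> group_le G x y \<Longrightarrow> x \<in> J"
    unfolding order_ideal_def by blast+
  have oneJ: "cls (\<lambda>x. 0) \<in> J" using subgroup.one_closed[OF sub] by (simp add: one_DG)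
  show "J = {\<one>\<^bsub>G\<^esub>} \<or> J = carrier G"
  proof (cases "J = {\<one>\<^bsub>G\<^esub>}")
    case False
    then obtain x where x: "x \<in> J" "x \<noteq> \<one>\<^bsub>G\<^esub>" using subgroup.one_closed[OF sub] by blast
    obtain y z where yz: "y \<in> J" "y \<in> pos_cone G" "z \<in> J" "z \<in> pos_cone G" "x = y \<otimes>\<^bsub>G\<^esub> inv\<^bsub>G\<^esub> z"
      using diff[OF x(1)] by blast
    have "y \<noteq> \<one>\<^bsub>G\<^esub> \<or> z \<noteq> \<one>\<^bsub>G\<^esub>"
      using x(2) yz(5) monoid.inv_one[OF group.is_monoid[OF group_DG]]
        monoid.r_one[OF group.is_monoid[OF group_DG] monoid.one_closed[OF group.is_monoid[OF group_DG]]]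
      by auto
    then obtain v where v: "v \<in> J" "v \<in> pos_cone G" "v \<noteq> \<one>\<^bsub>G\<^esub>" using yz by blast
    then obtain g where g: "g \<in> C" "v = cls g" using subgroup.subset[OF sub] by (auto simp: carrier_DG)
    then have mg: "0 < m (real_fun g)" using v pos_cone_iff by blast
    have multiples: "cls (\<lambda>x. int k * g x) \<in> J" for k
    proof (induction k)
      case (Suc k)
      have "cls (\<lambda>x. int (Suc k) * g x) = cls g \<otimes>\<^bsub>G\<^esub> cls (\<lambda>x. int k * g x)"
        using g(1) by (simp add: mult_DG C_cmult distrib_right)
      then show ?case using subgroup.m_closed[OF sub _ Suc] v(1) g(2) by simp
    qed (use oneJ in simp)
    have pos: "cls f \<in> J" if f: "f \<in> C" "0 < m (real_fun f)" for f
    proof -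
      obtain k where k: "m (real_fun f) < real k * m (real_fun g)" using reals_Archimedean3[OF mg] by blast
      have "m (real_fun (\<lambda>x. int k * g x)) = real k * m (real_fun g)"
        using g(1) by (simp add: m_cmult C_bounded)
      then have "group_le G (cls f) (cls (\<lambda>x. int k * g x))"
        using k f(1) g(1) by (simp add: group_le_iff C_cmult)
      moreover have "group_le G \<one>\<^bsub>G\<^esub> (cls f)"
        using f by (simp add: one_DG group_le_iff C_zero m_zero)
      ultimately show ?thesis using conv[of "cls f"] multiples f(1) by (auto simp: carrier_DG)
    qed
    have "cls f \<in> J" if f: "f \<in> C" for f
    proof -
      obtain k where k: "- m (real_fun f) < real k" using reals_Archimedean2 by blast
      \<comment> \<open>A multiple of the order unit large enough that \<open>f + h\<close> has
        positive mass.\<close>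
      define h where "h = (\<lambda>x. int (Suc k) * indicator X x)"
      have hC: "h \<in> C" unfolding h_def by (intro C_cmult C_one)
      have rh: "real_fun h = (\<lambda>x. real (Suc k) * one x)" by (simp add: h_def of_int_indicator)
      have mh: "m (real_fun h) = real (Suc k)" by (simp only: rh m_cmult[OF bounded_on_indicator] m_one mult_1_right)
      have "m (real_fun (\<lambda>x. f x + h x)) = m (real_fun f) + real (Suc k)"
        using mh f hC by (simp add: m_add C_bounded)
      then have 1: "cls (\<lambda>x. f x + h x) \<in> J" using k f hC by (intro pos C_add) auto
      have 2: "cls h \<in> J" using mh hC by (intro pos) auto
      have "cls f = cls (\<lambda>x. f x + h x) \<otimes>\<^bsub>G\<^esub> inv\<^bsub>G\<^esub> (cls h)"
        using f hC by (simp add: inv_DG mult_DG C_add C_uminus)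
      then show ?thesis using 1 2 subgroup.m_closed[OF sub] subgroup.m_inv_closed[OF sub] by metis
    qed
    then have "carrier G \<subseteq> J" by (auto simp: carrier_DG)
    then show ?thesis using subgroup.subset[OF sub] by blast
  qed simp
qed

lemma state_exists: "\<exists>\<omega>. state G \<omega>"
proof -
  define \<omega> where "\<omega> = restrict (\<lambda>A. m (real_fun (SOME f. f \<in> C \<and> A = cls f))) (carrier G)"
  have \<omega>: "\<omega> (cls f) = m (real_fun f)" if f: "f \<in> C" for f
  proof -
    define g where "g = (SOME g. g \<in> C \<and> cls f = cls g)"
    have "g \<in> C \<and> cls f = cls g" unfolding g_def by (rule someI[of _ f]) (simp add: f)
    then have "m (real_fun g) = m (real_fun f)" using m_cls_cong[OF f, of g] by simp
    moreover have "\<omega> (cls f) = m (real_fun g)" using f by (simp add: \<omega>_def carrier_DG g_def)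
    ultimately show ?thesis by simp
  qed
  have "state G \<omega>"
    unfolding state_def
  proof (intro conjI ballI)
    show "\<omega> \<in> extensional (carrier G)" by (simp add: \<omega>_def)
    show "\<omega> \<in> hom G real_add_group"
      using \<omega> by (auto simp: hom_def carrier_DG mult_DG real_add_group_def C_add m_add C_bounded)
    show "0 \<le> \<omega> x" if x: "x \<in> pos_cone G" for x
    proof -
      obtain f where f: "x = cls f" "f \<in> C" using x by (auto simp: DG_def)
      then have "0 < m (real_fun f) \<or> cls f = cls (\<lambda>x. 0)" using x pos_cone_iff by (simp add: one_DG)
      moreover have "m (real_fun f) = 0" if "cls f = cls (\<lambda>x. 0)"
        using m_cls_cong[OF f(2) C_zero that] by (simp add: m_zero)
      ultimately show ?thesis using \<omega>[OF f(2)] f(1) by fastforce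
    qed
    show "\<omega> (order_unit G) = 1"
      using \<omega>[OF C_one] by (simp add: order_unit_DG of_int_indicator m_one)
  qed
  then show ?thesis by blast
qed

text \<open>If a rational \<open>i / k\<close> lay strictly between the state of \<open>g\<close>
  and its mass, then \<open>k * g - i\<close> would have positive mass, hence be in the cone, but a
  negative state. Applying the inequality to \<open>- f\<close> as well gives equality.\<close>

lemma state_cls:
  assumes \<omega>: "state G \<omega>" and f: "f \<in> C"
  shows "\<omega> (cls f) = m (real_fun f)"
proof -
  have add: "\<omega> (cls (\<lambda>x. g x + h x)) = \<omega> (cls g) + \<omega> (cls h)" if "g \<in> C" "h \<in> C" for g h
  proof -
    have "\<omega> (cls g \<otimes>\<^bsub>G\<^esub> cls h) = \<omega> (cls g) + \<omega> (cls h)"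
      using \<omega> that by (auto simp: state_def hom_def carrier_DG real_add_group_def)
    then show ?thesis using that by (simp add: mult_DG)
  qed
  have zero: "\<omega> (cls (\<lambda>x. 0)) = 0" using add[OF C_zero C_zero] by simp
  have uminus: "\<omega> (cls (\<lambda>x. - g x)) = - \<omega> (cls g)" if "g \<in> C" for g
    using add[OF that C_uminus[OF that]] zero by simp
  have nat_mult: "\<omega> (cls (\<lambda>x. int k * g x)) = real k * \<omega> (cls g)" if g: "g \<in> C" for k g
  proof (induction k)
    case (Suc k)
    have "\<omega> (cls (\<lambda>x. g x + int k * g x)) = \<omega> (cls g) + real k * \<omega> (cls g)"
      using add[OF g C_cmult[OF g]] Suc by simp
    then show ?case by (simp add: algebra_simps)
  qed (simp add: zero)
  have int_mult: "\<omega> (cls (\<lambda>x. i * g x)) = real_of_int i * \<omega> (cls g)" if g: "g \<in> C" for i g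
  proof (cases "0 \<le> i")
    case True
    then show ?thesis using nat_mult[OF g, of "nat i"] by simp
  next
    case False
    then show ?thesis using nat_mult[OF g, of "nat (- i)"] uminus[OF C_cmult[OF g], of i] by simp
  qed
  have ge: "m (real_fun g) \<le> \<omega> (cls g)" if g: "g \<in> C" for g
  proof (rule ccontr)
    assume "\<not> ?thesis"
    then obtain r where r: "r \<in> \<rat>" "\<omega> (cls g) < r" "r < m (real_fun g)"
      using Rats_dense_in_real[of "\<omega> (cls g)" "m (real_fun g)"] by auto
    obtain i k where ik: "k > 0" "r = real_of_int i / real_of_int k" using r(1) by (rule Rats_cases')
    define h where "h = (\<lambda>x. k * g x - i * indicator X x)"
    have hC: "h \<in> C" unfolding h_def by (intro C_diff C_cmult g C_one)
    have "real_fun h = (\<lambda>x. real_of_int k * real_fun g x - real_of_int i * one x)"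
      by (simp add: h_def of_int_indicator)
    then have "m (real_fun h) = real_of_int k * m (real_fun g) - real_of_int i"
      using g by (simp add: m_diff m_cmult bounded_on_cmult C_bounded m_one)
    also have "\<dots> > 0" using r(3) ik by (simp add: field_simps)
    finally have "cls h \<in> pos_cone G" using pos_cone_iff[OF hC] by blast
    then have "0 \<le> \<omega> (cls h)" using \<omega> by (auto simp: state_def)
    moreover have "\<omega> (cls h) = real_of_int k * \<omega> (cls g) - real_of_int i"
    proof -
      have "\<omega> (cls (indicator X)) = 1" using \<omega> by (simp add: state_def order_unit_DG)
      then show ?thesis
        using add[OF C_cmult[OF g] C_cmult[OF C_one], of k "- i"] int_mult[OF g, of k] int_mult[OF C_one, of "- i"]
        by (simp add: h_def)
    qed
    ultimately show False using r(2) ik by (simp add: field_simps)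
  qed
  have "m (real_fun (\<lambda>x. - f x)) = - m (real_fun f)"
    using m_cmult[of "real_fun f" "-1"] f by (simp add: C_bounded)
  then show ?thesis using ge[OF f] ge[OF C_uminus[OF f]] uminus[OF f] by simp
qed

lemma unique_state: "\<exists>!\<omega>. state G \<omega>"
proof -
  obtain \<omega> where \<omega>: "state G \<omega>" using state_exists by blast
  have "\<omega>' = \<omega>" if \<omega>': "state G \<omega>'" for \<omega>'
  proof (rule extensionalityI[of _ "carrier G"])
    show "\<omega>' \<in> extensional (carrier G)" "\<omega> \<in> extensional (carrier G)" using \<omega> \<omega>' by (auto simp: state_def)
    show "\<omega>' x = \<omega> x" if "x \<in> carrier G" for x
      using that state_cls[OF \<omega>] state_cls[OF \<omega>'] by (auto simp: carrier_DG)
  qed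
  with \<omega> show ?thesis by blast
qed

lemma strict_order_DG: "state G \<omega> \<Longrightarrow> has_strict_order G \<omega>"
  by (auto simp: has_strict_order_def carrier_DG group_le_iff state_cls)

section \<open>The scaling measure\<close>

lemma borel_on_subset: "{U. openin T U} \<subseteq> Pow X"
  using openin_subset[of T] by (auto simp: topspace_T)

text \<open>There are countably many cells, so each open set is a countable union of them.\<close>

lemma sets_borel_on: "sets (borel_on T) = sigma_sets X \<K>"
proof -
  have "sets (borel_on T) = sigma_sets X {U. openin T U}"
    unfolding borel_on_def topspace_T using borel_on_subset by simp
  also have "\<dots> = sigma_sets X \<K>"
  proof (rule sigma_sets_eqI)
    fix U assume "U \<in> {U. openin T U}"
    then have "U \<subseteq> X" "\<forall>p\<in>U. \<exists>K\<in>\<K>. p \<in> K \<and> K \<subseteq> U" by (auto simp: openin_iff_cells)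
    then have "U = \<Union>{K \<in> \<K>. K \<subseteq> U}" by blast
    moreover have "\<Union>{K \<in> \<K>. K \<subseteq> U} \<in> sigma_sets X \<K>"
      by (rule sigma_sets_UNION) (auto intro: countable_subset[OF _ countable_cells])
    ultimately show "U \<in> sigma_sets X \<K>" by simp
  qed (auto intro: openin_cell)
  finally show ?thesis .
qed

lemma space_borel_on: "space (borel_on T) = X"
  unfolding borel_on_def topspace_T using borel_on_subset by simp

lemma cell_in_sets: "K \<in> \<K> \<Longrightarrow> K \<in> sets (borel_on T)"
  by (simp add: sets_borel_on)

lemma step_level_in_sets: "step f \<Longrightarrow> {p \<in> X. f p \<in> S} \<in> sets (borel_on T)"
  unfolding borel_on_def topspace_T using borel_on_subset step_open[of f S] by auto

text \<open>Integration is an eigenfunctional with its own factor \<open>t\<close>, which is not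
  assumed to be \<open>s\<close>. If \<open>m g\<close> is positive then some iterate of
  \<open>g\<close> is nonnegative, so the integral of \<open>g\<close> is nonnegative too; this
  comparison forces equality with \<open>m\<close>.\<close>

lemma integral_step:
  assumes sc: "scaled_by T \<sigma> t \<mu>" and t: "0 < t" and f: "step f"
  shows "(\<integral>p. f p \<partial>\<mu>) = m f"
proof -
  interpret prob_space \<mu> using sc by (simp add: scaled_by_def)
  have sets: "sets \<mu> = sets (borel_on T)" using sc by (simp add: scaled_by_def)
  have space: "space \<mu> = X" using sets_eq_imp_space_eq[OF sets] by (simp add: space_borel_on)
  have scale: "measure \<mu> (\<sigma> ` E) = t * measure \<mu> E" if "E \<in> sets \<mu>" "inj_on \<sigma> E" for E
    using sc that by (simp add: scaled_by_def)
  have cell_sets: "K \<in> sets \<mu>" if "K \<in> \<K>" for K using cell_in_sets[OF that] sets by simp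
  have meas: "g \<in> borel_measurable \<mu>" if "step g" for g
  proof (rule measurableI)
    fix A :: "real set"
    have "g -` A \<inter> space \<mu> = {p \<in> X. g p \<in> A}" by (auto simp: space)
    then show "g -` A \<inter> space \<mu> \<in> sets \<mu>" using step_level_in_sets[OF that] sets by simp
  qed simp
  have int: "integrable \<mu> g" if g: "step g" for g
  proof -
    obtain c where "\<And>x. x \<in> X \<Longrightarrow> \<bar>g x\<bar> \<le> c" using bounded_step[OF g] by (rule bounded_onE) auto
    then show ?thesis using meas[OF g] by (intro integrable_const_bound[of _ c] AE_I2) (auto simp: space)
  qed
  have int_cell: "expectation (indicator K) = measure \<mu> K" if "K \<in> \<K>" for K
    using cell_sets[OF that] by simp
  have L_int_cell: "expectation (L (indicator K)) = t * expectation (indicator K)" if K: "K \<in> \<K>" for K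
  proof -
    have KB: "K \<inter> B \<in> \<K>" "\<sigma> ` (K \<inter> B) \<in> \<K>" if "B \<in> P" for B
      using that K P_cells cell_Int cell_image[OF that, of "K \<inter> B"] by auto
    have "expectation (L (indicator K)) = (\<integral>p. (\<Sum>B\<in>P. indicator (\<sigma> ` (K \<inter> B)) p) \<partial>\<mu>)"
      by (simp only: L_cell[OF K])
    also have "\<dots> = (\<Sum>B\<in>P. measure \<mu> (\<sigma> ` (K \<inter> B)))"
      using KB int step_indicator int_cell by (subst Bochner_Integration.integral_sum) auto
    also have "\<dots> = (\<Sum>B\<in>P. t * measure \<mu> (K \<inter> B))"
      using KB cell_sets by (intro sum.cong refl scale) (auto intro: inj_on_subset[OF inj_P])
    also have "\<dots> = t * (\<Sum>B\<in>P. measure \<mu> (K \<inter> B))" by (simp add: sum_distrib_left)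
    also have "(\<Sum>B\<in>P. measure \<mu> (K \<inter> B)) = (\<integral>p. (\<Sum>B\<in>P. indicator (K \<inter> B) p) \<partial>\<mu>)"
      using KB int step_indicator int_cell by (subst Bochner_Integration.integral_sum) auto
    also have "(\<lambda>p. \<Sum>B\<in>P. indicator (K \<inter> B) p :: real) = indicator K"
      using cell_subset[OF K] Union_P by (intro indicator_decomp[symmetric] finite_P disjoint_P) auto
    finally show ?thesis .
  qed
  have L_int_weighted: "expectation (L g) = t * expectation g" if "weighted w g" for w g
    using that
  proof (induction rule: weighted.induct)
    case zero
    then show ?case using Ln_zero[of 1] by simp
  next
    case (cell w g K c)
    have i: "integrable \<mu> g" "integrable \<mu> (indicator K :: _ \<Rightarrow> real)" "integrable \<mu> (L g)" "integrable \<mu> (L (indicator K))"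
      using step_weighted[OF cell.hyps(1)] step_indicator[OF cell.hyps(2)] step_L by (auto intro: int)
    show ?case
      unfolding L_add L_cmult
      using i cell.IH L_int_cell[OF cell.hyps(2)] by (simp add: algebra_simps)
  qed
  have L_int: "expectation (L g) = t * expectation g" if g: "step g" for g
  proof -
    obtain c where c: "0 \<le> c" "\<And>x. x \<in> X \<Longrightarrow> \<bar>g x\<bar> \<le> c" using bounded_step[OF g] by (rule bounded_onE) auto
    have sc: "step (\<lambda>x. c * one x)" by (intro step_cmult step_one)
    have s: "step (\<lambda>x. g x + c * one x)" by (intro step_add g sc)
    have "0 \<le> g x + c * one x" if "x \<in> X" for x using c(2)[OF that] that by simp
    then obtain w where "weighted w (\<lambda>x. g x + c * one x)" using nonneg_step_weighted[OF s] by blast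
    then have 1: "(\<integral>p. L (\<lambda>x. g x + c * one x) p \<partial>\<mu>) = t * (\<integral>p. g p + c * one p \<partial>\<mu>)" by (rule L_int_weighted)
    have 2: "(\<integral>p. L (\<lambda>x. c * one x) p \<partial>\<mu>) = t * (\<integral>p. c * one p \<partial>\<mu>)"
      by (rule L_int_weighted[OF weighted_indicator[OF X_cell c(1)]])
    show ?thesis
      using 1 2 int[OF g] int[OF sc] int[OF step_L[OF g]] int[OF step_L[OF sc]] unfolding L_add
      by (simp add: distrib_left)
  qed
  have Ln_int: "expectation ((L ^^ k) g) = t ^ k * expectation g" if g: "step g" for g k
    by (induction k) (simp_all add: L_int[OF step_Ln[OF g]])
  have pos: "0 \<le> expectation g" if g: "step g" "0 < m g" for g
  proof -
    obtain k where k: "\<forall>x\<in>X. 0 \<le> (L ^^ k) g x" using Ln_nonneg_of_m_pos[OF g] by blast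
    then have "0 \<le> expectation ((L ^^ k) g)" by (intro Bochner_Integration.integral_nonneg_AE AE_I2) (auto simp: space)
    then show ?thesis using Ln_int[OF g(1), of k] zero_less_power[OF t, of k] by (simp add: zero_le_mult_iff)
  qed
  have ge: "m g \<le> expectation g" if g: "step g" for g
  proof (rule field_le_epsilon)
    fix e :: real assume "0 < e"
    \<comment> \<open>Shifted so that \<open>m h = e\<close> is positive.\<close>
    define h where "h = (\<lambda>x. g x - (m g - e) * one x)"
    have so: "step (\<lambda>x. (m g - e) * one x)" by (intro step_cmult step_one)
    have sh: "step h" unfolding h_def by (intro step_diff g so)
    have "m h = e" unfolding h_def
      by (simp add: m_diff[OF bounded_step[OF g] bounded_step[OF so]] m_cmult m_one)
    then have "0 \<le> expectation h" using pos[OF sh] \<open>0 < e\<close> by simp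
    moreover have "expectation one = 1" using prob_space by (simp add: int_cell[OF X_cell] space)
    then have "expectation h = expectation g - (m g - e)"
      unfolding h_def using int[OF g] int[OF so] by simp
    ultimately show "m g \<le> expectation g + e" by simp
  qed
  \<comment> \<open>The reverse inequality is \<open>ge\<close> applied to
    \<open>- f\<close>.\<close>
  have "m (\<lambda>x. (-1) * f x) = - m f" using m_cmult[OF bounded_step[OF f], of "-1"] by simp
  then show ?thesis using ge[OF f] ge[OF step_cmult[OF f, of "-1"]] by simp
qed

lemma scaling_measure_unique:
  assumes "scaling_measure T \<sigma> \<mu>" "scaling_measure T \<sigma> \<nu>"
  shows "\<mu> = \<nu>"
proof -
  obtain t u where t: "0 < t" "scaled_by T \<sigma> t \<mu>" and u: "0 < u" "scaled_by T \<sigma> u \<nu>"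
    using assms by (auto simp: scaling_measure_def)
  interpret M: prob_space \<mu> using t by (simp add: scaled_by_def)
  interpret N: prob_space \<nu> using u by (simp add: scaled_by_def)
  have sets: "sets \<mu> = sigma_sets X \<K>" "sets \<nu> = sigma_sets X \<K>"
    using t u by (auto simp: scaled_by_def sets_borel_on)
  show ?thesis
  proof (rule measure_eqI_generator_eq[of \<K> X _ _ "\<lambda>_. X"])
    show "Int_stable \<K>" using cell_Int by (auto simp: Int_stable_def)
    show "\<K> \<subseteq> Pow X" using cell_subset by auto
    show "emeasure \<mu> K = emeasure \<nu> K" if K: "K \<in> \<K>" for K
    proof -
      have Ks: "K \<in> sets \<mu>" "K \<in> sets \<nu>" using K by (auto simp: sets)
      have "measure \<mu> K = m (indicator K)" using integral_step[OF t(2,1) step_indicator[OF K]] Ks(1) by simp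
      moreover have "measure \<nu> K = m (indicator K)" using integral_step[OF u(2,1) step_indicator[OF K]] Ks(2) by simp
      ultimately show ?thesis by (simp add: M.emeasure_eq_measure N.emeasure_eq_measure)
    qed
  qed (use sets X_cell in auto)
qed

text \<open>The sets with step indicator form an algebra of open sets with open complements. A
  decreasing sequence of them with empty intersection is eventually empty by compactness, which
  gives the continuity at the empty set required for the extension.\<close>

lemma scaling_measure_exists: "\<exists>\<mu>. scaling_measure T \<sigma> \<mu>"
proof -
  define \<A> where "\<A> = {A. A \<subseteq> X \<and> step (indicator A)}"
  have K\<A>: "\<K> \<subseteq> \<A>" using cell_subset step_indicator by (auto simp: \<A>_def)
  have diff: "A - B \<in> \<A>" if "A \<in> \<A>" "B \<in> \<A>" for A B
  proof -
    \<comment> \<open>For values 0 and 1, \<open>u * (u - v)\<close> is the indicator of the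
      difference.\<close>
    have "step (\<lambda>x. indicator A x * (indicator A x - indicator B x))"
      using that by (intro step_comb[where h="\<lambda>u v. u * (u - v)"]) (auto simp: \<A>_def)
    moreover have "(\<lambda>x. indicator A x * (indicator A x - indicator B x) :: real) = indicator (A - B)"
      by (auto simp: indicator_def)
    ultimately show ?thesis using that by (auto simp: \<A>_def)
  qed
  interpret \<A>: algebra X \<A>
  proof (rule algebra_iff_Un[THEN iffD2], intro conjI ballI)
    show "\<A> \<subseteq> Pow X" by (auto simp: \<A>_def)
    have "X \<in> \<A>" using K\<A> X_cell by auto
    then show "{} \<in> \<A>" using diff[of X X] by simp
    show "X - A \<in> \<A>" if "A \<in> \<A>" for A using diff[OF \<open>X \<in> \<A>\<close> that] .
    show "A \<union> B \<in> \<A>" if "A \<in> \<A>" "B \<in> \<A>" for A B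
    proof -
      have "A \<union> B = X - ((X - A) - B)" using that by (auto simp: \<A>_def)
      then show ?thesis using diff that \<open>X \<in> \<A>\<close> by metis
    qed
  qed
  have open\<A>: "openin T A" if "A \<in> \<A>" for A
  proof -
    have "{p \<in> X. indicator A p \<in> {1::real}} = A" using that by (auto simp: \<A>_def indicator_def)
    then show ?thesis using step_open[of "indicator A" "{1}"] that by (auto simp: \<A>_def)
  qed
  define \<mu>0 where "\<mu>0 A = ennreal (m (indicator A))" for A
  have "\<exists>\<mu>. (\<forall>A\<in>\<A>. \<mu> A = \<mu>0 A) \<and> measure_space X (sigma_sets X \<A>) \<mu>"
  proof (rule \<A>.caratheodory_empty_continuous)
    have "indicator {} = (\<lambda>x :: 'a. 0 :: real)" by (auto simp: indicator_def)
    then have empty: "\<mu>0 {} = 0" by (simp add: \<mu>0_def m_zero)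
    then show "positive \<A> \<mu>0" by (simp add: positive_def)
    show "additive \<A> \<mu>0"
      unfolding additive_def
    proof (intro ballI impI)
      fix A B assume "A \<in> \<A>" "B \<in> \<A>" "A \<inter> B = {}"
      then have "indicator (A \<union> B) = (\<lambda>x. indicator A x + indicator B x :: real)"
        by (intro ext) (auto simp: indicator_def)
      then show "\<mu>0 (A \<union> B) = \<mu>0 A + \<mu>0 B"
        by (simp add: \<mu>0_def m_add m_indicator_nonneg ennreal_plus)
    qed
    show "\<mu>0 A \<noteq> \<infinity>" for A by (simp add: \<mu>0_def)
    show "(\<lambda>i. \<mu>0 (A i)) \<longlonglongrightarrow> 0" if A: "range A \<subseteq> \<A>" "decseq A" "(\<Inter>i. A i) = {}" for A :: "nat \<Rightarrow> _"
    proof -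
      have "\<forall>U\<in>range (\<lambda>i. X - A i). openin T U" using A(1) \<A>.compl_sets open\<A> by blast
      moreover have "topspace T \<subseteq> \<Union>(range (\<lambda>i. X - A i))" using A(3) by (auto simp: topspace_T)
      ultimately obtain \<F> where F: "finite \<F>" "\<F> \<subseteq> range (\<lambda>i. X - A i)" "topspace T \<subseteq> \<Union>\<F>"
        using compact_T unfolding compact_space_alt by meson
      then obtain I where I: "finite I" "\<F> = (\<lambda>i. X - A i) ` I" by (meson finite_subset_image)
      \<comment> \<open>Inserting 0 makes the maximum meaningful when \<open>I\<close> is
        empty.\<close>
      have "A k = {}" if "Max (insert 0 I) \<le> k" for k
      proof -
        have "A k \<subseteq> A i" if "i \<in> I" for i
          using that \<open>Max (insert 0 I) \<le> k\<close> I(1) by (intro decseqD[OF A(2)]) auto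
        moreover have "A k \<subseteq> \<Union>\<F>" using A(1) F(3) unfolding topspace_T \<A>_def by blast
        ultimately show ?thesis unfolding I(2) by blast
      qed
      then have "eventually (\<lambda>k. \<mu>0 (A k) = 0) sequentially"
        using empty unfolding eventually_sequentially by (metis)
      then show ?thesis by (rule tendsto_eventually)
    qed
  qed
  then obtain \<nu> where \<nu>: "\<And>A. A \<in> \<A> \<Longrightarrow> \<nu> A = \<mu>0 A" "measure_space X (sigma_sets X \<A>) \<nu>" by blast
  define \<mu> where "\<mu> = measure_of X \<A> \<nu>"
  have \<A>X: "\<A> \<subseteq> Pow X" by (auto simp: \<A>_def)
  have sets: "sets \<mu> = sigma_sets X \<A>" and space: "space \<mu> = X" by (simp_all add: \<mu>_def \<A>X)
  have sets_borel: "sets \<mu> = sets (borel_on T)"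
  proof -
    have "sigma_sets X \<A> = sigma_sets X {U. openin T U}"
    proof (rule sigma_sets_eqI)
      show "U \<in> sigma_sets X \<A>" if "U \<in> {U. openin T U}" for U
      proof -
        have "U \<in> sets (borel_on T)" using that borel_on_subset by (auto simp: borel_on_def topspace_T)
        then have "U \<in> sigma_sets X \<K>" by (simp add: sets_borel_on)
        then show ?thesis using sigma_sets_mono'[OF K\<A>] by blast
      qed
    qed (use open\<A> in auto)
    then show ?thesis using borel_on_subset by (simp add: sets borel_on_def topspace_T)
  qed
  have emeasure: "emeasure \<mu> A = \<mu>0 A" if "A \<in> \<A>" for A
  proof -
    have "A \<in> sigma_sets X \<A>" using that by auto
    moreover have "positive (sigma_sets X \<A>) \<nu>" "countably_additive (sigma_sets X \<A>) \<nu>"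
      using \<nu>(2) by (auto simp: measure_space_def)
    ultimately have "emeasure \<mu> A = \<nu> A"
      unfolding \<mu>_def by (intro emeasure_measure_of[OF refl \<A>X]) (auto simp: \<A>X)
    then show ?thesis using \<nu>(1)[OF that] by simp
  qed
  have prob: "prob_space \<mu>"
    by (rule prob_spaceI) (use emeasure[of X] K\<A> X_cell in \<open>auto simp: space \<mu>0_def m_one\<close>)
  interpret prob_space \<mu> by (rule prob)
  have measure: "measure \<mu> A = m (indicator A)" if "A \<in> \<A>" for A
    using emeasure[OF that] by (simp add: measure_def \<mu>0_def m_indicator_nonneg)
  \<comment> \<open>Dynkin's argument: as \<open>\<sigma>\<close> is injective on \<open>B\<close>,
    images commute with differences and preserve disjointness; on the generating algebra the
    identity is \<open>m (L f) = s * m f\<close>.\<close>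
  have piece: "\<sigma> ` (E \<inter> B) \<in> sets \<mu> \<and> measure \<mu> (\<sigma> ` (E \<inter> B)) = s * measure \<mu> (E \<inter> B)"
    if B: "B \<in> P" and E: "E \<in> sets \<mu>" for B E
  proof -
    have B\<A>: "B \<in> \<A>" using B P_cells K\<A> by auto
    have BX: "B \<subseteq> X" using B Union_P by auto
    have Bs: "B \<in> sets \<mu>" using B\<A> sets by auto
    have base: "\<sigma> ` (A \<inter> B) \<in> sets \<mu> \<and> measure \<mu> (\<sigma> ` (A \<inter> B)) = s * measure \<mu> (A \<inter> B)" if A: "A \<in> \<A>" for A
    proof -
      have AB: "A \<inter> B \<in> \<A>" using A B\<A> by auto
      have L: "L (indicator (A \<inter> B)) = indicator (\<sigma> ` (A \<inter> B))"
        using BX by (intro L_indicator_inj) (auto intro: inj_on_subset[OF inj_P[OF B]])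
      have "step (indicator (\<sigma> ` (A \<inter> B)))" using step_L[of "indicator (A \<inter> B)"] AB by (simp add: L \<A>_def)
      then have \<sigma>AB: "\<sigma> ` (A \<inter> B) \<in> \<A>" using BX maps by (auto simp: \<A>_def)
      have "m (indicator (\<sigma> ` (A \<inter> B))) = s * m (indicator (A \<inter> B))"
        using m_L[of "indicator (A \<inter> B)"] by (simp add: L)
      then show ?thesis using \<sigma>AB AB sets measure by auto
    qed
    note injB = inj_P[OF B]
    have "Int_stable \<A>" by (auto simp: Int_stable_def)
    moreover note \<A>X
    moreover have "E \<in> sigma_sets X \<A>" using E by (simp add: sets)
    ultimately show ?thesis
    proof (induction rule: sigma_sets_induct_disjoint)
      case (basic A)
      then show ?case by (rule base)
    next
      case empty
      show ?case by simp
    next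
      case (compl A)
      have eq: "\<sigma> ` ((X - A) \<inter> B) = \<sigma> ` (X \<inter> B) - \<sigma> ` (A \<inter> B)" "(X - A) \<inter> B = (X \<inter> B) - (A \<inter> B)"
        using inj_on_image_set_diff[OF injB, of "X \<inter> B" "A \<inter> B"] by auto
      have X: "\<sigma> ` (X \<inter> B) \<in> sets \<mu> \<and> measure \<mu> (\<sigma> ` (X \<inter> B)) = s * measure \<mu> (X \<inter> B)"
        by (rule base) auto
      have A: "A \<in> sets \<mu>" "A \<subseteq> X" using compl(1) sigma_sets_into_sp[OF \<A>X compl(1)] by (auto simp: sets)
      have "X \<in> sets \<mu>" using space by auto
      have "measure \<mu> (\<sigma> ` ((X - A) \<inter> B)) = measure \<mu> (\<sigma> ` (X \<inter> B)) - measure \<mu> (\<sigma> ` (A \<inter> B))"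
        unfolding eq(1) using X compl A(2) by (intro finite_measure_Diff) auto
      also have "\<dots> = s * (measure \<mu> (X \<inter> B) - measure \<mu> (A \<inter> B))"
        using X compl by (simp add: right_diff_distrib)
      also have "measure \<mu> (X \<inter> B) - measure \<mu> (A \<inter> B) = measure \<mu> ((X - A) \<inter> B)"
        unfolding eq(2) using A Bs \<open>X \<in> sets \<mu>\<close> by (intro finite_measure_Diff[symmetric]) auto
      finally show ?case using X compl unfolding eq(1) by auto
    next
      case (union A)
      have As: "A i \<in> sets \<mu>" for i using union sets by auto
      have img: "(\<Union>i. A i) \<inter> B = (\<Union>i. A i \<inter> B)" by auto
      have d1: "disjoint_family (\<lambda>i. A i \<inter> B)" using union(1) by (auto simp: disjoint_family_on_def)
      have d2: "disjoint_family (\<lambda>i. \<sigma> ` (A i \<inter> B))"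
        using union(1) injB unfolding disjoint_family_on_def inj_on_def by blast
      have "(\<lambda>i. measure \<mu> (\<sigma> ` (A i \<inter> B))) sums measure \<mu> (\<Union>i. \<sigma> ` (A i \<inter> B))"
        using union by (intro finite_measure_UNION d2) auto
      moreover have "(\<lambda>i. measure \<mu> (A i \<inter> B)) sums measure \<mu> (\<Union>i. A i \<inter> B)"
        using As Bs by (intro finite_measure_UNION d1) auto
      then have "(\<lambda>i. s * measure \<mu> (A i \<inter> B)) sums (s * measure \<mu> (\<Union>i. A i \<inter> B))" by (rule sums_mult)
      ultimately have "measure \<mu> (\<Union>i. \<sigma> ` (A i \<inter> B)) = s * measure \<mu> (\<Union>i. A i \<inter> B)"
        using union by (simp add: sums_unique2)
      moreover have "(\<Union>i. \<sigma> ` (A i \<inter> B)) \<in> sets \<mu>" using union by auto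
      ultimately show ?case unfolding img image_UN by blast
    qed
  qed
  have "measure \<mu> (\<sigma> ` E) = s * measure \<mu> E" if E: "E \<in> sets \<mu>" "inj_on \<sigma> E" for E
  proof -
    have EX: "E \<subseteq> X" using sets.sets_into_space[OF E(1)] space by simp
    have PB: "B \<in> sets \<mu>" if "B \<in> P" for B using that P_cells K\<A> sets by auto
    have disj: "disjoint_family_on (\<lambda>B. E \<inter> B) P"
      using disjoint_P by (auto simp: disjoint_family_on_def disjoint_def)
    \<comment> \<open>Injectivity on all of \<open>E\<close>, not merely on each piece, keeps the
      images of different pieces disjoint.\<close>
    have disj_img: "disjoint_family_on (\<lambda>B. \<sigma> ` (E \<inter> B)) P"
      using disj E(2) unfolding disjoint_family_on_def inj_on_def by blast
    have "\<sigma> ` E = (\<Union>B\<in>P. \<sigma> ` (E \<inter> B))" "E = (\<Union>B\<in>P. E \<inter> B)" using EX Union_P by auto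
    then have "measure \<mu> (\<sigma> ` E) = (\<Sum>B\<in>P. measure \<mu> (\<sigma> ` (E \<inter> B)))" "measure \<mu> E = (\<Sum>B\<in>P. measure \<mu> (E \<inter> B))"
      using finite_measure_finite_Union[OF finite_P _ disj_img] finite_measure_finite_Union[OF finite_P _ disj]
        piece E(1) PB by (auto simp: image_subset_iff)
    then show ?thesis using piece E(1) by (simp add: sum_distrib_left)
  qed
  then have "scaled_by T \<sigma> s \<mu>" using prob sets_borel by (simp add: scaled_by_def)
  then show ?thesis using s_pos by (auto simp: scaling_measure_def)
qed

end

theorem corollary5p5:
  fixes \<tau> :: "real \<Rightarrow> real" and n :: nat and a :: "nat \<Rightarrow> real"
    and \<sigma> :: "real \<times> bool \<Rightarrow> real \<times> bool"
  assumes "piecewise_monotonic \<tau>"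
    and "associated_partition \<tau> n a"
    and "topologically_exact \<tau> n a"
    and "associated_map \<tau> n a \<sigma>"
  shows "simple_ordered_group (DG (X_top \<tau> n a) \<sigma>)
    \<and> (\<exists>!\<mu>. scaling_measure (X_top \<tau> n a) \<sigma> \<mu>)
    \<and> (\<exists>!\<omega>. state (DG (X_top \<tau> n a) \<sigma>) \<omega>)
    \<and> (\<forall>\<mu> \<omega>. scaling_measure (X_top \<tau> n a) \<sigma> \<mu> \<and> state (DG (X_top \<tau> n a) \<sigma>) \<omega> \<longrightarrow>
         (\<forall>f \<in> C_int (X_top \<tau> n a).
            \<omega> (DG_class (X_top \<tau> n a) \<sigma> f) = (\<integral>p. real_of_int (f p) \<partial>\<mu>))
         \<and> has_strict_order (DG (X_top \<tau> n a) \<sigma>) \<omega>)"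
proof -
  interpret exact_interval_map \<tau> n a \<sigma>
    using assms by unfold_locales (auto simp: piecewise_monotonic_def associated_partition_def)
  obtain s m where sm: "conformal_system X \<sigma> branch_cells cells s m" by (rule sys.exists_conformal)
  interpret conformal_system X \<sigma> branch_cells cells s m by (rule sm)
  interpret conformal_space X \<sigma> branch_cells cells "split_topology D" s m by unfold_locales
  \<comment> \<open>State and integral are compared through their common value
    \<open>m (real_fun f)\<close>.\<close>
  have "\<omega> (cls f) = (\<integral>p. real_of_int (f p) \<partial>\<mu>)"
    if "scaling_measure (split_topology D) \<sigma> \<mu>" "state G \<omega>" "f \<in> C" for \<mu> \<omega> f
    using that state_cls integral_step[of _ \<mu> "real_fun f"] C_iff_step by (auto simp: scaling_measure_def)
  then show ?thesis
    unfolding X_top_def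
    using simple_DG unique_state strict_order_DG scaling_measure_exists scaling_measure_unique by blast
qed

end
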